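(* Let $r\in\mathbb{N}$ and $\boldsymbol{l}=(l_1,\dots,l_r)\in\mathbb{N}_0^r$ with $l_1\ge 1$, and put $|\boldsymbol{l}|:=l_1+\cdots+l_r$. Then $$\zeta_r^{\rm reg}(-\boldsymbol{l})=(-1)^{r+|\boldsymbol{l}|}\,\zeta_r^{\star\,\rm reg}(-\boldsymbol{l}),\qquad \zeta_r^{\rm rev}(-\boldsymbol{l})=(-1)^{r+|\boldsymbol{l}|}\,\zeta_r^{\star\,\rm rev}(-\boldsymbol{l}).$$
   Context: $\mathbb{N}=\{1,2,\dots\}$, $\mathbb{N}_0=\mathbb{N}\cup\{0\}$, $-\boldsymbol{l}=(-l_1,\dots,-l_r)$. The multiple zeta function and the multiple zeta star function are $$\zeta_r(s_1,\dots,s_r)=\sum_{0<n_1<\cdots<n_r} \frac{1}{n_1^{s_1}\cdots n_r^{s_r}},\qquad \zeta_r^{\star}(s_1,\dots,s_r)=\sum_{0<n_1\le\cdots\le n_r} \frac{1}{n_1^{s_1}\cdots n_r^{s_r}}.$$ Both converge absolutely when $\mathrm{Re}(s_{r-k+1}+\cdots+s_r)>k$ for $k=1,\dots,r$ and have meromorphic continuations to $\mathbb{C}^r$, denoted by the same symbols. For $F=\zeta_r$ or $F=\zeta_r^\star$ the regular and reverse values are the iterated limits of the continuation $$F^{\rm reg}(-\boldsymbol{l}):=\lim_{s_1\to -l_1}\cdots\lim_{s_r\to -l_r}F(s_1,\dots,s_r),\qquad F^{\rm rev}(-\boldsymbol{l}):=\lim_{s_r\to -l_r}\cdots\lim_{s_1\to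 -l_1}F(s_1,\dots,s_r),$$ where the innermost (rightmost) limit is taken first: for reg, first $s_r\to -l_r$ and last $s_1\to -l_1$; for rev, first $s_1\to -l_1$ and last $s_r\to -l_r$. *)

theory Defs
  imports "HOL-Analysis.Analysis" "HOL-Complex_Analysis.Complex_Analysis"
begin

text \<open>
  A point of \<open>\<complex>\<^sup>r\<close> is an extensional function on the index set \<open>{1..r}\<close>.  The topology of
  \<open>\<complex>\<^sup>r\<close> is then the subspace topology inherited from the library's product topology on
  \<open>nat \<Rightarrow> complex\<close>.
\<close>

abbreviation Cspace :: "nat \<Rightarrow> (nat \<Rightarrow> complex) set" where
  "Cspace r \<equiv> {1..r} \<rightarrow>\<^sub>E UNIV"

definition polydisc :: "nat \<Rightarrow> (nat \<Rightarrow> complex) \<Rightarrow> real \<Rightarrow> (nat \<Rightarrow> complex) set" where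
  "polydisc r p e = (\<Pi>\<^sub>E i\<in>{1..r}. ball (p i) e)"

definition holomorphic_several ::
    "nat \<Rightarrow> ((nat \<Rightarrow> complex) \<Rightarrow> complex) \<Rightarrow> (nat \<Rightarrow> complex) set \<Rightarrow> bool" where
  "holomorphic_several r f U \<longleftrightarrow>
     continuous_on U f \<and>
     (\<forall>z\<in>U. \<forall>i\<in>{1..r}. (\<lambda>w. f (z(i := w))) holomorphic_on {w. z(i := w) \<in> U})"

text \<open>
  Meromorphic on \<open>\<complex>\<^sup>r\<close>: locally a quotient \<open>g / h\<close> of holomorphic functions, where \<open>h\<close> does
  not vanish identically.  HOL functions being total, \<open>F\<close> also has values on the zero sets of
  the denominators; these values are left unconstrained.
\<close>

definition meromorphic_several :: "nat \<Rightarrow> ((nat \<Rightarrow> complex) \<Rightarrow> complex) \<Rightarrow> bool" where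
  "meromorphic_several r F \<longleftrightarrow>
     (\<forall>p\<in>Cspace r. \<exists>e>0. \<exists>g h.
        holomorphic_several r g (polydisc r p e) \<and>
        holomorphic_several r h (polydisc r p e) \<and>
        (\<exists>z\<in>polydisc r p e. h z \<noteq> 0) \<and>
        (\<forall>z\<in>polydisc r p e. h z \<noteq> 0 \<longrightarrow> F z = g z / h z))"

definition zeta_term :: "nat \<Rightarrow> (nat \<Rightarrow> complex) \<Rightarrow> (nat \<Rightarrow> nat) \<Rightarrow> complex" where
  "zeta_term r s n = 1 / (\<Prod>i=1..r. of_nat (n i) powr s i)"

definition multi_zeta_series :: "nat \<Rightarrow> (nat \<Rightarrow> complex) \<Rightarrow> complex" where
  "multi_zeta_series r s =
     infsum (zeta_term r s) {n \<in> {1..r} \<rightarrow>\<^sub>E {1..}. strict_mono_on {1..r} n}"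

definition multi_zeta_star_series :: "nat \<Rightarrow> (nat \<Rightarrow> complex) \<Rightarrow> complex" where
  "multi_zeta_star_series r s =
     infsum (zeta_term r s) {n \<in> {1..r} \<rightarrow>\<^sub>E {1..}. mono_on {1..r} n}"

definition convergence_domain :: "nat \<Rightarrow> (nat \<Rightarrow> complex) set" where
  "convergence_domain r =
     {s \<in> Cspace r. \<forall>k\<in>{1..r}. Re (\<Sum>i=r-k+1..r. s i) > real k}"

definition meromorphic_continuation ::
    "nat \<Rightarrow> ((nat \<Rightarrow> complex) \<Rightarrow> complex) \<Rightarrow> ((nat \<Rightarrow> complex) \<Rightarrow> complex) \<Rightarrow> bool" where
  "meromorphic_continuation r f F \<longleftrightarrow>
     meromorphic_several r F \<and> (\<forall>s\<in>convergence_domain r. F s = f s)"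

text \<open>
  The continuation is unique as a meromorphic function, that is, up to values on the zero set
  of a local denominator.  Such a set is avoided by all points that matter for an
  iterated limit (a nonzero holomorphic \<open>h\<close> is nonzero for all \<open>s\<^sub>1\<close> near but different from
  \<open>a\<^sub>1\<close>, then all \<open>s\<^sub>2\<close> near but different from \<open>a\<^sub>2\<close>, and so on, in any order of the variables),
  so the iterated limits below do not depend on the representative picked here.
\<close>

definition multi_zeta :: "nat \<Rightarrow> (nat \<Rightarrow> complex) \<Rightarrow> complex" where
  "multi_zeta r = (SOME F. meromorphic_continuation r (multi_zeta_series r) F)"

definition multi_zeta_star :: "nat \<Rightarrow> (nat \<Rightarrow> complex) \<Rightarrow> complex" where
  "multi_zeta_star r = (SOME F. meromorphic_continuation r (multi_zeta_star_series r) F)"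

text \<open>
  \<open>has_iterated_limit [i\<^sub>1, \<dots>, i\<^sub>m] a F s v\<close> says that
  \<open>lim\<^bsub>s i\<^sub>1 \<rightarrow> a i\<^sub>1\<^esub> \<dots> lim\<^bsub>s i\<^sub>m \<rightarrow> a i\<^sub>m\<^esub> F s\<close> exists and equals \<open>v\<close>: the head of the list is the
  outermost limit, taken last.  An inner limit has to exist only for outer variables in a
  punctured neighbourhood of their limit points, because the inner limits are themselves
  meromorphic functions of the outer variables.
\<close>

primrec has_iterated_limit ::
    "nat list \<Rightarrow> (nat \<Rightarrow> complex) \<Rightarrow> ((nat \<Rightarrow> complex) \<Rightarrow> complex) \<Rightarrow> (nat \<Rightarrow> complex)
      \<Rightarrow> complex \<Rightarrow> bool" where
  "has_iterated_limit [] a F s v \<longleftrightarrow> F s = v"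
| "has_iterated_limit (i # is) a F s v \<longleftrightarrow>
     (\<exists>f. (\<forall>\<^sub>F z in at (a i). has_iterated_limit is a F (s(i := z)) (f z)) \<and>
          (f \<longlongrightarrow> v) (at (a i)))"

lemma has_iterated_limit_unique:
  assumes "has_iterated_limit is a F s v" and "has_iterated_limit is a F s w"
  shows "v = w"
  using assms
proof (induction "is" arbitrary: s v w)
  case Nil
  then show ?case by simp
next
  case (Cons i "is")
  obtain f g where
    f: "\<forall>\<^sub>F z in at (a i). has_iterated_limit is a F (s(i := z)) (f z)" "(f \<longlongrightarrow> v) (at (a i))" and
    g: "\<forall>\<^sub>F z in at (a i). has_iterated_limit is a F (s(i := z)) (g z)" "(g \<longlongrightarrow> w) (at (a i))"
    using Cons.prems by auto
  have "\<forall>\<^sub>F z in at (a i). g z = f z"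
    using f(1) g(1) by eventually_elim (rule Cons.IH)
  with g(2) have "(f \<longlongrightarrow> w) (at (a i))"
    by (rule Lim_transform_eventually)
  with f(2) show ?case
    by (rule tendsto_unique[OF trivial_limit_at])
qed

text \<open>
  The starting point \<open>0\<close> below is immaterial: all \<open>r\<close> coordinates are overwritten by the limit
  variables.
\<close>

definition has_reg_value ::
    "nat \<Rightarrow> ((nat \<Rightarrow> complex) \<Rightarrow> complex) \<Rightarrow> (nat \<Rightarrow> nat) \<Rightarrow> complex \<Rightarrow> bool" where
  "has_reg_value r F l v \<longleftrightarrow>
     has_iterated_limit [1..<Suc r] (\<lambda>i. - of_nat (l i)) F (\<lambda>i\<in>{1..r}. 0) v"

definition has_rev_value ::
    "nat \<Rightarrow> ((nat \<Rightarrow> complex) \<Rightarrow> complex) \<Rightarrow> (nat \<Rightarrow> nat) \<Rightarrow> complex \<Rightarrow> bool" where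
  "has_rev_value r F l v \<longleftrightarrow>
     has_iterated_limit (rev [1..<Suc r]) (\<lambda>i. - of_nat (l i)) F (\<lambda>i\<in>{1..r}. 0) v"

definition reg_value :: "nat \<Rightarrow> ((nat \<Rightarrow> complex) \<Rightarrow> complex) \<Rightarrow> (nat \<Rightarrow> nat) \<Rightarrow> complex" where
  "reg_value r F l = (THE v. has_reg_value r F l v)"

definition rev_value :: "nat \<Rightarrow> ((nat \<Rightarrow> complex) \<Rightarrow> complex) \<Rightarrow> (nat \<Rightarrow> nat) \<Rightarrow> complex" where
  "rev_value r F l = (THE v. has_rev_value r F l v)"

end

theory Submission
  imports Defs
begin

text \<open>
  Summing first over the largest index, a multiple zeta value is an iterated tail
  \<open>n \<mapsto> \<Sum>m>n. m\<^bsup>-s\<^esup> g(m)\<close>.  If \<open>g\<close> has an asymptotic expansion in the powers \<open>n\<^bsup>-a-j\<^esup>\<close> (\<open>j \<in> \<nat>\<close>), so has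
  its tail, with coefficients given by a convolution with Bernoulli numbers; prescribing this
  expansion defines the tail also where the series diverges.  After clearing finitely many linear
  denominators all this is holomorphic in the exponents, which gives the meromorphic continuation,
  and an identity theorem shows that any other continuation has the same iterated limits.
  The star version only adds the term \<open>m = n\<close> to each tail; a parameter \<open>\<delta> \<in> {0, 1}\<close> treats both
  versions at once.

  Setting \<open>s\<^sub>r = -l\<close> turns the innermost tail into a polynomial, and setting \<open>s\<^sub>1 = -l\<close> turns the
  innermost finite sum (after summation by parts) into a polynomial.  Either way the depth drops
  by one, and both limits become finite combinations of the values \<open>\<zeta>(-m)\<close>.
  The reflection \<open>B(-x) = B(x) + x\<close> of \<open>B(x) = x / (e\<^sup>x - 1)\<close> says that the polynomials for the two
  versions correspond to each other under \<open>n \<mapsto> -n\<close> up to sign, and \<open>\<zeta>(-m) = 0\<close> for even \<open>m \<ge> 2\<close>; the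
  hypothesis \<open>l\<^sub>1 \<ge> 1\<close> excludes \<open>m = 0\<close>.
\<close>

section \<open>Euler--Maclaurin coefficients\<close>

text \<open>The limit points may lie on polar hyperplanes, so no value of the continuation there can
  be used. Each limit is taken while the remaining variables are generic, and must be recognised as
  a combination of the same functions in one variable fewer. Eliminating an exponent
  \<open>-l\<close> next to \<open>s\<close> leaves exponents \<open>s - j\<close> with
  \<open>j \<le> Suc l\<close>; on the level of limit points the pair \<open>l, m\<close> becomes
  \<open>m + j\<close>. Depth plus weight thereby drops by \<open>l + 1 - j\<close>, which is
  precisely the index of the Bernoulli number in the coefficient of \<open>n ^ j\<close>. So the
  sign produced by the reflection of \<open>B\<close> is the sign that the theorem asks for, and an
  induction on the depth closes. In the regular order the surviving exponent is \<open>l 1\<close>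
  plus a natural number, hence positive. In the reverse order \<open>l 1\<close> is consumed first,
  but for \<open>l 1 \<ge> 1\<close> the constant coefficient of the polynomial vanishes, so only
  \<open>j \<ge> 1\<close> contributes and the next exponent is again positive.\<close>

definition npow :: "nat \<Rightarrow> complex \<Rightarrow> complex" where
  "npow n s = of_nat n powr (- s)"

lemma npow_1 [simp]: "npow 1 s = 1" "npow (Suc 0) s = 1"
  by (simp_all add: npow_def)

lemma npow_0 [simp]: "n \<ge> 1 \<Longrightarrow> npow n 0 = 1"
  by (simp add: npow_def)

lemma npow_add: "npow n (a + b) = npow n a * npow n b"
  by (simp add: npow_def flip: powr_add)

lemma npow_neg_of_nat: "n \<ge> 1 \<Longrightarrow> npow n (- of_nat k) = of_nat n ^ k"
  by (simp add: npow_def)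

lemma npow_of_nat: "n \<ge> 1 \<Longrightarrow> npow n (of_nat k) = 1 / of_nat n ^ k"
  by (simp add: npow_def powr_minus divide_inverse)

lemma norm_npow: "norm (npow n s) = real n powr (- Re s)"
  by (simp add: npow_def norm_powr_real_powr)

lemma npow_eq_exp: "n \<ge> 1 \<Longrightarrow> npow n s = exp (- s * of_real (ln (real n)))"
  by (simp add: npow_def powr_def Ln_of_nat)

lemma npow_mult: "npow (m * n) s = npow m s * npow n s"
  by (simp add: npow_def powr_times_real)

lemma npow_tendsto_0:
  assumes "Re s > 0" shows "(\<lambda>N. npow N s) \<longlonglongrightarrow> 0"
proof (rule tendsto_norm_zero_cancel)
  have "(\<lambda>N. real N powr (- Re s)) \<longlonglongrightarrow> 0"
    using assms by (intro tendsto_neg_powr filterlim_real_sequentially) auto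
  then show "(\<lambda>N. norm (npow N s)) \<longlonglongrightarrow> 0" by (simp add: norm_npow)
qed

section \<open>Bernoulli numbers and the formal Euler--Maclaurin identity\<close>

definition bern_fps :: "complex fps" where
  "bern_fps = inverse (Abs_fps (\<lambda>n. 1 / fact (Suc n)))"

text \<open>The Bernoulli number \<open>B_n\<close> divided by \<open>n!\<close>, in the convention
  \<open>B_1 = -1/2\<close>.\<close>

definition bern_coeff :: "nat \<Rightarrow> complex" where
  "bern_coeff n = fps_nth bern_fps n"

lemma bern_fps_mult: "bern_fps * Abs_fps (\<lambda>n. 1 / fact (Suc n)) = 1"
  unfolding bern_fps_def by (rule inverse_mult_eq_1) simp

lemma bern_coeff_sum: "(\<Sum>i\<le>k. bern_coeff i / fact (k - i + 1)) = (if k = 0 then 1 else 0)"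
proof -
  have "fps_nth (bern_fps * Abs_fps (\<lambda>n. 1 / fact (Suc n))) k = fps_nth 1 k"
    by (simp only: bern_fps_mult)
  then show ?thesis by (simp add: fps_mult_nth bern_coeff_def atLeast0AtMost del: fact_Suc)
qed

text \<open>The generating function \<open>B(x) = x / (e\<^sup>x - 1)\<close> satisfies \<open>B(-x) = B(x) + x\<close>.\<close>

lemma bern_coeff_reflect: "(-1) ^ n * bern_coeff n = bern_coeff n + (if n = 1 then 1 else 0)"
proof -
  let ?G = "Abs_fps (\<lambda>n. 1 / fact (Suc n)) :: complex fps"
  let ?G' = "Abs_fps (\<lambda>n. (-1) ^ n / fact (Suc n)) :: complex fps"
  let ?B' = "Abs_fps (\<lambda>n. (-1) ^ n * bern_coeff n)"
  have G: "fps_X * ?G = fps_exp 1 - 1"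
    by (rule fps_ext) (auto simp del: fact_Suc)
  have G': "fps_X * ?G' = 1 - fps_exp (- 1)"
  proof (rule fps_ext)
    fix n show "fps_nth (fps_X * ?G') n = fps_nth (1 - fps_exp (- 1)) n"
      by (cases n) (auto simp del: fact_Suc)
  qed
  have B'G': "?B' * ?G' = 1"
  proof (rule fps_ext)
    fix n
    have "fps_nth (?B' * ?G') n = (\<Sum>i\<le>n. (-1) ^ n * (bern_coeff i / fact (n - i + 1)))"
      by (auto simp: fps_mult_nth atLeast0AtMost simp del: fact_Suc simp flip: power_add intro!: sum.cong)
    also have "\<dots> = (-1) ^ n * (if n = 0 then 1 else 0)"
      by (simp only: sum_distrib_left[symmetric] bern_coeff_sum)
    finally show "fps_nth (?B' * ?G') n = fps_nth 1 n" by simp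
  qed
  \<comment> \<open>With \<open>G = (e^x - 1) / x\<close> this gives
    \<open>e^x G(-x) = G(x)\<close>. Inverting yields \<open>B(-x) = e^x B(x)\<close>, and
    \<open>e^x = 1 + x G\<close> turns the right side into \<open>B + x\<close>.\<close>
  have "fps_X * (?G' * fps_exp 1) = (1 - fps_exp (- 1)) * fps_exp 1"
    by (simp only: G' mult.assoc[symmetric])
  also have "\<dots> = fps_exp 1 - 1" by (simp add: algebra_simps flip: fps_exp_add_mult)
  also have "\<dots> = fps_X * ?G" by (simp only: G)
  finally have E: "?G' * fps_exp 1 = ?G" by (metis mult_left_cancel fps_X_neq_zero)
  have "?B' = ?B' * (bern_fps * (?G' * fps_exp 1))" by (simp only: E bern_fps_mult) simp
  also have "\<dots> = (?B' * ?G') * (bern_fps * fps_exp 1)" by (simp only: mult_ac)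
  also have "\<dots> = bern_fps * (1 + fps_X * ?G)" unfolding B'G' G by simp
  also have "\<dots> = bern_fps + fps_X * (bern_fps * ?G)" by (simp only: algebra_simps mult_1_right mult_1_left)
  also have "\<dots> = bern_fps + fps_X" by (simp only: bern_fps_mult mult_1_right)
  finally have "fps_nth ?B' n = fps_nth (bern_fps + fps_X) n" by simp
  then show ?thesis by (simp add: bern_coeff_def)
qed

lemma bern_coeff_0 [simp]: "bern_coeff 0 = 1"
  using bern_coeff_sum[of 0] by simp

lemma bern_coeff_odd: assumes "odd n" "n \<noteq> 1" shows "bern_coeff n = 0"
  using bern_coeff_reflect[of n] assms by simp

text \<open>The coefficient of \<open>x^i\<close> in \<open>(1 - x)^(-b)\<close>.\<close>

definition binom_coeff :: "nat \<Rightarrow> complex \<Rightarrow> complex" where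
  "binom_coeff i b = pochhammer b i / fact i"

lemma sum_triangle:
  fixes G :: "nat \<Rightarrow> nat \<Rightarrow> 'a::comm_monoid_add"
  shows "(\<Sum>t<K. \<Sum>i<K - t. G t i) = (\<Sum>p<K. \<Sum>t\<le>p. G t (p - t))"
proof -
  have "(\<Sum>t<K. \<Sum>i<K - t. G t i) = (\<Sum>(t, i)\<in>(SIGMA t:{..<K}. {..<K - t}). G t i)"
    by (simp add: sum.Sigma)
  also have "(SIGMA t:{..<K}. {..<K - t}) = {(i, j). i + j < K}" by auto
  finally show ?thesis by (simp add: sum.triangle_reindex)
qed

lemma sum_triangle_le:
  fixes G :: "nat \<Rightarrow> nat \<Rightarrow> 'a::comm_monoid_add"
  shows "(\<Sum>t\<le>K. \<Sum>q\<le>t. G q (t - q)) = (\<Sum>q\<le>K. \<Sum>i\<le>K - q. G q i)"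
proof -
  have "(\<Sum>q\<le>K. \<Sum>i\<le>K - q. G q i) = (\<Sum>(t, i)\<in>(SIGMA t:{..K}. {..K - t}). G t i)"
    by (simp add: sum.Sigma)
  also have "(SIGMA t:{..K}. {..K - t}) = {(i, j). i + j \<le> K}" by auto
  finally show ?thesis by (simp add: sum.triangle_reindex_eq)
qed

text \<open>With \<open>u q = d / (a + q - 1)\<close> these are, up to the factor \<open>d\<close>, the Euler--Maclaurin coefficients.  The
  quotient is kept abstract so that denominators can be cleared.\<close>

definition em_kernel :: "(nat \<Rightarrow> complex) \<Rightarrow> complex \<Rightarrow> complex \<Rightarrow> nat \<Rightarrow> nat \<Rightarrow> complex" where
  "em_kernel u d a q i =
     (if i = 0 then u q else d * bern_coeff i * pochhammer (a + of_nat q) (i - 1))"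

definition em_coeff :: "(nat \<Rightarrow> complex) \<Rightarrow> complex \<Rightarrow> complex \<Rightarrow> (nat \<Rightarrow> complex) \<Rightarrow> nat \<Rightarrow> complex" where
  "em_coeff u d a c t = (\<Sum>q\<le>t. c q * em_kernel u d a q (t - q))"

text \<open>All summands share the factor \<open>d * c * pochhammer (a + of_nat q) k\<close>; what
  remains is the Bernoulli recursion \<open>bern_coeff_sum\<close>. The hypothesis is
  \<open>u q = d / (a + q - 1)\<close> multiplied out, so that it can hold at a pole if the
  coefficient \<open>c\<close> vanishes there.\<close>

lemma em_kernel_binom_coeff:
  assumes "c * u q * (a + of_nat q - 1) = d * c"
  shows "(\<Sum>i\<le>k. c * em_kernel u d a q i * binom_coeff (k - i + 1) (a + of_nat q - 1 + of_nat i))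
           = (if k = 0 then d * c else 0)"
proof -
  let ?al = "a + of_nat q"
  have "c * em_kernel u d a q i * binom_coeff (k - i + 1) (?al - 1 + of_nat i)
          = d * c * pochhammer ?al k * (bern_coeff i / fact (k - i + 1))" if "i \<le> k" for i
  proof (cases i)
    case 0
    have "c * em_kernel u d a q i * binom_coeff (k - i + 1) (?al - 1 + of_nat i)
        = c * u q * pochhammer (?al - 1) (Suc k) / fact (k + 1)"
      using 0 by (simp add: em_kernel_def binom_coeff_def)
    also have "\<dots> = (c * u q * (?al - 1)) * pochhammer ?al k / fact (k + 1)"
      by (simp add: pochhammer_rec mult_ac)
    finally show ?thesis using assms 0 by simp
  next
    case (Suc j)
    have "pochhammer ?al k = pochhammer ?al j * pochhammer (?al + of_nat j) (k - j)"
      using Suc that by (intro pochhammer_product) auto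
    moreover have "Suc (k - Suc j) = k - j" using Suc that by auto
    ultimately show ?thesis using Suc
      by (simp add: em_kernel_def binom_coeff_def mult_ac add.assoc del: fact_Suc)
  qed
  then have "(\<Sum>i\<le>k. c * em_kernel u d a q i * binom_coeff (k - i + 1) (?al - 1 + of_nat i))
     = (\<Sum>i\<le>k. d * c * pochhammer ?al k * (bern_coeff i / fact (k - i + 1)))"
    by (intro sum.cong) auto
  also have "\<dots> = d * c * pochhammer ?al k * (if k = 0 then 1 else 0)"
    by (simp only: sum_distrib_left[symmetric] bern_coeff_sum)
  finally show ?thesis by simp
qed

text \<open>Formal Euler--Maclaurin summation: let \<open>E(m)\<close> be the expansion with
  coefficients \<open>em_coeff\<close> and leading exponent \<open>a - 1\<close>. The left side is
  the coefficient of \<open>m^(-a-p)\<close> in \<open>E(m - 1) - E(m)\<close>, so this difference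
  reproduces \<open>d\<close> times the given expansion.\<close>

lemma em_coeff_binom_coeff:
  assumes "\<And>t. t \<le> p \<Longrightarrow> c t * u t * (a + of_nat t - 1) = d * c t"
  shows "(\<Sum>t\<le>p. em_coeff u d a c t * binom_coeff (p - t + 1) (a - 1 + of_nat t)) = d * c p"
proof -
  let ?G = "\<lambda>q i. c q * em_kernel u d a q i * binom_coeff (p - q - i + 1) (a + of_nat q - 1 + of_nat i)"
  have "(\<Sum>t\<le>p. em_coeff u d a c t * binom_coeff (p - t + 1) (a - 1 + of_nat t))
      = (\<Sum>t\<le>p. \<Sum>q\<le>t. ?G q (t - q))"
    unfolding em_coeff_def
    by (intro sum.cong refl, unfold sum_distrib_right, intro sum.cong refl)
      (auto simp: of_nat_diff add_diff_eq diff_add_eq)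
  also have "\<dots> = (\<Sum>q\<le>p. \<Sum>i\<le>p - q. ?G q i)" by (rule sum_triangle_le)
  also have "\<dots> = (\<Sum>q\<le>p. if p - q = 0 then d * c q else 0)"
    using assms by (intro sum.cong refl em_kernel_binom_coeff) auto
  also have "\<dots> = (\<Sum>q\<le>p. if q = p then d * c q else 0)" by (intro sum.cong) auto
  finally show ?thesis by simp
qed

section \<open>Remainder estimates uniform in the exponent\<close>

lemma norm_binom_coeff_le:
  assumes "norm b \<le> B" shows "norm (binom_coeff n b) \<le> pochhammer B n / fact n"
proof -
  have "norm (pochhammer b n) = (\<Prod>i<n. norm (b + of_nat i))"
    by (simp add: pochhammer_prod prod_norm atLeast0LessThan)
  also have "\<dots> \<le> (\<Prod>i<n. B + of_nat i)"
  proof (intro prod_mono conjI)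
    fix i show "norm (b + of_nat i) \<le> B + of_nat i"
      using norm_triangle_ineq[of b "of_nat i"] assms by simp
  qed auto
  finally show ?thesis
    by (simp add: binom_coeff_def norm_divide pochhammer_prod atLeast0LessThan divide_right_mono)
qed

text \<open>The constant must not depend on \<open>b\<close>. The coefficients are dominated by
  those of \<open>(1 - x)^(-B)\<close>, a series that converges at \<open>x = 1/2\<close>; its tail
  there, up to scaling, is the constant.\<close>

lemma binomial_remainder:
  fixes B :: real and K :: nat
  obtains C where "C \<ge> 0" and "\<And>b x. norm b \<le> B \<Longrightarrow> 0 \<le> x \<Longrightarrow> x \<le> 1/2 \<Longrightarrow>
     norm ((1 - of_real x) powr (- b) - (\<Sum>i<K. binom_coeff i b * of_real x ^ i)) \<le> C * x ^ K"
proof (cases "B \<ge> 0")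
  case False
  have "\<not> norm b \<le> B" for b :: complex using False norm_ge_zero[of b] by linarith
  then show ?thesis using that[of 0] by auto
next
  case True
  define w where "w n = pochhammer B n / fact n" for n
  have w0: "w n \<ge> 0" for n using True by (simp add: w_def pochhammer_prod prod_nonneg)
  have eq: "((-b) gchoose n) * (- x) ^ n = pochhammer b n / fact n * x ^ n" for b x :: "'a::field_char_0" and n
    by (simp add: gbinomial_pochhammer power_minus[of x] mult_ac)
  have "(\<lambda>n. w n * (1/2) ^ n) sums ((1 + (- (1/2))) powr (- B))"
    using gen_binomial_real[of "-(1/2)" "-B"] unfolding w_def eq by simp
  then have sw: "summable (\<lambda>n. w n * (1/2) ^ n)" by (rule sums_summable)
  have sw': "summable (\<lambda>n. w (n + K) * (1/2) ^ n)"
  proof -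
    have "summable (\<lambda>n. 2 ^ K * (w (n + K) * (1/2) ^ (n + K)))"
      using sw by (intro summable_mult) (subst summable_iff_shift[of _ K])
    moreover have "2 ^ K * (w (n + K) * (1/2) ^ (n + K)) = w (n + K) * (1/2) ^ n" for n
      by (simp add: power_add power_divide)
    ultimately show ?thesis by simp
  qed
  define C where "C = (\<Sum>n. w (n + K) * (1/2) ^ n)"
  have "C \<ge> 0" unfolding C_def using w0 sw' by (intro suminf_nonneg) auto
  moreover have "norm ((1 - of_real x) powr (- b) - (\<Sum>i<K. binom_coeff i b * of_real x ^ i)) \<le> C * x ^ K"
    if b: "norm b \<le> B" and x: "0 \<le> x" "x \<le> 1/2" for b x
  proof -
    have s: "(\<lambda>n. binom_coeff n b * of_real x ^ n) sums (1 - of_real x) powr (- b)"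
      using gen_binomial_complex[of "- of_real x" "- b"] x unfolding eq binom_coeff_def by simp
    have "(1 - of_real x) powr (- b) - (\<Sum>i<K. binom_coeff i b * of_real x ^ i)
        = (\<Sum>n. binom_coeff (n + K) b * of_real x ^ (n + K))"
      using sums_unique[OF s] suminf_split_initial_segment[OF sums_summable[OF s], of K] by simp
    also have "norm \<dots> \<le> (\<Sum>n. x ^ K * (w (n + K) * (1/2) ^ n))"
    proof (rule norm_suminf_le)
      fix n
      have "norm (binom_coeff (n + K) b * of_real x ^ (n + K)) = norm (binom_coeff (n + K) b) * (x ^ n * x ^ K)"
        using x by (simp add: norm_mult norm_power power_add)
      also have "\<dots> \<le> w (n + K) * ((1/2) ^ n * x ^ K)"
        using x norm_binom_coeff_le[OF b, of "n + K"] w0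
        by (intro mult_mono power_mono) (auto simp: w_def)
      finally show "norm (binom_coeff (n + K) b * of_real x ^ (n + K)) \<le> x ^ K * (w (n + K) * (1/2) ^ n)"
        by (simp add: mult_ac)
    qed (use sw' in \<open>rule summable_mult\<close>)
    also have "\<dots> = C * x ^ K" using sw' by (simp add: C_def suminf_mult mult.commute)
    finally show ?thesis .
  qed
  ultimately show ?thesis using that by blast
qed

text \<open>Substitute \<open>x = 1 / m\<close>, at most 1/2 because \<open>m \<ge> 2\<close>, into
  the binomial series for \<open>(m - 1)^(-b) = m^(-b) (1 - x)^(-b)\<close>. The zeroth term cancels
  against \<open>npow m b\<close>, hence the index \<open>i + 1\<close>.\<close>

lemma npow_pred_remainder:
  fixes B :: real and K :: nat
  obtains C where "C \<ge> 0" and "\<And>b m. norm b \<le> B \<Longrightarrow> m \<ge> 2 \<Longrightarrow>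
     norm (npow (m - 1) b - npow m b - (\<Sum>i<K. binom_coeff (i + 1) b * npow m (b + of_nat (i + 1))))
       \<le> C * real m powr (- Re b - real K - 1)"
proof -
  obtain C where "C \<ge> 0" and C: "\<And>b x. norm b \<le> B \<Longrightarrow> 0 \<le> x \<Longrightarrow> x \<le> 1/2 \<Longrightarrow>
     norm ((1 - of_real x) powr (- b) - (\<Sum>i<Suc K. binom_coeff i b * of_real x ^ i)) \<le> C * x ^ Suc K"
    using binomial_remainder[of B "Suc K"] by blast
  have "norm (npow (m - 1) b - npow m b - (\<Sum>i<K. binom_coeff (i + 1) b * npow m (b + of_nat (i + 1))))
       \<le> C * real m powr (- Re b - real K - 1)" if b: "norm b \<le> B" and m: "m \<ge> 2" for b m
  proof -
    define x where "x = 1 / real m"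
    have x: "0 \<le> x" "x \<le> 1/2" using m by (auto simp: x_def field_simps)
    have "of_nat (m - 1) = (of_nat m :: complex) * (1 - of_real x)"
      using m by (simp add: x_def of_nat_diff field_simps)
    then have 1: "npow (m - 1) b = npow m b * (1 - of_real x) powr (- b)"
      unfolding npow_def by (simp only:, intro powr_times_real) (use x in auto)
    have 2: "npow m (b + of_nat i) = npow m b * of_real x ^ i" for i
      using m by (simp add: npow_add npow_of_nat x_def power_divide)
    have 3: "(\<Sum>i<Suc K. binom_coeff i b * of_real x ^ i)
             = 1 + (\<Sum>i<K. binom_coeff (i + 1) b * of_real x ^ (i + 1))"
      by (subst sum.lessThan_Suc_shift) (simp add: binom_coeff_def)
    have "npow (m - 1) b - npow m b - (\<Sum>i<K. binom_coeff (i + 1) b * npow m (b + of_nat (i + 1)))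
       = npow m b * ((1 - of_real x) powr (- b) - (\<Sum>i<Suc K. binom_coeff i b * of_real x ^ i))"
      unfolding 1 2 3 by (simp add: ring_distribs sum_distrib_left mult_ac)
    also have "norm \<dots> \<le> real m powr (- Re b) * (C * x ^ Suc K)"
      unfolding norm_mult norm_npow using C[OF b x] by (intro mult_left_mono) auto
    also have "x ^ Suc K = real m powr (- real (Suc K))"
      using m powr_realpow[of "real m" "Suc K"]
      by (simp add: x_def powr_minus power_one_over inverse_eq_divide del: power_Suc of_nat_Suc)
    also have "real m powr (- Re b) * (C * real m powr (- real (Suc K)))
        = C * real m powr (- Re b + - real (Suc K))"
      by (simp only: mult.left_commute[of _ C] powr_add)
    also have "- Re b + - real (Suc K) = - Re b - real K - 1" by simp
    finally show ?thesis .
  qed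
  with \<open>C \<ge> 0\<close> show ?thesis using that by blast
qed

text \<open>\<open>C'\<close> is fixed before all other parameters. This uniformity is what later
  makes the remainder series converge uniformly on polydiscs, and so makes its sum holomorphic in
  the exponents.\<close>

lemma em_remainder:
  fixes B C :: real and K :: nat
  obtains C' where "C' \<ge> 0" and "\<And>a c f u d.
     norm a \<le> B \<Longrightarrow> norm d \<le> B \<Longrightarrow> (\<And>t. t < K \<Longrightarrow> norm (em_coeff u d a c t) \<le> B) \<Longrightarrow>
     (\<And>t. t < K \<Longrightarrow> c t * u t * (a + of_nat t - 1) = d * c t) \<Longrightarrow>
     (\<And>m. m \<ge> 1 \<Longrightarrow> norm (f m - (\<Sum>t<K. c t * npow m (a + of_nat t))) \<le> C * real m powr (- Re a - real K)) \<Longrightarrow>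
     (\<And>m. m \<ge> 2 \<Longrightarrow> norm (d * f m - (\<Sum>t<K. em_coeff u d a c t *
            (npow (m - 1) (a - 1 + of_nat t) - npow m (a - 1 + of_nat t))))
        \<le> C' * real m powr (- Re a - real K))"
proof -
  \<comment> \<open>One constant is needed for every truncation order \<open>L\<close>, since the
    \<open>t\<close>-th term is expanded to order \<open>K - t\<close>. The radius
    \<open>B + 1 + real K\<close> covers every \<open>a - 1 + t\<close>.\<close>
  define Q where "Q L c \<longleftrightarrow> c \<ge> 0 \<and> (\<forall>b m. norm b \<le> B + 1 + real K \<longrightarrow> m \<ge> 2 \<longrightarrow>
     norm (npow (m - 1) b - npow m b - (\<Sum>i<L. binom_coeff (i + 1) b * npow m (b + of_nat (i + 1))))
       \<le> c * real m powr (- Re b - real L - 1))" for L c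
  have "\<exists>c. Q L c" for L
    unfolding Q_def by (rule npow_pred_remainder[of "B + 1 + real K" L]) blast
  then obtain R where "\<And>L. Q L (R L)" by metis
  then have R0: "\<And>L. R L \<ge> 0" and R: "\<And>L b m. norm b \<le> B + 1 + real K \<Longrightarrow> m \<ge> 2 \<Longrightarrow>
     norm (npow (m - 1) b - npow m b - (\<Sum>i<L. binom_coeff (i + 1) b * npow m (b + of_nat (i + 1))))
       \<le> R L * real m powr (- Re b - real L - 1)" unfolding Q_def by auto
  define C' where "C' = \<bar>B\<bar> * \<bar>C\<bar> + (\<Sum>t<K. \<bar>B\<bar> * R (K - t))"
  have "C' \<ge> 0" unfolding C'_def by (intro add_nonneg_nonneg sum_nonneg mult_nonneg_nonneg R0) auto
  moreover have "norm (d * f m - (\<Sum>t<K. em_coeff u d a c t *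
            (npow (m - 1) (a - 1 + of_nat t) - npow m (a - 1 + of_nat t))))
        \<le> C' * real m powr (- Re a - real K)"
    if a: "norm a \<le> B" and d: "norm d \<le> B" and e: "\<And>t. t < K \<Longrightarrow> norm (em_coeff u d a c t) \<le> B"
      and u: "\<And>t. t < K \<Longrightarrow> c t * u t * (a + of_nat t - 1) = d * c t"
      and f: "\<And>m. m \<ge> 1 \<Longrightarrow> norm (f m - (\<Sum>t<K. c t * npow m (a + of_nat t))) \<le> C * real m powr (- Re a - real K)"
      and m: "m \<ge> 2" for a c f u d m
  proof -
    let ?e = "em_coeff u d a c" and ?b = "\<lambda>t. a - 1 + of_nat t"
    let ?v = "\<lambda>t. npow (m - 1) (?b t) - npow m (?b t)"
    let ?S = "\<lambda>t. \<Sum>i<K - t. binom_coeff (i + 1) (?b t) * npow m (?b t + of_nat (i + 1))"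
    let ?M = "real m powr (- Re a - real K)"
    \<comment> \<open>Regrouping by the total exponent \<open>p = t + i\<close>; the formal identity
      then collapses the inner sum to \<open>d * c p\<close>.\<close>
    have "(\<Sum>t<K. ?e t * ?S t) = (\<Sum>t<K. \<Sum>i<K - t. ?e t * binom_coeff (i + 1) (?b t) * npow m (a + of_nat (t + i)))"
      by (simp add: sum_distrib_left algebra_simps)
    also have "\<dots> = (\<Sum>p<K. \<Sum>t\<le>p. ?e t * binom_coeff (p - t + 1) (?b t) * npow m (a + of_nat (t + (p - t))))"
      by (rule sum_triangle)
    also have "\<dots> = (\<Sum>p<K. (\<Sum>t\<le>p. ?e t * binom_coeff (p - t + 1) (?b t)) * npow m (a + of_nat p))"
      by (simp add: sum_distrib_right)
    also have "\<dots> = (\<Sum>p<K. d * c p * npow m (a + of_nat p))"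
      by (intro sum.cong refl arg_cong2[where f = times] em_coeff_binom_coeff u) auto
    finally have S: "(\<Sum>t<K. ?e t * ?S t) = d * (\<Sum>p<K. c p * npow m (a + of_nat p))"
      by (simp add: sum_distrib_left mult_ac)
    have eq: "d * f m - (\<Sum>t<K. ?e t * ?v t)
      = d * (f m - (\<Sum>p<K. c p * npow m (a + of_nat p))) - (\<Sum>t<K. ?e t * (?v t - ?S t))"
      by (simp only: right_diff_distrib sum_subtractf S) (simp add: algebra_simps)
    have "norm (d * f m - (\<Sum>t<K. ?e t * ?v t)) \<le> norm (d * (f m - (\<Sum>p<K. c p * npow m (a + of_nat p)))) + norm (\<Sum>t<K. ?e t * (?v t - ?S t))"
      unfolding eq by (rule norm_triangle_ineq4)
    also have "\<dots> \<le> \<bar>B\<bar> * (\<bar>C\<bar> * ?M) + (\<Sum>t<K. \<bar>B\<bar> * (R (K - t) * ?M))"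
    proof (intro add_mono sum_norm_le)
      have "norm (f m - (\<Sum>p<K. c p * npow m (a + of_nat p))) \<le> \<bar>C\<bar> * ?M"
        by (intro order_trans[OF f[of m]] mult_right_mono) (use m in auto)
      then show "norm (d * (f m - (\<Sum>p<K. c p * npow m (a + of_nat p)))) \<le> \<bar>B\<bar> * (\<bar>C\<bar> * ?M)"
        unfolding norm_mult using d by (intro mult_mono) auto
    next
      fix t assume t: "t \<in> {..<K}"
      have "norm (?b t) \<le> norm a + norm (- 1 + of_nat t :: complex)"
        using norm_triangle_ineq[of a "-1 + of_nat t"] by (simp add: algebra_simps)
      also have "norm (- 1 + of_nat t :: complex) \<le> 1 + real t"
        using norm_triangle_ineq[of "-1::complex" "of_nat t"] by simp
      finally have "norm (?b t) \<le> B + 1 + real K" using a t by simp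
      moreover have "- Re (?b t) - real (K - t) - 1 = - Re a - real K"
        using t by (simp add: of_nat_diff)
      ultimately have "norm (?v t - ?S t) \<le> R (K - t) * ?M"
        using R[OF _ m, of "?b t" "K - t"] by (simp only:)
      then show "norm (?e t * (?v t - ?S t)) \<le> \<bar>B\<bar> * (R (K - t) * ?M)"
        unfolding norm_mult using e[of t] t by (intro mult_mono) auto
    qed
    also have "\<dots> = C' * ?M" by (simp add: C'_def sum_distrib_right distrib_right mult.assoc)
    finally show ?thesis .
  qed
  ultimately show ?thesis by (rule that)
qed

section \<open>Regularised tails of sequences\<close>

text \<open>A quadratic part of the summand is compared with the telescoping difference
  \<open>1/(n + k) - 1/(n + k + 1)\<close>; the other factor has exponent
  \<open>2 - \<sigma> \<le> 0\<close> and is at most its value at \<open>n\<close>.\<close>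

lemma powr_tail_sum:
  fixes \<sigma> :: real
  assumes "\<sigma> \<ge> 2" "n \<ge> 1"
  shows "summable (\<lambda>k. real (n + 1 + k) powr (- \<sigma>))"
    and "(\<Sum>k. real (n + 1 + k) powr (- \<sigma>)) \<le> real n powr (1 - \<sigma>)"
proof -
  let ?h = "\<lambda>k. 1 / real (n + k)"
  have "?h \<longlonglongrightarrow> 0"
    using LIMSEQ_ignore_initial_segment[OF lim_1_over_n, of n] by (simp add: add.commute)
  then have s: "(\<lambda>k. ?h k - ?h (Suc k)) sums (1 / real n)"
    using telescope_sums'[of ?h 0] by simp
  then have s': "(\<lambda>k. real n powr (2 - \<sigma>) * (?h k - ?h (Suc k))) sums (real n powr (2 - \<sigma>) * (1 / real n))"
    by (rule sums_mult)
  have le: "real (n + 1 + k) powr (- \<sigma>) \<le> real n powr (2 - \<sigma>) * (?h k - ?h (Suc k))" for k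
  proof -
    have "real (n + 1 + k) powr (- \<sigma>) = real (n + 1 + k) powr (2 - \<sigma>) * real (n + 1 + k) powr (- 2)"
      by (simp flip: powr_add)
    also have "real (n + 1 + k) powr (2 - \<sigma>) \<le> real n powr (2 - \<sigma>)"
      using assms by (intro powr_mono2') auto
    also have "real (n + 1 + k) powr (- 2) = 1 / (real (n + 1 + k) * real (n + 1 + k))"
      by (simp add: powr_minus divide_inverse power2_eq_square)
    also have "\<dots> \<le> 1 / (real (n + k) * real (n + 1 + k))"
      using assms by (intro divide_left_mono mult_right_mono) auto
    also have "\<dots> = ?h k - ?h (Suc k)"
      using assms by (simp add: field_simps)
    finally show ?thesis by (simp add: mult_left_mono)
  qed
  show sm: "summable (\<lambda>k. real (n + 1 + k) powr (- \<sigma>))"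
    by (rule summable_comparison_test'[OF sums_summable[OF s'], of 0]) (use le in auto)
  have "(\<Sum>k. real (n + 1 + k) powr (- \<sigma>)) \<le> real n powr (2 - \<sigma>) * (1 / real n)"
    unfolding sums_unique[OF s'] by (intro suminf_le le sm sums_summable[OF s'])
  also have "\<dots> = real n powr (1 - \<sigma>)"
    using assms by (simp add: powr_diff power2_eq_square)
  finally show "(\<Sum>k. real (n + 1 + k) powr (- \<sigma>)) \<le> real n powr (1 - \<sigma>)" .
qed

text \<open>What is left of \<open>d * f m\<close> after subtracting the telescoping differences of
  the truncated expansion. For large \<open>K\<close> it is summable even where \<open>f\<close> is
  not; \<open>em_tail\<close> adds the expansion back.\<close>

definition em_rem :: "nat \<Rightarrow> (nat \<Rightarrow> complex) \<Rightarrow> complex \<Rightarrow> complex \<Rightarrow> (nat \<Rightarrow> complex) \<Rightarrow> (nat \<Rightarrow> complex) \<Rightarrow> nat \<Rightarrow> complex" where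
  "em_rem K u d a c f m = d * f m - (\<Sum>t<K. em_coeff u d a c t *
     (npow (m - 1) (a - 1 + of_nat t) - npow m (a - 1 + of_nat t)))"

definition em_tail :: "nat \<Rightarrow> (nat \<Rightarrow> complex) \<Rightarrow> complex \<Rightarrow> complex \<Rightarrow> (nat \<Rightarrow> complex) \<Rightarrow> (nat \<Rightarrow> complex) \<Rightarrow> nat \<Rightarrow> complex" where
  "em_tail K u d a c f n =
     (\<Sum>t<K. em_coeff u d a c t * npow n (a - 1 + of_nat t)) + (\<Sum>k. em_rem K u d a c f (n + 1 + k))"

lemma em_tail_props:
  assumes R: "\<And>m. m \<ge> 2 \<Longrightarrow> norm (em_rem K u d a c f m) \<le> C * real m powr (- Re a - real K)"
    and K: "Re a + real K \<ge> 2" and n: "n \<ge> 1"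
  shows "em_tail K u d a c f n = em_tail K u d a c f (Suc n) + d * f (Suc n)"
    and "norm (em_tail K u d a c f n - (\<Sum>t<K. em_coeff u d a c t * npow n (a - 1 + of_nat t)))
           \<le> C * real n powr (- (Re a - 1) - real K)"
proof -
  let ?s = "Re a + real K"
  have sp: "summable (\<lambda>k. C * real (n + 1 + k) powr (- ?s))" if "n \<ge> 1" for n
    using powr_tail_sum(1)[OF K that] by (rule summable_mult)
  have le: "norm (em_rem K u d a c f (n + 1 + k)) \<le> C * real (n + 1 + k) powr (- ?s)" if "n \<ge> 1" for n k
    using R[of "n + 1 + k"] that by (simp add: algebra_simps)
  have sr: "summable (\<lambda>k. em_rem K u d a c f (n + 1 + k))" if "n \<ge> 1" for n
    using le[OF that] by (intro summable_comparison_test'[OF sp[OF that], of 0]) auto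
  have "(\<Sum>k. em_rem K u d a c f (n + 1 + k)) = em_rem K u d a c f (Suc n) + (\<Sum>k. em_rem K u d a c f (Suc n + 1 + k))"
    using suminf_split_head[OF sr[OF n]] by simp
  then show "em_tail K u d a c f n = em_tail K u d a c f (Suc n) + d * f (Suc n)"
    unfolding em_tail_def by (simp add: em_rem_def right_diff_distrib sum_subtractf)
  have "norm (\<Sum>k. em_rem K u d a c f (n + 1 + k)) \<le> (\<Sum>k. C * real (n + 1 + k) powr (- ?s))"
    using le[OF n] sp[OF n] by (rule norm_suminf_le)
  also have "\<dots> = C * (\<Sum>k. real (n + 1 + k) powr (- ?s))"
    using powr_tail_sum(1)[OF K n] by (rule suminf_mult)
  also have "\<dots> \<le> C * real n powr (1 - ?s)"
  proof (rule mult_left_mono[OF powr_tail_sum(2)[OF K n]])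
    \<comment> \<open>\<open>C\<close> is not assumed nonnegative; the bound at \<open>m = 2\<close>
      forces it.\<close>
    have "0 \<le> C * real 2 powr (- Re a - real K)"
      using order_trans[OF norm_ge_zero R[of 2]] by simp
    then show "0 \<le> C" by (simp add: zero_le_mult_iff)
  qed
  finally show "norm (em_tail K u d a c f n - (\<Sum>t<K. em_coeff u d a c t * npow n (a - 1 + of_nat t)))
           \<le> C * real n powr (- (Re a - 1) - real K)"
    by (simp add: em_tail_def algebra_simps)
qed

text \<open>\<open>g n\<close> plays the role of \<open>f (n + 1) + f (n + 2) + \<dots>\<close>; when that series diverges, the constant
  of summation is fixed by prescribing the asymptotic expansion of \<open>g\<close> up to \<open>o(1)\<close>.\<close>

definition is_tail :: "complex \<Rightarrow> (nat \<Rightarrow> complex) \<Rightarrow> (nat \<Rightarrow> complex) \<Rightarrow> (nat \<Rightarrow> complex) \<Rightarrow> bool" where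
  "is_tail b c f g \<longleftrightarrow> (\<forall>n\<ge>1. g n = g (Suc n) + f (Suc n)) \<and>
     (\<exists>K. Re b + real K > 0 \<and> (\<lambda>N. g N - (\<Sum>t<K. c t * npow N (b + of_nat t))) \<longlonglongrightarrow> 0)"

lemma sum_npow_tendsto_0:
  assumes "Re b + real K > 0"
  shows "(\<lambda>N. \<Sum>t=K..<L. c t * npow N (b + of_nat t)) \<longlonglongrightarrow> 0"
proof (rule tendsto_null_sum)
  fix t assume "t \<in> {K..<L}"
  then have "(\<lambda>N. npow N (b + of_nat t)) \<longlonglongrightarrow> 0"
    using assms by (intro npow_tendsto_0) auto
  then show "(\<lambda>N. c t * npow N (b + of_nat t)) \<longlonglongrightarrow> 0" by (rule tendsto_mult_right_zero)
qed

lemma expansion_tendsto_le: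
  assumes "Re b + real K > 0" "K \<le> L"
  shows "(\<lambda>N. g N - (\<Sum>t<K. c t * npow N (b + of_nat t))) \<longlonglongrightarrow> 0 \<longleftrightarrow>
         (\<lambda>N. g N - (\<Sum>t<L. c t * npow N (b + of_nat t))) \<longlonglongrightarrow> 0"
proof -
  have eq: "(\<Sum>t<L. c t * npow N (b + of_nat t)) = (\<Sum>t<K. c t * npow N (b + of_nat t)) + (\<Sum>t=K..<L. c t * npow N (b + of_nat t))" for N
    using assms(2) by (simp add: sum.atLeastLessThan_concat flip: atLeast0LessThan)
  note z = sum_npow_tendsto_0[OF assms(1), of c L]
  show ?thesis
  proof
    assume "(\<lambda>N. g N - (\<Sum>t<K. c t * npow N (b + of_nat t))) \<longlonglongrightarrow> 0"
    from tendsto_diff[OF this z] show "(\<lambda>N. g N - (\<Sum>t<L. c t * npow N (b + of_nat t))) \<longlonglongrightarrow> 0"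
      by (simp add: eq algebra_simps)
  next
    assume "(\<lambda>N. g N - (\<Sum>t<L. c t * npow N (b + of_nat t))) \<longlonglongrightarrow> 0"
    from tendsto_add[OF this z] show "(\<lambda>N. g N - (\<Sum>t<K. c t * npow N (b + of_nat t))) \<longlonglongrightarrow> 0"
      by (simp add: eq algebra_simps)
  qed
qed

text \<open>Powers whose exponent has positive real part tend to 0, so all admissible truncations
  give the same condition.\<close>

lemma is_tail_iff:
  assumes "Re b + real K > 0"
  shows "is_tail b c f g \<longleftrightarrow> (\<forall>n\<ge>1. g n = g (Suc n) + f (Suc n)) \<and>
     (\<lambda>N. g N - (\<Sum>t<K. c t * npow N (b + of_nat t))) \<longlonglongrightarrow> 0"
proof -
  have "(\<lambda>N. g N - (\<Sum>t<L. c t * npow N (b + of_nat t))) \<longlonglongrightarrow> 0 \<longleftrightarrow>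
        (\<lambda>N. g N - (\<Sum>t<K. c t * npow N (b + of_nat t))) \<longlonglongrightarrow> 0" if "Re b + real L > 0" for L
    using expansion_tendsto_le[OF assms, of L g c] expansion_tendsto_le[OF that, of K g c] by linarith
  then show ?thesis using assms unfolding is_tail_def by blast
qed

text \<open>The recursion makes \<open>g - h\<close> constant from 1 on, and the common expansion
  makes it tend to 0.\<close>

lemma is_tail_unique:
  assumes "is_tail b c f g" "is_tail b c f h" "n \<ge> 1"
  shows "g n = h n"
proof -
  obtain K where K: "Re b + real K > 0" using assms(1) by (auto simp: is_tail_def)
  from assms(1,2) have
    g: "\<forall>n\<ge>1. g n = g (Suc n) + f (Suc n)" "(\<lambda>N. g N - (\<Sum>t<K. c t * npow N (b + of_nat t))) \<longlonglongrightarrow> 0" and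
    h: "\<forall>n\<ge>1. h n = h (Suc n) + f (Suc n)" "(\<lambda>N. h N - (\<Sum>t<K. c t * npow N (b + of_nat t))) \<longlonglongrightarrow> 0"
    unfolding is_tail_iff[OF K] by blast+
  have "g (n + k) - h (n + k) = g n - h n" for k
  proof (induction k)
    case (Suc k)
    have nk: "n + k \<ge> 1" using assms(3) by simp
    have "g (n + k) = g (Suc (n + k)) + f (Suc (n + k))" "h (n + k) = h (Suc (n + k)) + f (Suc (n + k))"
      using g(1) h(1) nk by blast+
    then show ?case using Suc by simp
  qed simp
  then have "(\<lambda>k. g (k + n) - h (k + n)) \<longlonglongrightarrow> g n - h n" by (simp add: add.commute)
  moreover have "(\<lambda>N. g N - h N) \<longlonglongrightarrow> 0" using tendsto_diff[OF g(2) h(2)] by simp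
  then have "(\<lambda>k. g (k + n) - h (k + n)) \<longlonglongrightarrow> 0" by (rule LIMSEQ_ignore_initial_segment)
  ultimately show ?thesis using LIMSEQ_unique by fastforce
qed

lemma is_tail_cong:
  assumes "is_tail b c f g" "\<And>n. n \<ge> 1 \<Longrightarrow> f n = f' n" "\<And>n. n \<ge> 1 \<Longrightarrow> g n = g' n" "\<And>t. c t = c' t"
  shows "is_tail b c' f' g'"
proof -
  obtain K where K: "Re b + real K > 0" using assms(1) by (auto simp: is_tail_def)
  have "(\<lambda>N. g N - (\<Sum>t<K. c t * npow N (b + of_nat t))) \<longlonglongrightarrow> 0" using assms(1) is_tail_iff[OF K] by blast
  then have "(\<lambda>N. g' N - (\<Sum>t<K. c' t * npow N (b + of_nat t))) \<longlonglongrightarrow> 0"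
    using assms(3,4) by (subst tendsto_cong[of _ "\<lambda>N. g N - (\<Sum>t<K. c t * npow N (b + of_nat t))"])
      (auto intro!: eventually_sequentiallyI[of 1])
  moreover have "g' n = g' (Suc n) + f' (Suc n)" if "n \<ge> 1" for n
  proof -
    have "g n = g (Suc n) + f (Suc n)" using assms(1) that unfolding is_tail_def by blast
    then show ?thesis using assms(2)[of "Suc n"] assms(3)[of n] assms(3)[of "Suc n"] that by simp
  qed
  ultimately show ?thesis unfolding is_tail_iff[OF K] by blast
qed

lemma is_tail_cong_coeff:
  assumes "is_tail b c f g" "\<And>t. t < K \<Longrightarrow> c t = c' t" "Re b + real K > 0"
  shows "is_tail b c' f g"
proof -
  have "(\<Sum>t<K. c t * npow N (b + of_nat t)) = (\<Sum>t<K. c' t * npow N (b + of_nat t))" for N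
    using assms(2) by (intro sum.cong) auto
  then have "is_tail b c f g \<longleftrightarrow> is_tail b c' f g" unfolding is_tail_iff[OF assms(3)] by (simp only:)
  with assms(1) show ?thesis by blast
qed

text \<open>Tails whose leading exponents differ by natural numbers become comparable, and can be
  added, relative to one common exponent.\<close>

lemma is_tail_shift:
  assumes "is_tail (b + of_nat e) c f g"
  shows "is_tail b (\<lambda>t. if t < e then 0 else c (t - e)) f g"
proof -
  obtain K where K: "Re (b + of_nat e) + real K > 0" using assms by (auto simp: is_tail_def)
  have eq: "(\<Sum>t<K + e. (if t < e then 0 else c (t - e)) * npow N (b + of_nat t))
      = (\<Sum>t<K. c t * npow N (b + of_nat e + of_nat t))" for N
  proof -
    have "(\<Sum>t<K + e. (if t < e then 0 else c (t - e)) * npow N (b + of_nat t))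
       = (\<Sum>t\<in>{e..<K + e}. c (t - e) * npow N (b + of_nat t))"
      by (rule sum.mono_neutral_cong_right) auto
    also have "\<dots> = (\<Sum>t<K. c t * npow N (b + of_nat e + of_nat t))"
      using sum.shift_bounds_nat_ivl[of "\<lambda>t. c (t - e) * npow N (b + of_nat t)" 0 e K]
      by (simp add: atLeast0LessThan algebra_simps)
    finally show ?thesis .
  qed
  have K': "Re b + real (K + e) > 0" using K by simp
  show ?thesis using assms unfolding is_tail_iff[OF K] is_tail_iff[OF K'] eq .
qed

lemma is_tail_sum:
  assumes "\<And>j. j \<in> J \<Longrightarrow> is_tail b (c j) (f j) (g j)"
  shows "is_tail b (\<lambda>t. \<Sum>j\<in>J. p j * c j t) (\<lambda>n. \<Sum>j\<in>J. p j * f j n) (\<lambda>n. \<Sum>j\<in>J. p j * g j n)"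
proof -
  obtain K where K: "Re b + real K > 0" using reals_Archimedean2[of "- Re b"] by (metis add.commute less_iff_diff_less_0 minus_diff_eq diff_minus_eq_add neg_less_0_iff_less)
  have "(\<lambda>N. \<Sum>j\<in>J. p j * (g j N - (\<Sum>t<K. c j t * npow N (b + of_nat t)))) \<longlonglongrightarrow> 0"
    using assms unfolding is_tail_iff[OF K] by (intro tendsto_null_sum tendsto_mult_right_zero) auto
  also have "(\<lambda>N. \<Sum>j\<in>J. p j * (g j N - (\<Sum>t<K. c j t * npow N (b + of_nat t))))
     = (\<lambda>N. (\<Sum>j\<in>J. p j * g j N) - (\<Sum>t<K. (\<Sum>j\<in>J. p j * c j t) * npow N (b + of_nat t)))"
  proof
    fix N
    have "(\<Sum>t<K. (\<Sum>j\<in>J. p j * c j t) * npow N (b + of_nat t)) = (\<Sum>j\<in>J. p j * (\<Sum>t<K. c j t * npow N (b + of_nat t)))"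
      unfolding sum_distrib_right sum_distrib_left by (subst sum.swap) (simp add: mult_ac)
    then show "(\<Sum>j\<in>J. p j * (g j N - (\<Sum>t<K. c j t * npow N (b + of_nat t))))
      = (\<Sum>j\<in>J. p j * g j N) - (\<Sum>t<K. (\<Sum>j\<in>J. p j * c j t) * npow N (b + of_nat t))"
      by (simp add: right_diff_distrib sum_subtractf)
  qed
  finally have "(\<lambda>N. (\<Sum>j\<in>J. p j * g j N) - (\<Sum>t<K. (\<Sum>j\<in>J. p j * c j t) * npow N (b + of_nat t))) \<longlonglongrightarrow> 0" .
  moreover have "(\<Sum>j\<in>J. p j * g j n) = (\<Sum>j\<in>J. p j * g j (Suc n)) + (\<Sum>j\<in>J. p j * f j (Suc n))" if "n \<ge> 1" for n
  proof -
    have "g j n = g j (Suc n) + f j (Suc n)" if "j \<in> J" for j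
      using assms[OF that] \<open>n \<ge> 1\<close> unfolding is_tail_def by blast
    then have "(\<Sum>j\<in>J. p j * g j n) = (\<Sum>j\<in>J. p j * (g j (Suc n) + f j (Suc n)))"
      by (intro sum.cong) auto
    then show ?thesis by (simp add: distrib_left sum.distrib)
  qed
  ultimately show ?thesis unfolding is_tail_iff[OF K] by blast
qed

lemma is_tail_cmult:
  assumes "is_tail b c f g"
  shows "is_tail b (\<lambda>t. p * c t) (\<lambda>n. p * f n) (\<lambda>n. p * g n)"
  using is_tail_sum[of "{()}" b "\<lambda>_. c" "\<lambda>_. f" "\<lambda>_. g" "\<lambda>_. p"] assms by simp

lemma em_tail_is_tail:
  assumes R: "\<And>m. m \<ge> 2 \<Longrightarrow> norm (em_rem K u d a c f m) \<le> C * real m powr (- Re a - real K)"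
    and K: "Re a + real K \<ge> 2"
  shows "is_tail (a - 1) (em_coeff u d a c) (\<lambda>n. d * f n) (em_tail K u d a c f)"
proof -
  let ?g = "\<lambda>n. em_tail K u d a c f n - (\<Sum>t<K. em_coeff u d a c t * npow n (a - 1 + of_nat t))"
  have "(\<lambda>n. C * real n powr (- (Re a - 1) - real K)) \<longlonglongrightarrow> 0"
    using K by (intro tendsto_mult_right_zero tendsto_neg_powr filterlim_real_sequentially) auto
  then have "?g \<longlonglongrightarrow> 0"
    by (rule Lim_null_comparison[rotated])
      (use em_tail_props(2)[OF R K] in \<open>blast intro: eventually_sequentiallyI[of 1]\<close>)
  moreover have "em_tail K u d a c f n = em_tail K u d a c f (Suc n) + d * f (Suc n)" if "n \<ge> 1" for n
    by (rule em_tail_props(1)[OF R K that])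
  moreover have "Re (a - 1) + real K > 0" using K by simp
  ultimately show ?thesis unfolding is_tail_def by blast
qed

section \<open>Iterated tails and uniform expansions\<close>

text \<open>For \<open>ss = [s\<^sub>k, \<dots>, s\<^sub>r]\<close>, the sequence \<open>mz_tail \<delta> ss n\<close> is the regularised sum over \<open>n < n\<^sub>k < \<dots> < n\<^sub>r\<close>
  (\<open>\<delta> = 0\<close>) or \<open>n \<le> n\<^sub>k \<le> \<dots> \<le> n\<^sub>r\<close> (\<open>\<delta> = 1\<close>), with asymptotic expansion
  \<open>\<Sum>t. mz_coeff \<delta> ss t * npow n (mz_exp ss + t)\<close>.\<close>

primrec mz_exp :: "complex list \<Rightarrow> complex" where
  "mz_exp [] = 0"
| "mz_exp (x # ys) = x + mz_exp ys - 1"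

abbreviation plain_coeff :: "complex \<Rightarrow> (nat \<Rightarrow> complex) \<Rightarrow> nat \<Rightarrow> complex" where
  "plain_coeff a \<equiv> em_coeff (\<lambda>t. 1 / (a + of_nat t - 1)) 1 a"

text \<open>The term \<open>m = n\<close>, present for \<open>\<delta> = 1\<close>, has the
  exponents \<open>x + mz_exp ys + t\<close>. Counted from \<open>mz_exp (x # ys)\<close> these are
  larger by one, whence the index \<open>t - 1\<close>.\<close>

primrec mz_coeff :: "complex \<Rightarrow> complex list \<Rightarrow> nat \<Rightarrow> complex" where
  "mz_coeff \<delta> [] = (\<lambda>t. if t = 0 then 1 else 0)"
| "mz_coeff \<delta> (x # ys) = (\<lambda>t. plain_coeff (x + mz_exp ys) (mz_coeff \<delta> ys) t +
     (if t = 0 then 0 else \<delta> * mz_coeff \<delta> ys (t - 1)))"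

text \<open>\<open>SOME\<close> is arbitrary if there is no tail, as can happen at poles. Off the
  poles existence is part of \<open>mz_den_eq\<close>, and uniqueness makes the choice immaterial at
  every \<open>n \<ge> 1\<close>.\<close>

primrec mz_tail :: "complex \<Rightarrow> complex list \<Rightarrow> nat \<Rightarrow> complex" where
  "mz_tail \<delta> [] = (\<lambda>n. 1)"
| "mz_tail \<delta> (x # ys) = (\<lambda>n.
     (SOME g. is_tail (x + mz_exp ys - 1) (plain_coeff (x + mz_exp ys) (mz_coeff \<delta> ys))
                (\<lambda>m. npow m x * mz_tail \<delta> ys m) g) n + \<delta> * (npow n x * mz_tail \<delta> ys n))"

lemma mz_tail_Cons:
  assumes "is_tail (x + mz_exp ys - 1) (plain_coeff (x + mz_exp ys) (mz_coeff \<delta> ys))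
                (\<lambda>m. npow m x * mz_tail \<delta> ys m) g" and "n \<ge> 1"
  shows "mz_tail \<delta> (x # ys) n = g n + \<delta> * (npow n x * mz_tail \<delta> ys n)"
  using is_tail_unique[OF someI[of "is_tail _ _ _", OF assms(1)] assms] by simp

text \<open>The \<open>cleared\<close> versions are the plain ones multiplied by the linear factors that can vanish.  The expansion
  coefficients of the constant sequence \<open>1\<close> beyond the first one vanish, so that the first tail has
  one pole only; this matters where \<open>s\<^sub>r\<close> is a nonpositive integer.\<close>

definition pole_count :: "nat \<Rightarrow> complex list \<Rightarrow> nat" where
  "pole_count K ys = (if ys = [] then 1 else K)"

definition pole_prod :: "nat \<Rightarrow> complex \<Rightarrow> complex list \<Rightarrow> complex" where
  "pole_prod K x ys = (\<Prod>j<pole_count K ys. x + mz_exp ys + of_nat j - 1)"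

definition pole_quot :: "nat \<Rightarrow> complex \<Rightarrow> complex list \<Rightarrow> nat \<Rightarrow> complex" where
  "pole_quot K x ys t = (if t < pole_count K ys
     then (\<Prod>j\<in>{..<pole_count K ys} - {t}. x + mz_exp ys + of_nat j - 1) else 0)"

primrec mz_den :: "nat \<Rightarrow> complex list \<Rightarrow> complex" where
  "mz_den K [] = 1"
| "mz_den K (x # ys) = pole_prod K x ys * mz_den K ys"

primrec cleared_coeff :: "complex \<Rightarrow> nat \<Rightarrow> complex list \<Rightarrow> nat \<Rightarrow> complex" where
  "cleared_coeff \<delta> K [] = (\<lambda>t. if t = 0 then 1 else 0)"
| "cleared_coeff \<delta> K (x # ys) = (\<lambda>t.
     em_coeff (pole_quot K x ys) (pole_prod K x ys) (x + mz_exp ys) (cleared_coeff \<delta> K ys) t +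
     (if t = 0 then 0 else \<delta> * pole_prod K x ys * cleared_coeff \<delta> K ys (t - 1)))"

primrec cleared_tail :: "complex \<Rightarrow> nat \<Rightarrow> complex list \<Rightarrow> nat \<Rightarrow> complex" where
  "cleared_tail \<delta> K [] = (\<lambda>n. 1)"
| "cleared_tail \<delta> K (x # ys) = (\<lambda>n.
     em_tail K (pole_quot K x ys) (pole_prod K x ys) (x + mz_exp ys) (cleared_coeff \<delta> K ys)
       (\<lambda>m. npow m x * cleared_tail \<delta> K ys m) n +
     \<delta> * pole_prod K x ys * (npow n x * cleared_tail \<delta> K ys n))"

text \<open>An index \<open>t < K\<close> lies past \<open>pole_count\<close> only if
  \<open>ys = []\<close> and \<open>t > 0\<close>. The coefficient is then 0, so the default 0 in
  \<open>pole_quot\<close> does no harm.\<close>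

lemma pole_quot_mult:
  assumes "t < K"
  shows "cleared_coeff \<delta> K ys t * pole_quot K x ys t * (x + mz_exp ys + of_nat t - 1)
           = pole_prod K x ys * cleared_coeff \<delta> K ys t"
proof (cases "t < pole_count K ys")
  case True
  then show ?thesis
    unfolding pole_prod_def pole_quot_def by (subst prod.remove[of _ t]) (auto simp: mult_ac)
next
  case False
  with assms have "ys = []" "t \<noteq> 0" by (auto simp: pole_count_def split: if_splits)
  then show ?thesis by simp
qed

section \<open>Expansions uniform on bounded sets of exponents\<close>

definition bounded_lists :: "nat \<Rightarrow> real \<Rightarrow> complex list set" where
  "bounded_lists r B = {ss. length ss = r \<and> (\<forall>x\<in>set ss. norm x \<le> B)}"

lemma bounded_lists_Cons: "x # ys \<in> bounded_lists (Suc r) B \<longleftrightarrow> norm x \<le> B \<and> ys \<in> bounded_lists r B"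
  by (auto simp: bounded_lists_def)

lemma norm_mz_exp_le: "ss \<in> bounded_lists r B \<Longrightarrow> norm (mz_exp ss) \<le> real r * (B + 1)"
proof (induction ss arbitrary: r)
  case Nil
  then show ?case by (simp add: bounded_lists_def)
next
  case (Cons x ys)
  then obtain r' where r: "r = Suc r'" by (auto simp: bounded_lists_def)
  with Cons.prems have x: "norm x \<le> B" and ys: "ys \<in> bounded_lists r' B" by (auto simp: bounded_lists_Cons)
  have "norm (mz_exp (x # ys)) \<le> norm x + norm (mz_exp ys) + 1"
    using norm_triangle_ineq4[of "x + mz_exp ys" 1] norm_triangle_ineq[of x "mz_exp ys"] by simp
  then show ?case using x Cons.IH[OF ys] by (simp add: r algebra_simps)
qed

lemma norm_prod_le_power:
  fixes f :: "'a \<Rightarrow> complex"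
  assumes "\<And>i. i \<in> S \<Longrightarrow> norm (f i) \<le> M" "M \<ge> 1" "card S \<le> K"
  shows "norm (prod f S) \<le> M ^ K"
proof -
  have "norm (prod f S) \<le> (\<Prod>i\<in>S. M)"
    unfolding prod_norm[symmetric] using assms by (intro prod_mono) auto
  also have "\<dots> \<le> M ^ K" using assms by (simp add: power_increasing)
  finally show ?thesis .
qed

text \<open>The invariant of the induction on the depth: one truncation order \<open>K\<close>
  serves all depths, and \<open>C\<close> depends on the bound \<open>B\<close> but not on the
  individual list.\<close>

definition uniform_expansion :: "complex \<Rightarrow> nat \<Rightarrow> real \<Rightarrow> nat \<Rightarrow> real \<Rightarrow> bool" where
  "uniform_expansion \<delta> K B r C \<longleftrightarrow> C \<ge> 0 \<and> (\<forall>ss\<in>bounded_lists r B.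
     (\<forall>t<K. norm (cleared_coeff \<delta> K ss t) \<le> C) \<and>
     (\<forall>n\<ge>1. norm (cleared_tail \<delta> K ss n - (\<Sum>t<K. cleared_coeff \<delta> K ss t * npow n (mz_exp ss + of_nat t)))
        \<le> C * real n powr (- Re (mz_exp ss) - real K)))"

text \<open>Separated out because it is needed three times: to continue the induction, to identify
  the cleared with the plain tails, and to majorise the remainder series on a polydisc.\<close>

lemma uniform_step:
  assumes U: "uniform_expansion \<delta> K B r C" and K: "K \<ge> 1"
  obtains C' where "C' \<ge> 0" and
    "\<And>x ys. x # ys \<in> bounded_lists (Suc r) B \<Longrightarrow> norm (pole_prod K x ys) \<le> C'" and
    "\<And>x ys t. x # ys \<in> bounded_lists (Suc r) B \<Longrightarrow> t < K \<Longrightarrow>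
       norm (em_coeff (pole_quot K x ys) (pole_prod K x ys) (x + mz_exp ys) (cleared_coeff \<delta> K ys) t) \<le> C'" and
    "\<And>x ys m. x # ys \<in> bounded_lists (Suc r) B \<Longrightarrow> m \<ge> 2 \<Longrightarrow>
       norm (em_rem K (pole_quot K x ys) (pole_prod K x ys) (x + mz_exp ys) (cleared_coeff \<delta> K ys)
              (\<lambda>m. npow m x * cleared_tail \<delta> K ys m) m) \<le> C' * real m powr (- Re (x + mz_exp ys) - real K)"
proof -
  \<comment> \<open>\<open>M\<close> bounds every linear factor of index at most \<open>K\<close>,
    \<open>Q\<close> the products of such factors, \<open>L\<close> the kernels and \<open>E\<close>
    the convolutions.\<close>
  define M where "M = 1 + \<bar>real (Suc r) * (B + 1)\<bar> + \<bar>B\<bar> + real K + 1"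
  define Q where "Q = M ^ K"
  define L where "L = Q + Q * (\<Sum>i\<le>K. norm (bern_coeff i)) * Q"
  define E where "E = real K * (C * L)"
  have M1: "M \<ge> 1" by (simp add: M_def)
  have Q1: "Q \<ge> 1" unfolding Q_def using M1 by simp
  have C0: "C \<ge> 0" using U by (simp add: uniform_expansion_def)
  have L: "L \<ge> Q" "L \<ge> 0"
    unfolding L_def using Q1 by (auto intro!: mult_nonneg_nonneg sum_nonneg add_nonneg_nonneg)
  have E0: "E \<ge> 0" unfolding E_def using C0 L by simp
  have a: "norm (x + mz_exp ys) \<le> M - real K - 2" if "x # ys \<in> bounded_lists (Suc r) B" for x ys
  proof -
    have x: "norm x \<le> B" and ys: "ys \<in> bounded_lists r B" using that by (auto simp: bounded_lists_Cons)
    have "0 \<le> B" using x norm_ge_zero order_trans by blast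
    then show ?thesis using norm_triangle_ineq[of x "mz_exp ys"] x norm_mz_exp_le[OF ys]
      by (simp add: M_def algebra_simps)
  qed
  have fac: "norm (x + mz_exp ys + of_nat j) \<le> M" "norm (x + mz_exp ys + of_nat j - 1) \<le> M"
    if "x # ys \<in> bounded_lists (Suc r) B" "j \<le> K" for x ys j
    using a[OF that(1)] that(2) norm_triangle_ineq[of "x + mz_exp ys" "of_nat j"]
      norm_triangle_ineq4[of "x + mz_exp ys + of_nat j" 1] by auto
  have cnt: "pole_count K ys \<le> K" for ys using K by (simp add: pole_count_def)
  have pp: "norm (pole_prod K x ys) \<le> Q" if "x # ys \<in> bounded_lists (Suc r) B" for x ys
    unfolding pole_prod_def Q_def using fac[OF that] cnt[of ys] M1
    by (intro norm_prod_le_power) auto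
  have pq: "norm (pole_quot K x ys t) \<le> Q" if "x # ys \<in> bounded_lists (Suc r) B" for x ys t
  proof (cases "t < pole_count K ys")
    case True
    have "card ({..<pole_count K ys} - {t}) \<le> K" using cnt[of ys] by (simp add: card_Diff_subset True)
    then have "norm (\<Prod>j\<in>{..<pole_count K ys} - {t}. x + mz_exp ys + of_nat j - 1) \<le> Q"
      unfolding Q_def using fac(2)[OF that] cnt[of ys] M1 by (intro norm_prod_le_power) auto
    then show ?thesis using True by (simp add: pole_quot_def)
  qed (use Q1 in \<open>simp add: pole_quot_def\<close>)
  have ek: "norm (em_kernel (pole_quot K x ys) (pole_prod K x ys) (x + mz_exp ys) q i) \<le> L"
    if "x # ys \<in> bounded_lists (Suc r) B" "q + i \<le> K" for x ys q i
  proof (cases "i = 0")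
    case True
    then show ?thesis using pq[OF that(1), of q] L(1) by (simp add: em_kernel_def)
  next
    case False
    have "norm (pochhammer (x + mz_exp ys + of_nat q) (i - 1)) \<le> Q"
      unfolding pochhammer_prod Q_def
    proof (intro norm_prod_le_power M1)
      fix j assume "j \<in> {0..<i - 1}"
      then show "norm (x + mz_exp ys + of_nat q + of_nat j) \<le> M"
        using fac(1)[OF that(1), of "q + j"] that(2) by (simp add: add.assoc)
    qed (use that in auto)
    then have "norm (em_kernel (pole_quot K x ys) (pole_prod K x ys) (x + mz_exp ys) q i)
       \<le> Q * (\<Sum>i\<le>K. norm (bern_coeff i)) * Q"
      unfolding em_kernel_def using False pp[OF that(1)] that(2) Q1
      by (auto simp: norm_mult intro!: mult_mono mult_nonneg_nonneg sum_nonneg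
            member_le_sum[of i "{..K}" "\<lambda>i. norm (bern_coeff i)"])
    then show ?thesis using Q1 by (simp add: L_def)
  qed
  have ec: "norm (em_coeff (pole_quot K x ys) (pole_prod K x ys) (x + mz_exp ys) (cleared_coeff \<delta> K ys) t) \<le> E"
    if xy: "x # ys \<in> bounded_lists (Suc r) B" and t: "t < K" for x ys t
  proof -
    have ys: "ys \<in> bounded_lists r B" using xy by (simp add: bounded_lists_Cons)
    have "norm (em_coeff (pole_quot K x ys) (pole_prod K x ys) (x + mz_exp ys) (cleared_coeff \<delta> K ys) t)
        \<le> (\<Sum>q\<le>t. C * L)"
      unfolding em_coeff_def
    proof (rule sum_norm_le)
      fix q assume q: "q \<in> {..t}"
      have "norm (cleared_coeff \<delta> K ys q) \<le> C" using U ys q t by (auto simp: uniform_expansion_def)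
      then show "norm (cleared_coeff \<delta> K ys q *
          em_kernel (pole_quot K x ys) (pole_prod K x ys) (x + mz_exp ys) q (t - q)) \<le> C * L"
        unfolding norm_mult using ek[OF xy, of q "t - q"] q t C0 by (intro mult_mono) auto
    qed
    also have "\<dots> \<le> E" unfolding E_def using t C0 L by (auto intro!: mult_right_mono)
    finally show ?thesis .
  qed
  define B' where "B' = M + Q + E"
  obtain C1 where C1: "C1 \<ge> 0" and rem: "\<And>a c f u d m.
     norm a \<le> B' \<Longrightarrow> norm d \<le> B' \<Longrightarrow> (\<And>t. t < K \<Longrightarrow> norm (em_coeff u d a c t) \<le> B') \<Longrightarrow>
     (\<And>t. t < K \<Longrightarrow> c t * u t * (a + of_nat t - 1) = d * c t) \<Longrightarrow>
     (\<And>m. m \<ge> 1 \<Longrightarrow> norm (f m - (\<Sum>t<K. c t * npow m (a + of_nat t))) \<le> C * real m powr (- Re a - real K)) \<Longrightarrow>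
     m \<ge> 2 \<Longrightarrow> norm (em_rem K u d a c f m) \<le> C1 * real m powr (- Re a - real K)"
    unfolding em_rem_def using em_remainder[of B' K C] by (smt (verit))
  have re: "norm (em_rem K (pole_quot K x ys) (pole_prod K x ys) (x + mz_exp ys) (cleared_coeff \<delta> K ys)
              (\<lambda>m. npow m x * cleared_tail \<delta> K ys m) m) \<le> C1 * real m powr (- Re (x + mz_exp ys) - real K)"
    if xy: "x # ys \<in> bounded_lists (Suc r) B" and m: "m \<ge> 2" for x ys m
  proof (rule rem)
    have ys: "ys \<in> bounded_lists r B" using xy by (simp add: bounded_lists_Cons)
    show "norm (x + mz_exp ys) \<le> B'" using a[OF xy] Q1 E0 by (simp add: B'_def)
    show "norm (pole_prod K x ys) \<le> B'" using pp[OF xy] M1 E0 by (simp add: B'_def)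
    show "norm (em_coeff (pole_quot K x ys) (pole_prod K x ys) (x + mz_exp ys) (cleared_coeff \<delta> K ys) t) \<le> B'"
      if "t < K" for t using ec[OF xy that] M1 Q1 by (simp add: B'_def)
    show "cleared_coeff \<delta> K ys t * pole_quot K x ys t * (x + mz_exp ys + of_nat t - 1)
           = pole_prod K x ys * cleared_coeff \<delta> K ys t" if "t < K" for t using that by (rule pole_quot_mult)
    fix m :: nat assume m: "m \<ge> 1"
    have "npow m x * cleared_tail \<delta> K ys m - (\<Sum>t<K. cleared_coeff \<delta> K ys t * npow m (x + mz_exp ys + of_nat t))
      = npow m x * (cleared_tail \<delta> K ys m - (\<Sum>t<K. cleared_coeff \<delta> K ys t * npow m (mz_exp ys + of_nat t)))"
      by (simp add: right_diff_distrib sum_distrib_left npow_add mult_ac)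
    also have "norm \<dots> \<le> real m powr (- Re x) * (C * real m powr (- Re (mz_exp ys) - real K))"
      unfolding norm_mult norm_npow using U ys m by (intro mult_left_mono) (auto simp: uniform_expansion_def)
    also have "\<dots> = C * real m powr (- Re x + (- Re (mz_exp ys) - real K))"
      by (simp only: mult.left_commute[of _ C] powr_add)
    also have "- Re x + (- Re (mz_exp ys) - real K) = - Re (x + mz_exp ys) - real K" by simp
    finally show "norm (npow m x * cleared_tail \<delta> K ys m - (\<Sum>t<K. cleared_coeff \<delta> K ys t * npow m (x + mz_exp ys + of_nat t)))
      \<le> C * real m powr (- Re (x + mz_exp ys) - real K)" .
  qed fact
  define C' where "C' = C1 + Q + E"
  have C': "C' \<ge> 0" "Q \<le> C'" "E \<le> C'" "C1 \<le> C'" using C1 Q1 E0 by (auto simp: C'_def)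
  show ?thesis
  proof
    show "0 \<le> C'" by fact
    show "norm (pole_prod K x ys) \<le> C'" if "x # ys \<in> bounded_lists (Suc r) B" for x ys
      using pp[OF that] C' by simp
    show "norm (em_coeff (pole_quot K x ys) (pole_prod K x ys) (x + mz_exp ys) (cleared_coeff \<delta> K ys) t) \<le> C'"
      if "x # ys \<in> bounded_lists (Suc r) B" "t < K" for x ys t using ec[OF that] C' by simp
    show "norm (em_rem K (pole_quot K x ys) (pole_prod K x ys) (x + mz_exp ys) (cleared_coeff \<delta> K ys)
              (\<lambda>m. npow m x * cleared_tail \<delta> K ys m) m) \<le> C' * real m powr (- Re (x + mz_exp ys) - real K)"
      if "x # ys \<in> bounded_lists (Suc r) B" "m \<ge> 2" for x ys m
      by (intro order_trans[OF re[OF that]] mult_right_mono C') simp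
  qed
qed

lemma Re_arg_ge:
  assumes "x # ys \<in> bounded_lists (Suc r) B" "real K \<ge> real (Suc r) * (B + 1) + 2"
  shows "Re (x + mz_exp ys) + real K \<ge> 2"
proof -
  have x: "norm x \<le> B" and ys: "ys \<in> bounded_lists r B" using assms by (auto simp: bounded_lists_Cons)
  have "norm (x + mz_exp ys) \<le> real (Suc r) * (B + 1)"
    using norm_triangle_ineq[of x "mz_exp ys"] x norm_mz_exp_le[OF ys] by (simp add: algebra_simps)
  then show ?thesis using abs_Re_le_cmod[of "x + mz_exp ys"] assms(2) by linarith
qed

lemma uniform_expansion_exists:
  assumes "B \<ge> 0" "real K \<ge> real r * (B + 1) + 2"
  shows "\<exists>C. uniform_expansion \<delta> K B r C"
  using assms(2)
proof (induction r)
  case 0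
  have K: "K \<ge> 1" using 0 by simp
  have "(\<Sum>t<K. (if t = 0 then 1 else 0) * npow n (of_nat t)) = 1" if "n \<ge> 1" for n
    using K that by (subst sum.remove[of _ 0]) auto
  then have "uniform_expansion \<delta> K B 0 1"
    by (auto simp: uniform_expansion_def bounded_lists_def)
  then show ?case by blast
next
  case (Suc r)
  have "real K \<ge> real r * (B + 1) + 2" using Suc.prems assms(1) by (simp add: algebra_simps)
  then obtain C where U: "uniform_expansion \<delta> K B r C" using Suc.IH by blast
  have "0 \<le> real (Suc r) * (B + 1)" using assms(1) by (intro mult_nonneg_nonneg) auto
  then have K1: "K \<ge> 1" using Suc.prems by linarith
  obtain C' where C': "C' \<ge> 0" and
    pp: "\<And>x ys. x # ys \<in> bounded_lists (Suc r) B \<Longrightarrow> norm (pole_prod K x ys) \<le> C'" and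
    ec: "\<And>x ys t. x # ys \<in> bounded_lists (Suc r) B \<Longrightarrow> t < K \<Longrightarrow>
       norm (em_coeff (pole_quot K x ys) (pole_prod K x ys) (x + mz_exp ys) (cleared_coeff \<delta> K ys) t) \<le> C'" and
    re: "\<And>x ys m. x # ys \<in> bounded_lists (Suc r) B \<Longrightarrow> m \<ge> 2 \<Longrightarrow>
       norm (em_rem K (pole_quot K x ys) (pole_prod K x ys) (x + mz_exp ys) (cleared_coeff \<delta> K ys)
              (\<lambda>m. npow m x * cleared_tail \<delta> K ys m) m) \<le> C' * real m powr (- Re (x + mz_exp ys) - real K)"
    using uniform_step[OF U K1] by blast
  have C0: "C \<ge> 0" using U by (simp add: uniform_expansion_def)
  define D where "D = norm \<delta> * C' * C"
  have D0: "D \<ge> 0" unfolding D_def using C' C0 by simp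
  \<comment> \<open>One \<open>D\<close> pays for the error of the inner tail in the \<delta>-term.
    The other pays for its last coefficient: the shift by one pushes index \<open>K - 1\<close> out
    of the first \<open>K\<close> coefficients.\<close>
  have "uniform_expansion \<delta> K B (Suc r) (C' + D + D)"
    unfolding uniform_expansion_def
  proof (intro conjI ballI allI impI)
    show "0 \<le> C' + D + D" using C' D0 by simp
    fix ss assume ss: "ss \<in> bounded_lists (Suc r) B"
    then obtain x ys where ss_eq: "ss = x # ys" by (cases ss) (auto simp: bounded_lists_def)
    note xy = ss[unfolded ss_eq]
    have ys: "ys \<in> bounded_lists r B" using xy by (simp add: bounded_lists_Cons)
    let ?d = "pole_prod K x ys" and ?c = "cleared_coeff \<delta> K ys" and ?a = "x + mz_exp ys"
    let ?e = "em_coeff (pole_quot K x ys) ?d ?a ?c" and ?f = "\<lambda>m. npow m x * cleared_tail \<delta> K ys m"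
    have c: "norm (?c t) \<le> C" if "t < K" for t using U ys that by (auto simp: uniform_expansion_def)
    have dc: "norm (\<delta> * ?d * ?c t) \<le> D" if "t < K" for t
      unfolding norm_mult D_def using pp[OF xy] c[OF that] C' by (intro mult_mono) auto
    {
      fix t assume t: "t < K"
      have "norm (cleared_coeff \<delta> K ss t) \<le> norm (?e t) + norm (if t = 0 then 0 else \<delta> * ?d * ?c (t - 1))"
        unfolding ss_eq cleared_coeff.simps by (rule norm_triangle_ineq)
      also have "norm (if t = 0 then 0 else \<delta> * ?d * ?c (t - 1)) \<le> D" using dc[of "t - 1"] t D0 by auto
      finally show "norm (cleared_coeff \<delta> K ss t) \<le> C' + D + D" using ec[OF xy t] D0 by linarith
    }
    fix n :: nat assume n: "n \<ge> 1"
    let ?M = "real n powr (- (Re ?a - 1) - real K)"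
    have tail: "norm (em_tail K (pole_quot K x ys) ?d ?a ?c ?f n - (\<Sum>t<K. ?e t * npow n (?a - 1 + of_nat t))) \<le> C' * ?M"
      by (rule em_tail_props(2)[OF re[OF xy] Re_arg_ge[OF xy Suc.prems] n])
    obtain K' where K': "K = Suc K'" using K1 by (cases K) auto
    let ?r = "cleared_tail \<delta> K ys n - (\<Sum>t<K. ?c t * npow n (mz_exp ys + of_nat t))"
    have sh0: "npow n (?a - 1 + of_nat (Suc t)) = npow n x * npow n (mz_exp ys + of_nat t)" for t
      by (subst npow_add[symmetric]) (simp add: algebra_simps)
    have sh: "(\<Sum>t<K. (if t = 0 then 0 else \<delta> * ?d * ?c (t - 1)) * npow n (?a - 1 + of_nat t))
       = \<delta> * ?d * npow n x * (\<Sum>t<K'. ?c t * npow n (mz_exp ys + of_nat t))"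
      unfolding K' by (subst sum.lessThan_Suc_shift)
        (simp add: sum_distrib_left sh0 mult_ac del: of_nat_Suc)
    have eq: "cleared_tail \<delta> K ss n - (\<Sum>t<K. cleared_coeff \<delta> K ss t * npow n (mz_exp ss + of_nat t))
       = (em_tail K (pole_quot K x ys) ?d ?a ?c ?f n - (\<Sum>t<K. ?e t * npow n (?a - 1 + of_nat t)))
         + \<delta> * ?d * npow n x * ?r + \<delta> * ?d * ?c K' * npow n (?a + of_nat K')"
    proof -
      have 1: "(\<Sum>t<K. cleared_coeff \<delta> K ss t * npow n (mz_exp ss + of_nat t))
         = (\<Sum>t<K. ?e t * npow n (?a - 1 + of_nat t)) + \<delta> * ?d * npow n x * (\<Sum>t<K'. ?c t * npow n (mz_exp ys + of_nat t))"
        unfolding ss_eq cleared_coeff.simps mz_exp.simps distrib_right sum.distrib sh ..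
      have 2: "(\<Sum>t<K. ?c t * npow n (mz_exp ys + of_nat t))
         = (\<Sum>t<K'. ?c t * npow n (mz_exp ys + of_nat t)) + ?c K' * npow n (mz_exp ys + of_nat K')"
        unfolding K' by simp
      have 3: "npow n (?a + of_nat K') = npow n x * npow n (mz_exp ys + of_nat K')"
        by (simp add: add.assoc flip: npow_add)
      have 4: "cleared_tail \<delta> K ss n = em_tail K (pole_quot K x ys) ?d ?a ?c ?f n + \<delta> * ?d * (npow n x * cleared_tail \<delta> K ys n)"
        unfolding ss_eq by simp
      \<comment> \<open>Stated for abstract numbers, so that it is a bare ring identity.\<close>
      have 5: "T = E + e * d * (p * w) \<Longrightarrow> S1 = E' + e * d * p * s \<Longrightarrow> S = s + c * k \<Longrightarrow> k' = p * k \<Longrightarrow>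
          T - S1 = (E - E') + e * d * p * (w - S) + e * d * c * k'"
        for T E E' e d p w S1 S s c k k' :: complex by (simp add: algebra_simps)
      show ?thesis by (rule 5[OF 4 1 2 3])
    qed
    have "norm (cleared_tail \<delta> K ss n - (\<Sum>t<K. cleared_coeff \<delta> K ss t * npow n (mz_exp ss + of_nat t)))
        \<le> C' * ?M + D * ?M + D * ?M"
      unfolding eq
    proof (intro norm_triangle_mono tail)
      have "norm (\<delta> * ?d * npow n x * ?r) \<le> norm \<delta> * C' * real n powr (- Re x) * (C * real n powr (- Re (mz_exp ys) - real K))"
        unfolding norm_mult norm_npow using pp[OF xy] U ys n C'
        by (intro mult_mono mult_nonneg_nonneg) (auto simp: uniform_expansion_def)
      also have "\<dots> = D * real n powr (- Re x + (- Re (mz_exp ys) - real K))"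
        unfolding D_def powr_add by (simp add: mult_ac)
      also have "\<dots> \<le> D * ?M" using n D0 by (intro mult_left_mono powr_mono) auto
      finally show "norm (\<delta> * ?d * npow n x * ?r) \<le> D * ?M" .
      have "norm (\<delta> * ?d * ?c K' * npow n (?a + of_nat K')) \<le> D * real n powr (- Re (?a + of_nat K'))"
        unfolding norm_mult[of _ "npow n _"] norm_npow using dc[of K'] K' by (intro mult_right_mono) auto
      also have "- Re (?a + of_nat K') = - (Re ?a - 1) - real K" by (simp add: K')
      finally show "norm (\<delta> * ?d * ?c K' * npow n (?a + of_nat K')) \<le> D * ?M" .
    qed
    also have "\<dots> = (C' + D + D) * real n powr (- Re (mz_exp ss) - real K)"
      by (simp add: ss_eq distrib_right)
    finally show "norm (cleared_tail \<delta> K ss n - (\<Sum>t<K. cleared_coeff \<delta> K ss t * npow n (mz_exp ss + of_nat t)))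
        \<le> (C' + D + D) * real n powr (- Re (mz_exp ss) - real K)" .
  qed
  then show ?case by blast
qed

text \<open>Where the denominator is nonzero, dividing the cleared tail by it solves the plain tail
  problem. The third conjunct records this existence, which gives the \<open>SOME\<close> in
  \<open>mz_tail\<close> its meaning.\<close>

lemma mz_den_eq:
  assumes "B \<ge> 0" "real K \<ge> real r * (B + 1) + 2" "ss \<in> bounded_lists r B" "mz_den K ss \<noteq> 0"
  shows "(\<forall>t<K. cleared_coeff \<delta> K ss t = mz_den K ss * mz_coeff \<delta> ss t) \<and>
    (\<forall>n\<ge>1. cleared_tail \<delta> K ss n = mz_den K ss * mz_tail \<delta> ss n) \<and>
    (ss \<noteq> [] \<longrightarrow> (\<exists>g. is_tail (mz_exp ss) (plain_coeff (mz_exp ss + 1) (mz_coeff \<delta> (tl ss)))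
       (\<lambda>m. npow m (hd ss) * mz_tail \<delta> (tl ss) m) g))"
  using assms(2-)
proof (induction ss arbitrary: r)
  case Nil
  then show ?case by simp
next
  case (Cons x ys r')
  then obtain r where r: "r' = Suc r" by (auto simp: bounded_lists_def)
  note K = Cons.prems(1)[unfolded r] and xy = Cons.prems(2)[unfolded r]
  have Kr: "real K \<ge> real r * (B + 1) + 2" using K assms(1) by (simp add: algebra_simps)
  have ys: "ys \<in> bounded_lists r B" using xy by (simp add: bounded_lists_Cons)
  let ?d = "pole_prod K x ys" and ?D = "mz_den K ys" and ?a = "x + mz_exp ys"
  have d: "?d \<noteq> 0" and D: "?D \<noteq> 0" using Cons.prems(3) by auto
  have IHc: "cleared_coeff \<delta> K ys t = ?D * mz_coeff \<delta> ys t" if "t < K" for t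
    using Cons.IH[OF Kr ys D] that by blast
  have IHt: "cleared_tail \<delta> K ys n = ?D * mz_tail \<delta> ys n" if "n \<ge> 1" for n
    using Cons.IH[OF Kr ys D] that by blast
  have ker: "cleared_coeff \<delta> K ys q * em_kernel (pole_quot K x ys) ?d ?a q i
      = ?d * ?D * (mz_coeff \<delta> ys q * em_kernel (\<lambda>t. 1 / (?a + of_nat t - 1)) 1 ?a q i)" if q: "q < K" for q i
  proof (cases "i = 0")
    case True
    have pq: "cleared_coeff \<delta> K ys q * pole_quot K x ys q * (?a + of_nat q - 1) = ?d * cleared_coeff \<delta> K ys q"
      using q by (rule pole_quot_mult)
    show ?thesis
    proof (cases "?a + of_nat q - 1 = 0")
      \<comment> \<open>A pole despite \<open>d \<noteq> 0\<close>: the clearing identity forces the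
        coefficient on the left to be 0, and on the right division by 0 gives 0.\<close>
      case z: True
      with pq d have "cleared_coeff \<delta> K ys q = 0" by simp
      then show ?thesis using True z by (simp add: em_kernel_def)
    next
      case z: False
      then have "cleared_coeff \<delta> K ys q * pole_quot K x ys q = ?d * cleared_coeff \<delta> K ys q / (?a + of_nat q - 1)"
        using pq by (simp add: field_simps)
      then show ?thesis using True by (simp add: em_kernel_def IHc[OF q])
    qed
  next
    case False
    then show ?thesis by (simp add: em_kernel_def IHc[OF q])
  qed
  let ?e = "em_coeff (pole_quot K x ys) ?d ?a (cleared_coeff \<delta> K ys)"
  have ec: "?e t = ?d * ?D * plain_coeff ?a (mz_coeff \<delta> ys) t" if "t < K" for t
    unfolding em_coeff_def sum_distrib_left using that by (intro sum.cong refl ker) auto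
  have cc: "cleared_coeff \<delta> K (x # ys) t = mz_den K (x # ys) * mz_coeff \<delta> (x # ys) t" if t: "t < K" for t
    using ec[OF t] IHc[of "t - 1"] t by (auto simp: algebra_simps)
  obtain C where U: "uniform_expansion \<delta> K B r C"
    using uniform_expansion_exists[OF assms(1) Kr] by blast
  have "0 \<le> real r * (B + 1)" using assms(1) by (intro mult_nonneg_nonneg) auto
  then have "K \<ge> 1" using Kr by linarith
  from uniform_step[OF U this] obtain C' where "C' \<ge> 0" and
    "\<And>x ys. x # ys \<in> bounded_lists (Suc r) B \<Longrightarrow> norm (pole_prod K x ys) \<le> C'" and
    "\<And>x ys t. x # ys \<in> bounded_lists (Suc r) B \<Longrightarrow> t < K \<Longrightarrow>
       norm (em_coeff (pole_quot K x ys) (pole_prod K x ys) (x + mz_exp ys) (cleared_coeff \<delta> K ys) t) \<le> C'" and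
    re': "\<And>x ys m. x # ys \<in> bounded_lists (Suc r) B \<Longrightarrow> m \<ge> 2 \<Longrightarrow>
       norm (em_rem K (pole_quot K x ys) (pole_prod K x ys) (x + mz_exp ys) (cleared_coeff \<delta> K ys)
              (\<lambda>m. npow m x * cleared_tail \<delta> K ys m) m) \<le> C' * real m powr (- Re (x + mz_exp ys) - real K)"
    by blast
  note re = re'[OF xy]
  let ?T = "em_tail K (pole_quot K x ys) ?d ?a (cleared_coeff \<delta> K ys) (\<lambda>m. npow m x * cleared_tail \<delta> K ys m)"
  have K1: "Re ?a + real K \<ge> 2" by (rule Re_arg_ge[OF xy K])
  have "is_tail (?a - 1) ?e (\<lambda>n. ?d * (npow n x * cleared_tail \<delta> K ys n)) ?T"
    by (rule em_tail_is_tail[OF re K1])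
  then have "is_tail (?a - 1) (\<lambda>t. ?d * ?D * plain_coeff ?a (mz_coeff \<delta> ys) t)
      (\<lambda>n. ?d * (npow n x * cleared_tail \<delta> K ys n)) ?T"
    by (rule is_tail_cong_coeff[where K = K]) (use ec K1 in auto)
  from is_tail_cmult[OF this, of "1 / (?d * ?D)"]
  have "is_tail (?a - 1) (plain_coeff ?a (mz_coeff \<delta> ys)) (\<lambda>n. npow n x * mz_tail \<delta> ys n) (\<lambda>n. 1 / (?d * ?D) * ?T n)"
    by (rule is_tail_cong) (use d D in \<open>auto simp: IHt\<close>)
  then have ex: "\<exists>g. is_tail (?a - 1) (plain_coeff ?a (mz_coeff \<delta> ys)) (\<lambda>n. npow n x * mz_tail \<delta> ys n) g"
    and mz: "\<And>n. n \<ge> 1 \<Longrightarrow> mz_tail \<delta> (x # ys) n = 1 / (?d * ?D) * ?T n + \<delta> * (npow n x * mz_tail \<delta> ys n)"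
    by (blast, rule mz_tail_Cons)
  have "cleared_tail \<delta> K (x # ys) n = mz_den K (x # ys) * mz_tail \<delta> (x # ys) n" if n: "n \<ge> 1" for n
    unfolding mz[OF n] cleared_tail.simps mz_den.simps IHt[OF n] using d D by (simp add: field_simps)
  with cc ex show ?case by simp
qed

section \<open>Holomorphic functions of several variables\<close>

lemma polydisc_iff: "z \<in> polydisc r p e \<longleftrightarrow> z \<in> Cspace r \<and> (\<forall>i\<in>{1..r}. dist (p i) (z i) < e)"
  by (auto simp: polydisc_def PiE_iff)

lemma polydisc_upd:
  assumes "z \<in> polydisc r p e" "i \<in> {1..r}"
  shows "z(i := w) \<in> polydisc r p e \<longleftrightarrow> w \<in> ball (p i) e"
  using assms by (auto simp: polydisc_iff PiE_iff extensional_def)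

lemma polydisc_mono: "e' \<le> e \<Longrightarrow> polydisc r p e' \<subseteq> polydisc r p e"
  by (fastforce simp: polydisc_iff)

lemma polydisc_sub:
  assumes "q \<in> polydisc r p e"
  obtains e' where "e' > 0" "polydisc r q e' \<subseteq> polydisc r p e"
proof -
  define e' where "e' = Min (insert 1 ((\<lambda>i. e - dist (p i) (q i)) ` {1..r}))"
  have "e' > 0" unfolding e'_def using assms by (subst Min_gr_iff) (auto simp: polydisc_iff)
  moreover have "polydisc r q e' \<subseteq> polydisc r p e"
  proof
    fix z assume z: "z \<in> polydisc r q e'"
    have "dist (p i) (z i) < e" if "i \<in> {1..r}" for i
    proof -
      have "e' \<le> e - dist (p i) (q i)" unfolding e'_def using that by (intro Min_le) auto
      moreover have "dist (q i) (z i) < e'" using z that by (simp add: polydisc_iff)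
      ultimately show ?thesis using dist_triangle[of "p i" "z i" "q i"] by linarith
    qed
    then show "z \<in> polydisc r p e" using z by (simp add: polydisc_iff)
  qed
  ultimately show ?thesis using that by blast
qed

lemma holomorphic_several_subset:
  assumes "holomorphic_several r f U" "V \<subseteq> U"
  shows "holomorphic_several r f V"
  using assms unfolding holomorphic_several_def
  by (blast intro: continuous_on_subset holomorphic_on_subset)

lemma holomorphic_several_const: "holomorphic_several r (\<lambda>z. c) U"
  by (simp add: holomorphic_several_def)

lemma holomorphic_several_coord: "holomorphic_several r (\<lambda>z. z i) U"
proof -
  have "continuous_on U (\<lambda>z::nat \<Rightarrow> complex. z i)"
    using continuous_on_product_coordinates by (rule continuous_on_subset) auto
  moreover have "(\<lambda>w. (z(k := w)) i) holomorphic_on V" for z :: "nat \<Rightarrow> complex" and k V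
    by (cases "k = i") auto
  ultimately show ?thesis unfolding holomorphic_several_def by blast
qed

lemma holomorphic_several_compose:
  assumes "holomorphic_several r f U" "g holomorphic_on UNIV"
  shows "holomorphic_several r (\<lambda>z. g (f z)) U"
proof -
  have "continuous_on U (\<lambda>z. g (f z))"
    using assms by (intro continuous_on_compose2[OF holomorphic_on_imp_continuous_on[OF assms(2)]])
      (auto simp: holomorphic_several_def)
  moreover have "(\<lambda>w. g (f (z(i := w)))) holomorphic_on {w. z(i := w) \<in> U}"
    if "z \<in> U" "i \<in> {1..r}" for z i
    using holomorphic_on_compose_gen[of "\<lambda>w. f (z(i := w))" _ g UNIV] assms that
    by (auto simp: holomorphic_several_def o_def)
  ultimately show ?thesis by (simp add: holomorphic_several_def)
qed

lemma holomorphic_several_add: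
  "holomorphic_several r f U \<Longrightarrow> holomorphic_several r g U \<Longrightarrow> holomorphic_several r (\<lambda>z. f z + g z) U"
  by (auto simp: holomorphic_several_def intro!: continuous_intros holomorphic_intros)

lemma holomorphic_several_diff:
  "holomorphic_several r f U \<Longrightarrow> holomorphic_several r g U \<Longrightarrow> holomorphic_several r (\<lambda>z. f z - g z) U"
  by (auto simp: holomorphic_several_def intro!: continuous_intros holomorphic_intros)

lemma holomorphic_several_mult:
  "holomorphic_several r f U \<Longrightarrow> holomorphic_several r g U \<Longrightarrow> holomorphic_several r (\<lambda>z. f z * g z) U"
  by (auto simp: holomorphic_several_def intro!: continuous_intros holomorphic_intros)

lemma holomorphic_several_sum:
  "(\<And>i. i \<in> S \<Longrightarrow> holomorphic_several r (f i) U) \<Longrightarrow> holomorphic_several r (\<lambda>z. \<Sum>i\<in>S. f i z) U"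
  by (auto simp: holomorphic_several_def intro!: continuous_intros holomorphic_intros)

lemma holomorphic_several_prod:
  "(\<And>i. i \<in> S \<Longrightarrow> holomorphic_several r (f i) U) \<Longrightarrow> holomorphic_several r (\<lambda>z. \<Prod>i\<in>S. f i z) U"
  by (auto simp: holomorphic_several_def intro!: continuous_intros holomorphic_intros)

lemmas holomorphic_several_intros =
  holomorphic_several_const holomorphic_several_coord holomorphic_several_add holomorphic_several_diff
  holomorphic_several_mult holomorphic_several_sum holomorphic_several_prod

text \<open>Weierstrass' theorem in each variable separately; joint continuity comes from the
  uniform limit.\<close>

lemma holomorphic_several_uniform_limit:
  assumes f: "\<And>n. holomorphic_several r (f n) (polydisc r p e)"
    and lim: "uniform_limit (polydisc r p e) f g sequentially"
  shows "holomorphic_several r g (polydisc r p e)"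
  unfolding holomorphic_several_def
proof (intro conjI ballI)
  show "continuous_on (polydisc r p e) g"
    by (rule uniform_limit_theorem[OF _ lim]) (use f in \<open>auto simp: holomorphic_several_def\<close>)
  fix z i assume z: "z \<in> polydisc r p e" and i: "i \<in> {1..r}"
  have eq: "{w. z(i := w) \<in> polydisc r p e} = ball (p i) e" by (simp only: polydisc_upd[OF z i] Collect_mem_eq)
  have "(\<lambda>w. g (z(i := w))) holomorphic_on ball (p i) e"
  proof (rule holomorphic_uniform_sequence[where f = "\<lambda>n w. f n (z(i := w))"])
    show "(\<lambda>w. f n (z(i := w))) holomorphic_on ball (p i) e" for n
      using f[of n] z i by (auto simp: holomorphic_several_def simp flip: eq)
    fix x assume "x \<in> ball (p i) e"
    then have "\<exists>d>0. cball x d \<subseteq> ball (p i) e" using open_contains_cball[THEN iffD1, OF open_ball] by blast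
    then obtain d where d: "d > 0" "cball x d \<subseteq> ball (p i) e" by blast
    have "uniform_limit (cball x d) (\<lambda>n w. f n (z(i := w))) (\<lambda>w. g (z(i := w))) sequentially"
      unfolding uniform_limit_iff
    proof (intro allI impI)
      fix \<epsilon> :: real assume "\<epsilon> > 0"
      then have "\<forall>\<^sub>F n in sequentially. \<forall>x\<in>polydisc r p e. dist (f n x) (g x) < \<epsilon>"
        using lim by (simp add: uniform_limit_iff)
      then show "\<forall>\<^sub>F n in sequentially. \<forall>w\<in>cball x d. dist (f n (z(i := w))) (g (z(i := w))) < \<epsilon>"
        by (rule eventually_mono) (use d(2) polydisc_upd[OF z i] in blast)
    qed
    with d show "\<exists>d>0. cball x d \<subseteq> ball (p i) e \<and>
        uniform_limit (cball x d) (\<lambda>n w. f n (z(i := w))) (\<lambda>w. g (z(i := w))) sequentially" by blast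
  qed auto
  then show "(\<lambda>w. g (z(i := w))) holomorphic_on {w. z(i := w) \<in> polydisc r p e}" by (simp add: eq)
qed

lemma holomorphic_several_slice:
  assumes "holomorphic_several r f (polydisc r p e)" "z \<in> polydisc r p e" "i \<in> {1..r}"
  shows "(\<lambda>w. f (z(i := w))) holomorphic_on ball (p i) e"
proof -
  have "{w. z(i := w) \<in> polydisc r p e} = ball (p i) e"
    by (simp only: polydisc_upd[OF assms(2,3)] Collect_mem_eq)
  moreover have "(\<lambda>w. f (z(i := w))) holomorphic_on {w. z(i := w) \<in> polydisc r p e}"
    using assms unfolding holomorphic_several_def by blast
  ultimately show ?thesis by (simp only:)
qed

text \<open>The one-variable identity theorem is applied to one coordinate after another: after
  \<open>k\<close> steps the first \<open>k\<close> coordinates range over the large polydisc, while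
  the others are still close to those of \<open>q\<close>.\<close>

lemma holomorphic_several_identity:
  assumes f: "holomorphic_several r f (polydisc r p e)"
    and q: "q \<in> Cspace r" "e' > 0" "polydisc r q e' \<subseteq> polydisc r p e"
    and zero: "\<And>z. z \<in> polydisc r q e' \<Longrightarrow> f z = 0"
    and z: "z \<in> polydisc r p e"
  shows "f z = 0"
proof -
  have "q \<in> polydisc r q e'" using q by (auto simp: polydisc_iff)
  then have qp: "q \<in> polydisc r p e" using q by blast
  have "\<forall>z\<in>polydisc r p e. (\<forall>i\<in>{1..r}. k < i \<longrightarrow> z i \<in> ball (q i) e') \<longrightarrow> f z = 0" if "k \<le> r" for k
    using that
  proof (induction k)
    case 0
    then show ?case using zero by (auto simp: polydisc_iff)
  next
    case (Suc k)
    let ?i = "Suc k"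
    have i: "?i \<in> {1..r}" using Suc.prems by simp
    show ?case
    proof (intro ballI impI)
      fix z assume z: "z \<in> polydisc r p e" and near: "\<forall>i\<in>{1..r}. Suc k < i \<longrightarrow> z i \<in> ball (q i) e'"
      have "f (z(?i := z ?i)) = 0"
      proof (rule analytic_continuation_open[where s = "ball (q ?i) e' \<inter> ball (p ?i) e" and s' = "ball (p ?i) e"
            and f = "\<lambda>w. f (z(?i := w))" and g = "\<lambda>_. 0" and z = "z ?i"])
        have "q ?i \<in> ball (q ?i) e' \<inter> ball (p ?i) e" using qp q(2) i by (auto simp: polydisc_iff)
        then show "ball (q ?i) e' \<inter> ball (p ?i) e \<noteq> {}" by blast
        show "(\<lambda>w. f (z(?i := w))) holomorphic_on ball (p ?i) e"
          by (rule holomorphic_several_slice[OF f z i])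
        show "z ?i \<in> ball (p ?i) e" using z i by (auto simp: polydisc_iff)
        fix w assume w: "w \<in> ball (q ?i) e' \<inter> ball (p ?i) e"
        then have "z(?i := w) \<in> polydisc r p e" using polydisc_upd[OF z i] by auto
        moreover have "\<forall>i\<in>{1..r}. k < i \<longrightarrow> (z(?i := w)) i \<in> ball (q i) e'"
          using near w by (auto simp: less_Suc_eq)
        ultimately show "f (z(?i := w)) = 0" using Suc by simp
      qed auto
      then show "f z = 0" by simp
    qed
  qed
  from this[of r] z show ?thesis by auto
qed

lemma holomorphic_several_nonzero_sub:
  assumes "holomorphic_several r f (polydisc r p e)" "\<exists>z\<in>polydisc r p e. f z \<noteq> 0"
    "q \<in> Cspace r" "e' > 0" "polydisc r q e' \<subseteq> polydisc r p e"
  shows "\<exists>z\<in>polydisc r q e'. f z \<noteq> 0"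
  using holomorphic_several_identity[OF assms(1,3-5)] assms(2) by blast

text \<open>The same nesting of punctured neighbourhoods as in \<open>has_iterated_limit\<close>: a
  property that holds in this sense is all that an iterated limit can see.\<close>

primrec iter_eventually ::
    "nat list \<Rightarrow> (nat \<Rightarrow> complex) \<Rightarrow> ((nat \<Rightarrow> complex) \<Rightarrow> bool) \<Rightarrow> (nat \<Rightarrow> complex) \<Rightarrow> bool" where
  "iter_eventually [] a P s \<longleftrightarrow> P s"
| "iter_eventually (i # is) a P s \<longleftrightarrow> (\<forall>\<^sub>F z in at (a i). iter_eventually is a P (s(i := z)))"

lemma iter_eventually_mono:
  "iter_eventually is a P s \<Longrightarrow> (\<And>s. P s \<Longrightarrow> Q s) \<Longrightarrow> iter_eventually is a Q s"
proof (induction "is" arbitrary: s)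
  case (Cons i "is")
  then show ?case by (auto elim!: eventually_mono)
qed auto

lemma iter_eventually_conj:
  "iter_eventually is a P s \<Longrightarrow> iter_eventually is a Q s \<Longrightarrow> iter_eventually is a (\<lambda>s. P s \<and> Q s) s"
proof (induction "is" arbitrary: s)
  case (Cons i "is")
  from Cons.prems have "\<forall>\<^sub>F z in at (a i). iter_eventually is a P (s(i := z)) \<and> iter_eventually is a Q (s(i := z))"
    by (auto intro: eventually_conj)
  then show ?case using Cons.IH by (auto elim!: eventually_mono)
qed auto

lemma iter_eventually_ex: "iter_eventually is a P s \<Longrightarrow> \<exists>s. P s"
proof (induction "is" arbitrary: s)
  case (Cons i "is")
  then obtain z where "iter_eventually is a P (s(i := z))"
    using eventually_happens[of _ "at (a i)"] by (auto simp: trivial_limit_at)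
  then show ?case by (rule Cons.IH)
qed auto

lemma has_iterated_limit_cong:
  assumes "iter_eventually is a (\<lambda>s. F s = G s) s" "has_iterated_limit is a G s v"
  shows "has_iterated_limit is a F s v"
  using assms
proof (induction "is" arbitrary: s v)
  case (Cons i "is")
  from Cons.prems(2) obtain f where
    f: "\<forall>\<^sub>F z in at (a i). has_iterated_limit is a G (s(i := z)) (f z)" "(f \<longlongrightarrow> v) (at (a i))" by auto
  from Cons.prems(1) have "\<forall>\<^sub>F z in at (a i). iter_eventually is a (\<lambda>s. F s = G s) (s(i := z))" by simp
  with f(1) have "\<forall>\<^sub>F z in at (a i). has_iterated_limit is a F (s(i := z)) (f z)"
    by eventually_elim (rule Cons.IH)
  with f(2) show ?case by auto
qed auto

text \<open>The witness \<open>w\<close> is moved into place. It agrees with \<open>s\<close>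
  outside \<open>is\<close>, and one coordinate after the other is replaced by a value near
  \<open>a i\<close>. Along each such line \<open>H\<close> does not vanish identically, because
  \<open>H w \<noteq> 0\<close>, so its zeros cannot accumulate at \<open>a i\<close>. When
  \<open>is\<close> is exhausted, \<open>w\<close> is \<open>s\<close>.\<close>

lemma iter_eventually_nonzero:
  assumes H: "holomorphic_several r H (polydisc r a e)" and e: "e > 0"
    and "distinct is" "set is \<subseteq> {1..r}" "s \<in> Cspace r"
    and "w \<in> polydisc r a e" "H w \<noteq> 0" "\<And>i. i \<notin> set is \<Longrightarrow> w i = s i"
  shows "iter_eventually is a (\<lambda>s. s \<in> polydisc r a e \<and> H s \<noteq> 0) s"
  using assms(3-)
proof (induction "is" arbitrary: s w)
  case Nil
  then have "w = s" by auto
  then show ?case using Nil by auto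
next
  case (Cons i "is")
  have i: "i \<in> {1..r}" using Cons.prems by simp
  have "\<forall>\<^sub>F z in at (a i). H (w(i := z)) \<noteq> 0 \<and> z \<in> ball (a i) e"
  proof (rule non_zero_neighbour_alt)
    show "(\<lambda>z. H (w(i := z))) holomorphic_on ball (a i) e"
      by (rule holomorphic_several_slice[OF H Cons.prems(4) i])
    show "w i \<in> ball (a i) e" using Cons.prems(4) i by (auto simp: polydisc_iff)
  qed (use e Cons.prems in auto)
  then show ?case unfolding iter_eventually.simps
  proof (rule eventually_mono)
    fix z assume z: "H (w(i := z)) \<noteq> 0 \<and> z \<in> ball (a i) e"
    show "iter_eventually is a (\<lambda>s. s \<in> polydisc r a e \<and> H s \<noteq> 0) (s(i := z))"
    proof (rule Cons.IH)
      show "w(i := z) \<in> polydisc r a e" using polydisc_upd[OF Cons.prems(4) i] z by simp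
      show "s(i := z) \<in> Cspace r" using Cons.prems(3) i by (auto simp: PiE_iff extensional_def)
      show "H (w(i := z)) \<noteq> 0" using z by simp
    qed (use Cons.prems in auto)
  qed
qed

lemma iter_eventually_nonzero_full:
  assumes "holomorphic_several r H (polydisc r a e)" "e > 0" "distinct is" "set is = {1..r}" "s \<in> Cspace r"
    and "\<exists>w\<in>polydisc r a e. H w \<noteq> 0"
  shows "iter_eventually is a (\<lambda>s. s \<in> polydisc r a e \<and> H s \<noteq> 0) s"
proof -
  obtain w where "w \<in> polydisc r a e" "H w \<noteq> 0" using assms by blast
  then show ?thesis using assms by (intro iter_eventually_nonzero[where w = w])
    (auto simp: polydisc_iff PiE_iff extensional_def)
qed

text \<open>There are no zero divisors: nested punctured neighbourhoods of the centre avoid both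
  zero sets at once and are never empty.\<close>

lemma holomorphic_several_nonzero_mult:
  assumes "holomorphic_several r f (polydisc r p e)" "holomorphic_several r g (polydisc r p e)" "e > 0"
    and "\<exists>z\<in>polydisc r p e. f z \<noteq> 0" "\<exists>z\<in>polydisc r p e. g z \<noteq> 0"
  shows "\<exists>z\<in>polydisc r p e. f z * g z \<noteq> 0"
proof -
  let ?is = "[1..<Suc r]" and ?s = "\<lambda>i\<in>{1..r}. 0"
  have i: "distinct ?is" "set ?is = {1..r}" "?s \<in> Cspace r" by auto
  have "iter_eventually ?is p (\<lambda>s. (s \<in> polydisc r p e \<and> f s \<noteq> 0) \<and> s \<in> polydisc r p e \<and> g s \<noteq> 0) ?s"
    by (intro iter_eventually_conj iter_eventually_nonzero_full assms i)
  from iter_eventually_ex[OF this] show ?thesis by auto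
qed

section \<open>Uniqueness of meromorphic continuation\<close>

lemma meromorphic_severalE:
  assumes "meromorphic_several r F" "p \<in> Cspace r"
  obtains e g h where "e > 0" "holomorphic_several r g (polydisc r p e)"
    "holomorphic_several r h (polydisc r p e)" "\<exists>z\<in>polydisc r p e. h z \<noteq> 0"
    "\<And>z. z \<in> polydisc r p e \<Longrightarrow> h z \<noteq> 0 \<Longrightarrow> F z = g z / h z"
proof -
  from bspec[OF assms(1)[unfolded meromorphic_several_def] assms(2)]
  show ?thesis by (elim exE conjE) (erule (3) that, blast)
qed

text \<open>Values on the zero set of a local denominator are unconstrained, so equality of
  meromorphic functions can only be asked off the zeros of some nonzero holomorphic
  \<open>H\<close>.\<close>

definition generically_equal ::
    "nat \<Rightarrow> ((nat \<Rightarrow> complex) \<Rightarrow> complex) \<Rightarrow> ((nat \<Rightarrow> complex) \<Rightarrow> complex) \<Rightarrow> (nat \<Rightarrow> complex) \<Rightarrow> bool" where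
  "generically_equal r F G p \<longleftrightarrow> (\<exists>e>0. \<exists>H. holomorphic_several r H (polydisc r p e) \<and>
     (\<exists>z\<in>polydisc r p e. H z \<noteq> 0) \<and> (\<forall>z\<in>polydisc r p e. H z \<noteq> 0 \<longrightarrow> F z = G z))"

text \<open>On a polydisc where both functions are quotients, the cross difference
  \<open>g h' - g' h\<close> vanishes near \<open>x\<close>, hence everywhere by the identity
  theorem.\<close>

lemma generically_equal_transfer:
  assumes g: "holomorphic_several r g (polydisc r p e)" and h: "holomorphic_several r h (polydisc r p e)"
    and hn: "\<exists>z\<in>polydisc r p e. h z \<noteq> 0" and F: "\<And>z. z \<in> polydisc r p e \<Longrightarrow> h z \<noteq> 0 \<Longrightarrow> F z = g z / h z"
    and g': "holomorphic_several r g' (polydisc r p e)" and h': "holomorphic_several r h' (polydisc r p e)"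
    and hn': "\<exists>z\<in>polydisc r p e. h' z \<noteq> 0" and G: "\<And>z. z \<in> polydisc r p e \<Longrightarrow> h' z \<noteq> 0 \<Longrightarrow> G z = g' z / h' z"
    and x: "x \<in> polydisc r p e" and y: "y \<in> polydisc r p e" and eq: "generically_equal r F G x"
  shows "generically_equal r F G y"
proof -
  let ?k = "\<lambda>z. g z * h' z - g' z * h z"
  have k: "holomorphic_several r ?k (polydisc r p e)" by (intro holomorphic_several_intros g h g' h')
  obtain e1 H where e1: "e1 > 0" and H: "holomorphic_several r H (polydisc r x e1)"
    and Hn: "\<exists>z\<in>polydisc r x e1. H z \<noteq> 0" and FG: "\<And>z. z \<in> polydisc r x e1 \<Longrightarrow> H z \<noteq> 0 \<Longrightarrow> F z = G z"
    using eq unfolding generically_equal_def by blast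
  obtain e2 where e2: "e2 > 0" "polydisc r x e2 \<subseteq> polydisc r p e" using polydisc_sub[OF x] .
  define d where "d = min e1 e2"
  have d: "d > 0" "polydisc r x d \<subseteq> polydisc r x e1" "polydisc r x d \<subseteq> polydisc r p e"
    using e1 e2 polydisc_mono[of d e1 r x] polydisc_mono[of d e2 r x] by (auto simp: d_def)
  have xC: "x \<in> Cspace r" and yC: "y \<in> Cspace r" using x y by (auto simp: polydisc_iff)
  note sub = holomorphic_several_subset
  have kz: "?k z = 0" if "z \<in> polydisc r x d" for z
  proof (rule ccontr)
    assume nz: "?k z \<noteq> 0"
    \<comment> \<open>A product of nonzero holomorphic functions is nonzero somewhere. At such a
      point both quotients are valid and \<open>F = G\<close>, which contradicts
      \<open>?k \<noteq> 0\<close>.\<close>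
    have "\<exists>z\<in>polydisc r x d. ?k z * (H z * (h z * h' z)) \<noteq> 0"
      using that nz xC d
      by (intro holomorphic_several_nonzero_mult holomorphic_several_mult sub[OF k d(3)] sub[OF H d(2)]
           sub[OF h d(3)] sub[OF h' d(3)] holomorphic_several_nonzero_sub[OF H Hn]
           holomorphic_several_nonzero_sub[OF h hn] holomorphic_several_nonzero_sub[OF h' hn']) auto
    then obtain w where w: "w \<in> polydisc r x d" "?k w \<noteq> 0" "H w \<noteq> 0" "h w \<noteq> 0" "h' w \<noteq> 0" by auto
    then have "w \<in> polydisc r x e1" "w \<in> polydisc r p e" using d by blast+
    with w have "g w / h w = g' w / h' w" using F[of w] G[of w] FG[of w] by simp
    with w show False by (simp add: field_simps)
  qed
  have kp: "?k z = 0" if "z \<in> polydisc r p e" for z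
    by (rule holomorphic_several_identity[OF k xC d(1,3) kz that])
  obtain e3 where e3: "e3 > 0" "polydisc r y e3 \<subseteq> polydisc r p e" using polydisc_sub[OF y] .
  have "\<exists>z\<in>polydisc r y e3. h z * h' z \<noteq> 0"
    by (intro holomorphic_several_nonzero_mult sub[OF h e3(2)] sub[OF h' e3(2)] e3 yC
         holomorphic_several_nonzero_sub[OF h hn] holomorphic_several_nonzero_sub[OF h' hn'])
  moreover have "F z = G z" if "z \<in> polydisc r y e3" "h z * h' z \<noteq> 0" for z
  proof -
    have "z \<in> polydisc r p e" using that e3 by auto
    then have "F z = g z / h z" "G z = g' z / h' z" "g z * h' z = g' z * h z"
      using kp[of z] F[of z] G[of z] that by auto
    then show ?thesis using that by (simp add: frac_eq_eq)
  qed
  moreover have "holomorphic_several r (\<lambda>z. h z * h' z) (polydisc r y e3)"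
    by (intro holomorphic_several_mult sub[OF h e3(2)] sub[OF h' e3(2)])
  ultimately show ?thesis unfolding generically_equal_def using e3(1)
    by (intro exI[of _ e3] conjI exI[of _ "\<lambda>z. h z * h' z"]) auto
qed

text \<open>Along the segment from \<open>p0\<close> to \<open>p\<close>, generic equality is
  locally constant by the transfer lemma, and an interval is connected.\<close>

lemma meromorphic_several_unique:
  assumes F: "meromorphic_several r F" and G: "meromorphic_several r G"
    and p0: "p0 \<in> Cspace r" and eq0: "generically_equal r F G p0" and p: "p \<in> Cspace r"
  shows "generically_equal r F G p"
proof -
  define \<gamma> :: "real \<Rightarrow> nat \<Rightarrow> complex" where
    "\<gamma> t = (\<lambda>i\<in>{1..r}. (1 - of_real t) * p0 i + of_real t * p i)" for t
  have \<gamma>C: "\<gamma> t \<in> Cspace r" for t by (auto simp: \<gamma>_def)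
  have \<gamma>01: "\<gamma> 0 = p0" "\<gamma> 1 = p" using p0 p by (auto simp: \<gamma>_def fun_eq_iff PiE_iff extensional_def)
  have "generically_equal r F G (\<gamma> 1)"
  proof (rule connected_induction_simple[of "{0..1::real}" 0 1 "\<lambda>t. generically_equal r F G (\<gamma> t)"])
    show "generically_equal r F G (\<gamma> 0)" using eq0 by (simp add: \<gamma>01)
    fix t :: real assume t: "t \<in> {0..1}"
    obtain e1 g h where e1: "e1 > 0" and g: "holomorphic_several r g (polydisc r (\<gamma> t) e1)"
      and h: "holomorphic_several r h (polydisc r (\<gamma> t) e1)" and hn: "\<exists>z\<in>polydisc r (\<gamma> t) e1. h z \<noteq> 0"
      and Fq: "\<And>z. z \<in> polydisc r (\<gamma> t) e1 \<Longrightarrow> h z \<noteq> 0 \<Longrightarrow> F z = g z / h z"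
      by (rule meromorphic_severalE[OF F \<gamma>C[of t]]) (rule that)
    obtain e2 g' h' where e2: "e2 > 0" and g': "holomorphic_several r g' (polydisc r (\<gamma> t) e2)"
      and h': "holomorphic_several r h' (polydisc r (\<gamma> t) e2)" and hn': "\<exists>z\<in>polydisc r (\<gamma> t) e2. h' z \<noteq> 0"
      and Gq: "\<And>z. z \<in> polydisc r (\<gamma> t) e2 \<Longrightarrow> h' z \<noteq> 0 \<Longrightarrow> G z = g' z / h' z"
      by (rule meromorphic_severalE[OF G \<gamma>C[of t]]) (rule that)
    define e where "e = min e1 e2"
    have e: "e > 0" using e1 e2 by (simp add: e_def)
    have s1: "polydisc r (\<gamma> t) e \<subseteq> polydisc r (\<gamma> t) e1" and s2: "polydisc r (\<gamma> t) e \<subseteq> polydisc r (\<gamma> t) e2"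
      unfolding e_def by (intro polydisc_mono min.cobounded1 min.cobounded2)+
    define T where "T = {0..1} \<inter> (\<Inter>i\<in>{1..r}. {t'. dist (\<gamma> t i) (\<gamma> t' i) < e})"
    have "open (\<Inter>i\<in>{1..r}. {t'. dist (\<gamma> t i) (\<gamma> t' i) < e})"
    proof (intro open_INT ballI)
      fix i assume "i \<in> {1..r}"
      then show "open {t'. dist (\<gamma> t i) (\<gamma> t' i) < e}"
        unfolding \<gamma>_def by (intro open_Collect_less continuous_intros) (auto intro!: continuous_intros)
    qed auto
    then have "openin (top_of_set {0..1}) T" unfolding T_def by (rule openin_open_Int)
    moreover have "t \<in> T" using t e by (auto simp: T_def)
    moreover have "\<gamma> x \<in> polydisc r (\<gamma> t) e" if "x \<in> T" for x
      using that \<gamma>C[of x] by (auto simp: polydisc_iff T_def)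
    then have "\<forall>x\<in>T. \<forall>y\<in>T. generically_equal r F G (\<gamma> x) \<longrightarrow> generically_equal r F G (\<gamma> y)"
      using generically_equal_transfer[OF holomorphic_several_subset[OF g s1] holomorphic_several_subset[OF h s1]
        holomorphic_several_nonzero_sub[OF h hn \<gamma>C e s1] Fq
        holomorphic_several_subset[OF g' s2] holomorphic_several_subset[OF h' s2]
        holomorphic_several_nonzero_sub[OF h' hn' \<gamma>C e s2] Gq] s1 s2 by blast
    ultimately show "\<exists>T. openin (top_of_set {0..1}) T \<and> t \<in> T \<and>
        (\<forall>x\<in>T. \<forall>y\<in>T. generically_equal r F G (\<gamma> x) \<longrightarrow> generically_equal r F G (\<gamma> y))" by blast
  qed auto
  then show ?thesis by (simp add: \<gamma>01)
qed

lemma generically_equal_iter_eventually: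
  assumes "generically_equal r F G (\<lambda>i\<in>{1..r}. a i)" "distinct is" "set is = {1..r}" "s \<in> Cspace r"
  shows "iter_eventually is a (\<lambda>s. F s = G s) s"
proof -
  have eq: "polydisc r (\<lambda>i\<in>{1..r}. a i) e = polydisc r a e" for e by (auto simp: polydisc_iff)
  obtain e H where "e > 0" "holomorphic_several r H (polydisc r a e)" "\<exists>z\<in>polydisc r a e. H z \<noteq> 0"
    and FG: "\<And>z. z \<in> polydisc r a e \<Longrightarrow> H z \<noteq> 0 \<Longrightarrow> F z = G z"
    using assms(1) unfolding generically_equal_def eq by blast
  from iter_eventually_nonzero_full[OF this(2,1) assms(2-4) this(3)] FG
  show ?thesis by (auto elim: iter_eventually_mono)
qed

section \<open>Meromorphic continuation\<close>

text \<open>The value at \<open>n = 0\<close> of the last tail (\<open>\<delta> = 0\<close>), or its value at \<open>n = 1\<close> (\<open>\<delta> = 1\<close>).\<close>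

definition mz_val :: "complex \<Rightarrow> complex list \<Rightarrow> complex" where
  "mz_val \<delta> ss = (1 - \<delta>) * mz_tail \<delta> (tl ss) 1 + mz_tail \<delta> ss 1"

text \<open>The factor \<open>pole_prod\<close> brings the first summand, which only has the
  denominator of \<open>tl ss\<close>, to the common denominator \<open>mz_den K ss\<close>.\<close>

definition cleared_val :: "complex \<Rightarrow> nat \<Rightarrow> complex list \<Rightarrow> complex" where
  "cleared_val \<delta> K ss = (1 - \<delta>) * pole_prod K (hd ss) (tl ss) * cleared_tail \<delta> K (tl ss) 1 + cleared_tail \<delta> K ss 1"

lemma mz_val_eq:
  assumes "B \<ge> 0" "real K \<ge> real r * (B + 1) + 2" "ss \<in> bounded_lists r B" "mz_den K ss \<noteq> 0" "ss \<noteq> []"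
  shows "mz_val \<delta> ss = cleared_val \<delta> K ss / mz_den K ss"
proof -
  obtain x ys r' where ss: "ss = x # ys" and r: "r = Suc r'"
    using assms(3,5) by (cases ss) (auto simp: bounded_lists_def)
  have ys: "ys \<in> bounded_lists r' B" using assms(3) by (simp add: ss r bounded_lists_Cons)
  have K: "real K \<ge> real r' * (B + 1) + 2" using assms(1,2) by (simp add: r algebra_simps)
  have "cleared_tail \<delta> K ss 1 = mz_den K ss * mz_tail \<delta> ss 1" using mz_den_eq[OF assms(1-4)] by blast
  moreover have "cleared_tail \<delta> K ys 1 = mz_den K ys * mz_tail \<delta> ys 1"
    using mz_den_eq[OF assms(1) K ys] assms(4) by (simp add: ss)
  ultimately show ?thesis using assms(4)
    by (simp add: mz_val_def cleared_val_def ss field_simps)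
qed

text \<open>No denominator vanishes, which suffices for continuity of \<open>mz_val\<close>. The
  last entry only has to differ from 1, so nonpositive integers are allowed there.\<close>

primrec regular_list :: "complex list \<Rightarrow> bool" where
  "regular_list [] \<longleftrightarrow> True"
| "regular_list (x # ys) \<longleftrightarrow>
     (if ys = [] then x \<noteq> 1 else \<forall>t::nat. x + mz_exp ys + of_nat t - 1 \<noteq> 0) \<and> regular_list ys"

text \<open>Stronger than \<open>regular_list\<close>, but stable under integer shifts of the first
  entry and under putting a nonpositive integer in front of a nonempty list.\<close>

primrec generic_list :: "complex list \<Rightarrow> bool" where
  "generic_list [] \<longleftrightarrow> True"
| "generic_list (x # ys) \<longleftrightarrow> x + sum_list ys \<notin> \<int> \<and> generic_list ys"

lemma mz_exp_sum_list: "mz_exp ss = sum_list ss - of_nat (length ss)"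
  by (induction ss) auto

lemma generic_imp_regular_Cons:
  assumes "x + sum_list ys \<notin> \<int>"
  shows "x + mz_exp ys + of_nat t - 1 \<noteq> 0"
proof
  assume "x + mz_exp ys + of_nat t - 1 = 0"
  then have "x + sum_list ys = of_nat (length ys) + 1 - of_nat t"
    by (simp add: mz_exp_sum_list algebra_simps)
  moreover have "of_nat (length ys) + 1 - of_nat t \<in> (\<int> :: complex set)" by (intro Ints_add Ints_diff) auto
  ultimately show False using assms by simp
qed

lemma generic_imp_regular: "generic_list ss \<Longrightarrow> regular_list ss"
proof (induction ss)
  case (Cons x ys)
  then show ?case using generic_imp_regular_Cons[of x ys] generic_imp_regular_Cons[of x ys 0] by auto
qed auto

lemma regular_imp_mz_den: "regular_list ss \<Longrightarrow> mz_den K ss \<noteq> 0"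
proof (induction ss)
  case (Cons x ys)
  then have "pole_prod K x ys \<noteq> 0"
    by (cases "ys = []") (auto simp: pole_prod_def pole_count_def)
  then show ?case using Cons by auto
qed auto

lemma iter_eventually_append:
  "iter_eventually (is @ js) a P s \<longleftrightarrow> iter_eventually is a (iter_eventually js a P) s"
  by (induction "is" arbitrary: s) auto

lemma eventually_add_notin_Ints: "\<forall>\<^sub>F z in at (a::complex). z + c \<notin> \<int>"
proof -
  \<comment> \<open>The integers other than \<open>a + c\<close> form a closed set that misses the
    limit \<open>a + c\<close>; the point \<open>z = a\<close> itself is removed by the punctured
    neighbourhood.\<close>
  define A where "A = {m::int. of_int m \<noteq> a + c}"
  have lim: "((\<lambda>z. z + c) \<longlongrightarrow> a + c) (at a)" by (intro tendsto_intros)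
  have "closed (of_int ` A :: complex set)" by (rule closed_of_int_image)
  then have "open (- (of_int ` A) :: complex set)" by (rule open_Compl)
  with lim have "\<forall>\<^sub>F z in at a. z + c \<in> - (of_int ` A)"
    by (rule topological_tendstoD) (auto simp: A_def)
  moreover have "\<forall>\<^sub>F z in at a. z \<noteq> a" by (simp add: eventually_at_filter)
  ultimately show ?thesis
    by eventually_elim (auto simp: A_def elim!: Ints_cases)
qed

lemma map_upt_Cons: "k \<le> r \<Longrightarrow> map z [k..<Suc r] = z k # map z [Suc k..<Suc r]"
  by (simp add: upt_conv_Cons del: upt_Suc)

lemma map_upd_upt [simp]: "k < m \<or> n \<le> k \<Longrightarrow> map (z(k := w)) [m..<n] = map z [m..<n]"
  by (auto intro!: map_cong)

text \<open>Fits the reverse order of limits: the later variables are the outer ones, and each new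
  variable only has to avoid a translate of the integers determined by them.\<close>

lemma iter_eventually_generic:
  assumes "k \<le> Suc r"
  shows "iter_eventually (rev [k..<Suc r]) a (\<lambda>s. generic_list (map s [k..<Suc r])) s"
  using assms
proof (induction k rule: inc_induct)
  case base
  then show ?case by simp
next
  case (step k)
  have "rev [k..<Suc r] = rev [Suc k..<Suc r] @ [k]"
    using step by (simp add: upt_conv_Cons del: upt_Suc)
  moreover have "iter_eventually (rev [Suc k..<Suc r]) a (iter_eventually [k] a (\<lambda>s. generic_list (map s [k..<Suc r]))) s"
  proof (rule iter_eventually_mono[OF step.IH])
    fix s assume s: "generic_list (map s [Suc k..<Suc r])"
    have "\<forall>\<^sub>F z in at (a k). z + sum_list (map s [Suc k..<Suc r]) \<notin> \<int>" by (rule eventually_add_notin_Ints)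
    then have "\<forall>\<^sub>F z in at (a k). generic_list (map (s(k := z)) [k..<Suc r])"
    proof (rule eventually_mono)
      fix z assume "z + sum_list (map s [Suc k..<Suc r]) \<notin> \<int>"
      then show "generic_list (map (s(k := z)) [k..<Suc r])"
        using s step(2) map_upt_Cons[of k r "s(k := z)"] by (simp del: upt_Suc)
    qed
    then show "iter_eventually [k] a (\<lambda>s. generic_list (map s [k..<Suc r])) s" by simp
  qed
  ultimately show ?case by (simp add: iter_eventually_append del: upt_Suc)
qed

section \<open>Holomorphy of the cleared quantities\<close>

lemma holomorphic_several_npow:
  assumes "n \<ge> 1" "holomorphic_several r f U"
  shows "holomorphic_several r (\<lambda>z. npow n (f z)) U"
  unfolding npow_eq_exp[OF assms(1)]
  by (rule holomorphic_several_compose[OF assms(2), of "\<lambda>w. exp (- w * of_real (ln (real n)))"])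
    (intro holomorphic_intros)

lemma holomorphic_several_em_coeff:
  assumes "\<And>q. q < K \<Longrightarrow> holomorphic_several r (\<lambda>z. c z q) V" "\<And>q. q < K \<Longrightarrow> holomorphic_several r (\<lambda>z. u z q) V"
    "holomorphic_several r d V" "holomorphic_several r a V" "t < K"
  shows "holomorphic_several r (\<lambda>z. em_coeff (u z) (d z) (a z) (c z) t) V"
proof -
  have "holomorphic_several r (\<lambda>z. em_kernel (u z) (d z) (a z) q i) V" if "q < K" for q i
    unfolding em_kernel_def pochhammer_prod using assms(2)[OF that] assms(3,4)
    by (cases "i = 0") (auto intro!: holomorphic_several_intros)
  then show ?thesis unfolding em_coeff_def using assms(1,5) by (intro holomorphic_several_intros) auto
qed

text \<open>Only the remainder series is not a finite expression in the variables. As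
  \<open>B\<close> bounds the whole polydisc, \<open>uniform_step\<close> majorises it at all points
  at once.\<close>

lemma cleared_holomorphic:
  assumes B: "B \<ge> 0" "\<forall>z\<in>polydisc r p e. \<forall>i\<in>{1..r}. norm (z i) \<le> B"
    and K: "real K \<ge> real r * (B + 1) + 2" and k: "1 \<le> k" "k \<le> Suc r"
  shows "holomorphic_several r (\<lambda>z. mz_exp (map z [k..<Suc r])) (polydisc r p e) \<and>
     holomorphic_several r (\<lambda>z. mz_den K (map z [k..<Suc r])) (polydisc r p e) \<and>
     (\<forall>t<K. holomorphic_several r (\<lambda>z. cleared_coeff \<delta> K (map z [k..<Suc r]) t) (polydisc r p e)) \<and>
     (\<forall>n\<ge>1. holomorphic_several r (\<lambda>z. cleared_tail \<delta> K (map z [k..<Suc r]) n) (polydisc r p e)) \<and>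
     (k \<le> r \<longrightarrow> holomorphic_several r (\<lambda>z. pole_prod K (z k) (map z [Suc k..<Suc r])) (polydisc r p e))"
  using k(2)
proof (induction k rule: inc_induct)
  case base
  then show ?case by (simp add: holomorphic_several_const)
next
  case (step n)
  let ?V = "polydisc r p e" and ?l = "\<lambda>z. map z [Suc n..<Suc r]"
  define a where "a z = z n + mz_exp (?l z)" for z
  define d where "d z = pole_prod K (z n) (?l z)" for z
  define u where "u z = pole_quot K (z n) (?l z)" for z
  define c where "c z = cleared_coeff \<delta> K (?l z)" for z
  define f where "f z m = npow m (z n) * cleared_tail \<delta> K (?l z) m" for z m
  have n: "n \<ge> 1" "n \<le> r" using step k by auto
  have map_n: "map z [n..<Suc r] = z n # ?l z" for z :: "nat \<Rightarrow> complex" by (rule map_upt_Cons[OF n(2)])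
  have a: "holomorphic_several r a ?V"
    unfolding a_def using step.IH by (intro holomorphic_several_intros) auto
  define cnt where "cnt = (if n = r then 1 else K)"
  have cnt: "pole_count K (?l z) = cnt" for z :: "nat \<Rightarrow> complex" using n by (auto simp: pole_count_def cnt_def)
  have d: "holomorphic_several r d ?V"
    unfolding d_def pole_prod_def cnt a_def[symmetric] by (intro holomorphic_several_intros a)
  have u: "holomorphic_several r (\<lambda>z. u z q) ?V" for q
    unfolding u_def pole_quot_def cnt a_def[symmetric]
    by (cases "q < cnt") (auto intro!: holomorphic_several_intros a)
  have c: "holomorphic_several r (\<lambda>z. c z q) ?V" if "q < K" for q
    unfolding c_def using step.IH that by blast
  have f: "holomorphic_several r (\<lambda>z. f z m) ?V" if "m \<ge> 1" for m
    unfolding f_def using step.IH that by (intro holomorphic_several_intros holomorphic_several_npow) auto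
  have ec: "holomorphic_several r (\<lambda>z. em_coeff (u z) (d z) (a z) (c z) t) ?V" if "t < K" for t
    by (rule holomorphic_several_em_coeff[OF c u d a that])
  have rem: "holomorphic_several r (\<lambda>z. em_rem K (u z) (d z) (a z) (c z) (f z) m) ?V" if "m \<ge> 2" for m
    unfolding em_rem_def using that
    by (intro holomorphic_several_intros holomorphic_several_npow ec d f a) auto
  have bl: "map z [j..<Suc r] \<in> bounded_lists (Suc r - j) B" if "z \<in> ?V" "1 \<le> j" for z j
    using bspec[OF B(2) that(1)] that(2) by (auto simp: bounded_lists_def)
  define r' where "r' = r - n"
  have r': "Suc r - n = Suc r'" "Suc r' \<le> r" using n by (auto simp: r'_def)
  have "real (Suc r') * (B + 1) \<le> real r * (B + 1)" using r' B(1) by (intro mult_right_mono) auto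
  then have K1: "real K \<ge> real (Suc r') * (B + 1) + 2" using K by linarith
  then have K2: "real K \<ge> real r' * (B + 1) + 2" using B(1) by (simp add: algebra_simps)
  have "0 \<le> real r' * (B + 1)" using B by (intro mult_nonneg_nonneg) auto
  then have K3: "K \<ge> 1" using K2 by linarith
  obtain C where U: "uniform_expansion \<delta> K B r' C"
    using uniform_expansion_exists[OF B(1) K2] by blast
  from uniform_step[OF U K3] obtain C' where C': "C' \<ge> 0" and
    "\<And>x ys. x # ys \<in> bounded_lists (Suc r') B \<Longrightarrow> norm (pole_prod K x ys) \<le> C'" and
    "\<And>x ys t. x # ys \<in> bounded_lists (Suc r') B \<Longrightarrow> t < K \<Longrightarrow>
       norm (em_coeff (pole_quot K x ys) (pole_prod K x ys) (x + mz_exp ys) (cleared_coeff \<delta> K ys) t) \<le> C'" and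
    re': "\<And>x ys m. x # ys \<in> bounded_lists (Suc r') B \<Longrightarrow> m \<ge> 2 \<Longrightarrow>
       norm (em_rem K (pole_quot K x ys) (pole_prod K x ys) (x + mz_exp ys) (cleared_coeff \<delta> K ys)
              (\<lambda>m. npow m x * cleared_tail \<delta> K ys m) m) \<le> C' * real m powr (- Re (x + mz_exp ys) - real K)"
    by blast
  \<comment> \<open>\<open>K\<close> is so large that the exponent is at most -2 on the whole
    polydisc; this is the majorant for the Weierstrass test.\<close>
  have re: "norm (em_rem K (u z) (d z) (a z) (c z) (f z) m) \<le> C' * real m powr (- 2)"
    if z: "z \<in> ?V" and m: "m \<ge> 2" for z m
  proof -
    have xy: "z n # ?l z \<in> bounded_lists (Suc r') B"
      using bl[OF z n(1)] by (simp only: map_n r'(1))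
    have "norm (em_rem K (u z) (d z) (a z) (c z) (f z) m) \<le> C' * real m powr (- Re (a z) - real K)"
      using re'[OF xy m] unfolding u_def d_def a_def c_def f_def by simp
    also have "\<dots> \<le> C' * real m powr (- 2)"
      using Re_arg_ge[OF xy K1] m C' by (intro mult_left_mono powr_mono) (auto simp: a_def)
    finally show ?thesis .
  qed
  have tail: "holomorphic_several r (\<lambda>z. em_tail K (u z) (d z) (a z) (c z) (f z) m) ?V" if m: "m \<ge> 1" for m
  proof -
    have "uniform_limit ?V (\<lambda>N z. \<Sum>j<N. em_rem K (u z) (d z) (a z) (c z) (f z) (m + 1 + j))
        (\<lambda>z. \<Sum>j. em_rem K (u z) (d z) (a z) (c z) (f z) (m + 1 + j)) sequentially"
      by (rule Weierstrass_m_test[OF re])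
        (use m powr_tail_sum(1)[of 2 m] in \<open>auto intro!: summable_mult\<close>)
    moreover have "holomorphic_several r (\<lambda>z. \<Sum>j<N. em_rem K (u z) (d z) (a z) (c z) (f z) (m + 1 + j)) ?V" for N
      using m by (intro holomorphic_several_intros rem) auto
    ultimately have "holomorphic_several r (\<lambda>z. \<Sum>j. em_rem K (u z) (d z) (a z) (c z) (f z) (m + 1 + j)) ?V"
      by (rule holomorphic_several_uniform_limit[rotated])
    then show ?thesis unfolding em_tail_def using m
      by (intro holomorphic_several_intros holomorphic_several_npow ec a) auto
  qed
  have "holomorphic_several r (\<lambda>z. mz_exp (map z [n..<Suc r])) ?V"
    unfolding map_n mz_exp.simps a_def[symmetric] by (intro holomorphic_several_intros a)
  moreover have "holomorphic_several r (\<lambda>z. mz_den K (map z [n..<Suc r])) ?V"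
    unfolding map_n mz_den.simps d_def[symmetric] using step.IH by (intro holomorphic_several_intros d) auto
  moreover have "holomorphic_several r (\<lambda>z. cleared_coeff \<delta> K (map z [n..<Suc r]) t) ?V" if "t < K" for t
    unfolding map_n cleared_coeff.simps d_def[symmetric] a_def[symmetric] u_def[symmetric] c_def[symmetric]
    using that c[of "t - 1"] by (cases "t = 0") (auto intro!: holomorphic_several_intros ec d)
  moreover have "holomorphic_several r (\<lambda>z. cleared_tail \<delta> K (map z [n..<Suc r]) m) ?V" if "m \<ge> 1" for m
    unfolding map_n cleared_tail.simps d_def[symmetric] a_def[symmetric] u_def[symmetric] c_def[symmetric] f_def[symmetric]
    using that by (intro holomorphic_several_intros tail d f) auto
  ultimately show ?case using d unfolding d_def by blast
qed

lemma cleared_quotient: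
  assumes p: "p \<in> Cspace r" and r: "r \<ge> 1"
  obtains K where "holomorphic_several r (\<lambda>z. cleared_val \<delta> K (map z [1..<Suc r])) (polydisc r p 1)"
    "holomorphic_several r (\<lambda>z. mz_den K (map z [1..<Suc r])) (polydisc r p 1)"
    "\<And>z. z \<in> polydisc r p 1 \<Longrightarrow> mz_den K (map z [1..<Suc r]) \<noteq> 0 \<Longrightarrow>
       mz_val \<delta> (map z [1..<Suc r]) = cleared_val \<delta> K (map z [1..<Suc r]) / mz_den K (map z [1..<Suc r])"
proof -
  define B where "B = (\<Sum>i=1..r. norm (p i)) + 1"
  have B0: "B \<ge> 0" unfolding B_def by (intro add_nonneg_nonneg sum_nonneg) auto
  have B: "norm (z i) \<le> B" if "z \<in> polydisc r p 1" "i \<in> {1..r}" for z i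
  proof -
    have "norm (p i) \<le> (\<Sum>i=1..r. norm (p i))" using that by (intro member_le_sum) auto
    moreover have "norm (z i - p i) < 1" using that by (auto simp: polydisc_iff dist_norm norm_minus_commute)
    ultimately show ?thesis using norm_triangle_sub[of "z i" "p i"] unfolding B_def by linarith
  qed
  then have Ball: "\<forall>z\<in>polydisc r p 1. \<forall>i\<in>{1..r}. norm (z i) \<le> B" by blast
  obtain K :: nat where K: "real K \<ge> real r * (B + 1) + 2" using real_arch_simple by blast
  note hol = cleared_holomorphic[where r = r and p = p and e = 1 and B = B and k = 1, OF B0 Ball K]
  show ?thesis
  proof (rule that)
    have l: "map z [1..<Suc r] = z 1 # map z [Suc 1..<Suc r]" for z :: "nat \<Rightarrow> complex"
      by (rule map_upt_Cons[OF r])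
    have "holomorphic_several r (\<lambda>z. cleared_tail \<delta> K (map z [Suc 1..<Suc r]) 1) (polydisc r p 1)"
      using cleared_holomorphic[where r = r and p = p and e = 1 and B = B and k = "Suc 1" and \<delta> = \<delta>, OF B0 Ball K] r by auto
    moreover have "holomorphic_several r (\<lambda>z. cleared_tail \<delta> K (map z [1..<Suc r]) 1) (polydisc r p 1)"
      using hol[of \<delta>] r by auto
    moreover have "holomorphic_several r (\<lambda>z. pole_prod K (z 1) (map z [Suc 1..<Suc r])) (polydisc r p 1)"
      using hol[of \<delta>] r by auto
    ultimately show "holomorphic_several r (\<lambda>z. cleared_val \<delta> K (map z [1..<Suc r])) (polydisc r p 1)"
      unfolding cleared_val_def l list.sel by (intro holomorphic_several_intros)
    show "holomorphic_several r (\<lambda>z. mz_den K (map z [1..<Suc r])) (polydisc r p 1)"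
      using hol r by auto
    fix z assume z: "z \<in> polydisc r p 1" and den: "mz_den K (map z [1..<Suc r]) \<noteq> 0"
    have "map z [1..<Suc r] \<in> bounded_lists r B" using B[OF z] by (auto simp: bounded_lists_def)
    then show "mz_val \<delta> (map z [1..<Suc r]) = cleared_val \<delta> K (map z [1..<Suc r]) / mz_den K (map z [1..<Suc r])"
      using r by (intro mz_val_eq[OF B0 K _ den]) auto
  qed
qed

lemma meromorphic_mz_val:
  assumes r: "r \<ge> 1"
  shows "meromorphic_several r (\<lambda>z. mz_val \<delta> (map z [1..<Suc r]))"
  unfolding meromorphic_several_def
proof
  fix p :: "nat \<Rightarrow> complex" assume p: "p \<in> Cspace r"
  obtain K where K: "holomorphic_several r (\<lambda>z. cleared_val \<delta> K (map z [1..<Suc r])) (polydisc r p 1)"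
    "holomorphic_several r (\<lambda>z. mz_den K (map z [1..<Suc r])) (polydisc r p 1)"
    "\<And>z. z \<in> polydisc r p 1 \<Longrightarrow> mz_den K (map z [1..<Suc r]) \<noteq> 0 \<Longrightarrow>
       mz_val \<delta> (map z [1..<Suc r]) = cleared_val \<delta> K (map z [1..<Suc r]) / mz_den K (map z [1..<Suc r])"
    by (rule cleared_quotient[where \<delta> = \<delta>, OF p r]) (rule that)
  \<comment> \<open>With the constant 1 in the role of \<open>H\<close>,
    \<open>iter_eventually_nonzero_full\<close> just keeps the point inside the polydisc, while
    \<open>generic_list\<close> keeps the denominator away from 0.\<close>
  have pp: "\<exists>w\<in>polydisc r p 1. (1::complex) \<noteq> 0" using p by (intro bexI[of _ p]) (auto simp: polydisc_iff)
  have "iter_eventually (rev [1..<Suc r]) p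
      (\<lambda>s. (s \<in> polydisc r p 1 \<and> (1::complex) \<noteq> 0) \<and> generic_list (map s [1..<Suc r])) p"
    by (intro iter_eventually_conj iter_eventually_nonzero_full iter_eventually_generic
        holomorphic_several_const p pp) auto
  from iter_eventually_ex[OF this] have "\<exists>z\<in>polydisc r p 1. mz_den K (map z [1..<Suc r]) \<noteq> 0"
    using generic_imp_regular regular_imp_mz_den by blast
  with K show "\<exists>e>0. \<exists>g h. holomorphic_several r g (polydisc r p e) \<and> holomorphic_several r h (polydisc r p e) \<and>
        (\<exists>z\<in>polydisc r p e. h z \<noteq> 0) \<and>
        (\<forall>z\<in>polydisc r p e. h z \<noteq> 0 \<longrightarrow> mz_val \<delta> (map z [1..<Suc r]) = g z / h z)"
    by (intro exI[of _ "1::real"] conjI exI[of _ "\<lambda>z. cleared_val \<delta> K (map z [1..<Suc r])"]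
        exI[of _ "\<lambda>z. mz_den K (map z [1..<Suc r])"]) auto
qed

text \<open>At a regular list the denominator is nonzero, so the local quotient is continuous in the
  chosen variable.\<close>

lemma mz_val_tendsto:
  assumes "regular_list (xs @ y # ys)"
  shows "((\<lambda>z. mz_val \<delta> (xs @ z # ys)) \<longlongrightarrow> mz_val \<delta> (xs @ y # ys)) (at y)"
proof -
  define r where "r = length (xs @ y # ys)"
  define i where "i = Suc (length xs)"
  define s where "s = (\<lambda>j\<in>{1..r}. (xs @ y # ys) ! (j - 1))"
  have r: "r \<ge> 1" and s: "s \<in> Cspace r" and i: "i \<in> {1..r}" by (auto simp: r_def s_def i_def)
  have l: "map (s(i := z)) [1..<Suc r] = xs @ z # ys" for z
  proof (rule nth_equalityI)
    show "length (map (s(i := z)) [1..<Suc r]) = length (xs @ z # ys)"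
      by (simp add: r_def del: upt_Suc)
    fix j assume "j < length (map (s(i := z)) [1..<Suc r])"
    then have j: "j < r" by (simp del: upt_Suc)
    show "map (s(i := z)) [1..<Suc r] ! j = (xs @ z # ys) ! j"
      using j by (auto simp: s_def i_def r_def nth_append nth_Cons' simp del: upt_Suc)
  qed
  have sl: "s(i := y) = s" using i by (auto simp: s_def i_def fun_eq_iff)
  obtain K where K: "holomorphic_several r (\<lambda>z. cleared_val \<delta> K (map z [1..<Suc r])) (polydisc r s 1)"
    "holomorphic_several r (\<lambda>z. mz_den K (map z [1..<Suc r])) (polydisc r s 1)"
    "\<And>z. z \<in> polydisc r s 1 \<Longrightarrow> mz_den K (map z [1..<Suc r]) \<noteq> 0 \<Longrightarrow>
       mz_val \<delta> (map z [1..<Suc r]) = cleared_val \<delta> K (map z [1..<Suc r]) / mz_den K (map z [1..<Suc r])"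
    by (rule cleared_quotient[where \<delta> = \<delta>, OF s r]) (rule that)
  have ss: "s \<in> polydisc r s 1" using s by (auto simp: polydisc_iff)
  have si: "s i = y" using sl by (metis fun_upd_same)
  have isC: "isCont f y" if "f holomorphic_on ball y 1" for f :: "complex \<Rightarrow> complex"
    using holomorphic_on_imp_continuous_on[OF that] by (simp add: continuous_on_eq_continuous_at)
  have g: "isCont (\<lambda>z. cleared_val \<delta> K (xs @ z # ys)) y"
    using holomorphic_several_slice[OF K(1) ss i] unfolding l si by (rule isC)
  have h: "isCont (\<lambda>z. mz_den K (xs @ z # ys)) y"
    using holomorphic_several_slice[OF K(2) ss i] unfolding l si by (rule isC)
  have h0: "mz_den K (xs @ y # ys) \<noteq> 0" by (rule regular_imp_mz_den[OF assms])
  have q: "mz_val \<delta> (xs @ z # ys) = cleared_val \<delta> K (xs @ z # ys) / mz_den K (xs @ z # ys)"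
    if "z \<in> ball y 1" "mz_den K (xs @ z # ys) \<noteq> 0" for z
    using K(3)[of "s(i := z)"] that polydisc_upd[OF ss i, of z] unfolding l si by blast
  have "\<forall>\<^sub>F z in at y. z \<in> ball y 1" by (rule eventually_at_in_open') auto
  moreover have "\<forall>\<^sub>F z in at y. mz_den K (xs @ z # ys) \<noteq> 0"
    using h h0 by (intro tendsto_imp_eventually_ne) (auto simp: isCont_def)
  ultimately have "\<forall>\<^sub>F z in at y. cleared_val \<delta> K (xs @ z # ys) / mz_den K (xs @ z # ys) = mz_val \<delta> (xs @ z # ys)"
    by eventually_elim (simp add: q)
  moreover have "((\<lambda>z. cleared_val \<delta> K (xs @ z # ys) / mz_den K (xs @ z # ys)) \<longlongrightarrow>
      cleared_val \<delta> K (xs @ y # ys) / mz_den K (xs @ y # ys)) (at y)"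
    using g h h0 by (intro tendsto_divide) (auto simp: isCont_def)
  moreover have "mz_val \<delta> (xs @ y # ys) = cleared_val \<delta> K (xs @ y # ys) / mz_den K (xs @ y # ys)"
    by (rule q[OF _ h0]) simp
  ultimately show ?thesis by (simp only:) (rule Lim_transform_eventually)
qed

section \<open>Setting the last variable to a nonpositive integer\<close>

declare mz_tail.simps(2) [simp del] mz_coeff.simps(2) [simp del]

lemma bounded_lists_exists:
  obtains B where "B \<ge> 0" "ss \<in> bounded_lists (length ss) B"
proof -
  have "norm x \<le> (\<Sum>y\<in>set ss. norm y)" if "x \<in> set ss" for x
    using that by (intro member_le_sum) auto
  then show ?thesis by (intro that[of "\<Sum>y\<in>set ss. norm y"]) (auto simp: bounded_lists_def intro: sum_nonneg)
qed

lemma mz_tail_is_tail: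
  assumes "regular_list (x # ys)"
  shows "is_tail (x + mz_exp ys - 1) (plain_coeff (x + mz_exp ys) (mz_coeff \<delta> ys))
    (\<lambda>m. npow m x * mz_tail \<delta> ys m) (\<lambda>n. mz_tail \<delta> (x # ys) n - \<delta> * (npow n x * mz_tail \<delta> ys n))"
proof -
  obtain B where B: "B \<ge> 0" "x # ys \<in> bounded_lists (length (x # ys)) B" by (rule bounded_lists_exists)
  obtain K :: nat where K: "real K \<ge> real (length (x # ys)) * (B + 1) + 2" using real_arch_simple by blast
  have "\<exists>g. is_tail (mz_exp (x # ys)) (plain_coeff (mz_exp (x # ys) + 1) (mz_coeff \<delta> (tl (x # ys))))
       (\<lambda>m. npow m (hd (x # ys)) * mz_tail \<delta> (tl (x # ys)) m) g"
    using mz_den_eq[OF B(1) K B(2) regular_imp_mz_den[OF assms], of \<delta>] by blast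
  then obtain g where g: "is_tail (x + mz_exp ys - 1) (plain_coeff (x + mz_exp ys) (mz_coeff \<delta> ys))
    (\<lambda>m. npow m x * mz_tail \<delta> ys m) g" by auto
  show ?thesis by (rule is_tail_cong[OF g]) (simp_all only: mz_tail_Cons[OF g] add_diff_cancel_right')
qed

text \<open>\<open>L\<close> allows as many terms to be demanded as are needed for the error to tend
  to 0.\<close>

lemma mz_tail_expansion:
  assumes "regular_list ss"
  obtains K C where "K \<ge> L" "\<And>n. n \<ge> 1 \<Longrightarrow>
    norm (mz_tail \<delta> ss n - (\<Sum>t<K. mz_coeff \<delta> ss t * npow n (mz_exp ss + of_nat t))) \<le> C * real n powr (- Re (mz_exp ss) - real K)"
proof -
  obtain B where B: "B \<ge> 0" "ss \<in> bounded_lists (length ss) B" by (rule bounded_lists_exists)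
  obtain K0 :: nat where K0: "real K0 \<ge> real (length ss) * (B + 1) + 2" using real_arch_simple by blast
  define K where "K = max K0 L"
  have K: "real K \<ge> real (length ss) * (B + 1) + 2" "K \<ge> L" using K0 by (auto simp: K_def)
  obtain C where C: "uniform_expansion \<delta> K B (length ss) C" using uniform_expansion_exists[OF B(1) K(1)] by blast
  let ?D = "mz_den K ss"
  have D: "?D \<noteq> 0" by (rule regular_imp_mz_den[OF assms])
  have eq: "\<forall>t<K. cleared_coeff \<delta> K ss t = ?D * mz_coeff \<delta> ss t" "\<forall>n\<ge>1. cleared_tail \<delta> K ss n = ?D * mz_tail \<delta> ss n"
    using mz_den_eq[OF B(1) K(1) B(2) D, of \<delta>] by blast+
  have "norm (mz_tail \<delta> ss n - (\<Sum>t<K. mz_coeff \<delta> ss t * npow n (mz_exp ss + of_nat t))) \<le> C / norm ?D * real n powr (- Re (mz_exp ss) - real K)"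
    if n: "n \<ge> 1" for n
  proof -
    have "cleared_tail \<delta> K ss n - (\<Sum>t<K. cleared_coeff \<delta> K ss t * npow n (mz_exp ss + of_nat t))
      = ?D * (mz_tail \<delta> ss n - (\<Sum>t<K. mz_coeff \<delta> ss t * npow n (mz_exp ss + of_nat t)))"
      using eq n by (simp add: right_diff_distrib sum_distrib_left mult.assoc)
    moreover have "norm (cleared_tail \<delta> K ss n - (\<Sum>t<K. cleared_coeff \<delta> K ss t * npow n (mz_exp ss + of_nat t)))
        \<le> C * real n powr (- Re (mz_exp ss) - real K)"
      using C B(2) n unfolding uniform_expansion_def by blast
    ultimately have "norm ?D * norm (mz_tail \<delta> ss n - (\<Sum>t<K. mz_coeff \<delta> ss t * npow n (mz_exp ss + of_nat t)))
        \<le> C * real n powr (- Re (mz_exp ss) - real K)" by (simp only: norm_mult)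
    then have "norm (mz_tail \<delta> ss n - (\<Sum>t<K. mz_coeff \<delta> ss t * npow n (mz_exp ss + of_nat t)))
        \<le> C * real n powr (- Re (mz_exp ss) - real K) / norm ?D"
      using D by (subst pos_le_divide_eq) (simp_all only: zero_less_norm_iff not_False_eq_True mult.commute)
    then show ?thesis by (simp only: times_divide_eq_left)
  qed
  then show ?thesis by (rule that[OF K(2)])
qed

text \<open>The coefficient of \<open>n^(1-\<alpha>-i)\<close> in the expansion of the sum of
  \<open>m^(-\<alpha>)\<close> over \<open>m > n\<close>: the kernel for \<open>d = 1\<close> with
  its quotient written out.\<close>

definition em_gamma :: "nat \<Rightarrow> complex \<Rightarrow> complex" where
  "em_gamma i \<alpha> = (if i = 0 then 1 / (\<alpha> - 1) else bern_coeff i * pochhammer \<alpha> (i - 1))"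

lemma plain_coeff_eq: "plain_coeff a c t = (\<Sum>q\<le>t. c q * em_gamma (t - q) (a + of_nat q))"
  unfolding em_coeff_def em_kernel_def em_gamma_def by (intro sum.cong) auto

lemma plain_coeff_delta: "plain_coeff a (\<lambda>t. if t = 0 then 1 else 0) t = em_gamma t a"
proof -
  have "plain_coeff a (\<lambda>t. if t = 0 then 1 else 0) t = (\<Sum>q\<le>t. if q = 0 then em_gamma t a else 0)"
    unfolding plain_coeff_eq by (intro sum.cong) auto
  then show ?thesis by simp
qed

lemma plain_coeff_shift:
  "plain_coeff a (\<lambda>t. if t < e then 0 else c (t - e)) t = (if t < e then 0 else plain_coeff (a + of_nat e) c (t - e))"
proof (cases "t < e")
  case True
  then show ?thesis unfolding plain_coeff_eq by (auto intro!: sum.neutral)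
next
  case False
  have "plain_coeff a (\<lambda>t. if t < e then 0 else c (t - e)) t = (\<Sum>q\<in>{e..t}. c (q - e) * em_gamma (t - q) (a + of_nat q))"
    unfolding plain_coeff_eq by (rule sum.mono_neutral_cong_right) auto
  also have "\<dots> = (\<Sum>q\<le>t - e. c q * em_gamma (t - e - q) (a + of_nat e + of_nat q))"
    using False by (intro sum.reindex_bij_witness[of _ "\<lambda>q. q + e" "\<lambda>q. q - e"]) (auto simp: of_nat_diff)
  finally show ?thesis using False by (simp add: plain_coeff_eq)
qed

lemma plain_coeff_sum:
  "plain_coeff a (\<lambda>t. \<Sum>j\<in>J. p j * c j t) t = (\<Sum>j\<in>J. p j * plain_coeff a (c j) t)"
proof -
  have "plain_coeff a (\<lambda>t. \<Sum>j\<in>J. p j * c j t) t = (\<Sum>q\<le>t. \<Sum>j\<in>J. p j * (c j q * em_gamma (t - q) (a + of_nat q)))"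
    unfolding plain_coeff_eq by (simp add: sum_distrib_right mult.assoc)
  also have "\<dots> = (\<Sum>j\<in>J. p j * plain_coeff a (c j) t)"
    by (subst sum.swap) (simp add: plain_coeff_eq sum_distrib_left)
  finally show ?thesis .
qed

text \<open>Linearity of tails in the form needed when a polynomial replaces the inner tail: a
  factor \<open>n ^ j\<close> lowers the exponent, so the summands have different leading exponents,
  and \<open>e\<close> records their distance from the lowest.\<close>

lemma is_tail_lincomb:
  assumes "\<And>j. j \<in> J \<Longrightarrow> is_tail (a + of_nat (e j) - 1) (plain_coeff (a + of_nat (e j)) (c j)) (f j) (g j)"
  shows "is_tail (a - 1) (plain_coeff a (\<lambda>t. \<Sum>j\<in>J. p j * (if t < e j then 0 else c j (t - e j))))
     (\<lambda>n. \<Sum>j\<in>J. p j * f j n) (\<lambda>n. \<Sum>j\<in>J. p j * g j n)"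
proof -
  have "is_tail (a - 1) (plain_coeff a (\<lambda>t. if t < e j then 0 else c j (t - e j))) (f j) (g j)" if "j \<in> J" for j
    unfolding plain_coeff_shift using assms[OF that] by (intro is_tail_shift) (simp add: algebra_simps)
  moreover have "plain_coeff a (\<lambda>t. \<Sum>j\<in>J. p j * (if t < e j then 0 else c j (t - e j)))
      = (\<lambda>t. \<Sum>j\<in>J. p j * plain_coeff a (\<lambda>t. if t < e j then 0 else c j (t - e j)) t)"
    by (rule ext) (rule plain_coeff_sum)
  ultimately show ?thesis by (simp only:) (rule is_tail_sum)
qed

text \<open>\<open>\<Sum>j. faulhaber \<delta> l j * n ^ j\<close> is the regularised value of \<open>m\<^sup>l\<close> summed over \<open>m > n\<close> (for \<open>\<delta> = 0\<close>) or
  over \<open>m \<ge> n\<close> (for \<open>\<delta> = 1\<close>).\<close>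

definition faulhaber :: "complex \<Rightarrow> nat \<Rightarrow> nat \<Rightarrow> complex" where
  "faulhaber \<delta> l j = em_gamma (Suc l - j) (- of_nat l) + (if j = l then \<delta> else 0)"

lemma faulhaber_delta: "j \<le> Suc l \<Longrightarrow> faulhaber \<delta> l j = faulhaber 0 l j + (if j = l then \<delta> else 0)"
  by (simp add: faulhaber_def)

text \<open>For \<open>a = - l\<close> the Euler--Maclaurin expansion terminates, and the formal
  identity, applied to the constant sequence, becomes an identity between polynomials.\<close>

lemma faulhaber_diff:
  "(\<Sum>j\<le>Suc l. faulhaber 0 l j * ((y - 1) ^ j - y ^ j)) = y ^ l"
proof -
  have bin: "(y - 1) ^ N - y ^ N = (\<Sum>i<N. binom_coeff (i + 1) (- of_nat N) * y ^ (N - 1 - i))" for N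
  proof -
    have b: "binom_coeff k (- of_nat N) = (-1) ^ k * of_nat (N choose k)" for k
      by (simp add: binom_coeff_def binomial_gbinomial gbinomial_pochhammer flip: power_add mult.assoc)
    have "(y - 1) ^ N = (\<Sum>k\<le>N. of_nat (N choose k) * (-1) ^ k * y ^ (N - k))"
      using binomial_ring[of "-1" y N] by simp
    also have "\<dots> = (\<Sum>k<Suc N. binom_coeff k (- of_nat N) * y ^ (N - k))"
      by (simp add: b mult_ac lessThan_Suc_atMost)
    also have "\<dots> = y ^ N + (\<Sum>i<N. binom_coeff (i + 1) (- of_nat N) * y ^ (N - 1 - i))"
      by (subst sum.lessThan_Suc_shift) (simp add: binom_coeff_def)
    finally show ?thesis by simp
  qed
  have "(\<Sum>j\<le>Suc l. faulhaber 0 l j * ((y - 1) ^ j - y ^ j))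
      = (\<Sum>t\<le>Suc l. em_gamma t (- of_nat l) * ((y - 1) ^ (Suc l - t) - y ^ (Suc l - t)))"
    by (rule sum.reindex_bij_witness[of _ "\<lambda>t. Suc l - t" "\<lambda>t. Suc l - t"]) (auto simp: faulhaber_def)
  \<comment> \<open>The omitted index belongs to the constant term of the polynomial, whose
    difference is 0.\<close>
  also have "\<dots> = (\<Sum>t<Suc l. em_gamma t (- of_nat l) * ((y - 1) ^ (Suc l - t) - y ^ (Suc l - t)))"
    by (simp add: lessThan_Suc_atMost[symmetric])
  also have "\<dots> = (\<Sum>t<Suc l. \<Sum>i<Suc l - t. em_gamma t (- of_nat l) * (binom_coeff (i + 1) (- of_nat (Suc l - t)) * y ^ (l - t - i)))"
    unfolding bin sum_distrib_left by (intro sum.cong refl) auto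
  also have "\<dots> = (\<Sum>p<Suc l. \<Sum>t\<le>p. em_gamma t (- of_nat l) * (binom_coeff (p - t + 1) (- of_nat (Suc l - t)) * y ^ (l - t - (p - t))))"
    by (rule sum_triangle)
  also have "\<dots> = (\<Sum>p<Suc l. (\<Sum>t\<le>p. plain_coeff (- of_nat l) (\<lambda>t. if t = 0 then 1 else 0) t * binom_coeff (p - t + 1) (- of_nat l - 1 + of_nat t)) * y ^ (l - p))"
    unfolding sum_distrib_right plain_coeff_delta
    by (intro sum.cong refl) (auto simp: of_nat_diff algebra_simps)
  also have "\<dots> = (\<Sum>p<Suc l. (if p = 0 then 1 else 0) * y ^ (l - p))"
  proof (intro sum.cong refl arg_cong2[where f = times])
    fix p
    \<comment> \<open>The quotient at index 0 has this denominator. At all other indices the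
      coefficient of the constant sequence is 0, so nothing else has to be checked.\<close>
    have "- of_nat l - 1 \<noteq> (0 :: complex)"
      by (metis of_nat_Suc add_uminus_conv_diff minus_add_distrib add.commute neg_equal_0_iff_equal of_nat_eq_0_iff nat.distinct(1))
    then show "(\<Sum>t\<le>p. plain_coeff (- of_nat l) (\<lambda>t. if t = 0 then 1 else 0) t * binom_coeff (p - t + 1) (- of_nat l - 1 + of_nat t)) = (if p = 0 then 1 else 0)"
      by (subst em_coeff_binom_coeff) auto
  qed
  also have "\<dots> = (\<Sum>p<Suc l. if p = 0 then y ^ l else 0)" by (intro sum.cong) auto
  finally show ?thesis by simp
qed

lemma sum_powers_faulhaber:
  "(\<Sum>m=1..n. of_nat m ^ l) = faulhaber 0 l 0 - (\<Sum>j\<le>Suc l. faulhaber 0 l j * of_nat n ^ j)"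
proof (induction n)
  case 0
  have "(\<Sum>j\<le>Suc l. faulhaber 0 l j * of_nat 0 ^ j) = (\<Sum>j\<le>Suc l. if j = 0 then faulhaber 0 l j else 0)"
    by (intro sum.cong) auto
  then show ?case by simp
next
  case (Suc n)
  have "of_nat (Suc n) - 1 = (of_nat n :: complex)" by simp
  then have "(\<Sum>j\<le>Suc l. faulhaber 0 l j * of_nat n ^ j) - (\<Sum>j\<le>Suc l. faulhaber 0 l j * of_nat (Suc n) ^ j) = of_nat (Suc n) ^ l"
    using faulhaber_diff[of l "of_nat (Suc n)"] by (simp only: right_diff_distrib sum_subtractf)
  then show ?case using Suc by (simp del: sum.atMost_Suc of_nat_Suc add: algebra_simps)
qed

lemma regular_single_neg: "regular_list [- of_nat l]"
proof -
  have "- of_nat l \<noteq> (1 :: complex)"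
  proof
    assume "- of_nat l = (1 :: complex)"
    then have "(of_nat (Suc l) :: complex) = 0" by (simp add: add_eq_0_iff2)
    then show False by (simp only: of_nat_eq_0_iff nat.distinct)
  qed
  then show ?thesis by simp
qed

text \<open>The polynomial satisfies the recursion and is its own expansion, exactly from
  \<open>N = 1\<close> on; uniqueness of tails does the rest.\<close>

lemma mz_tail_neg:
  assumes "n \<ge> 1"
  shows "mz_tail \<delta> [- of_nat l] n = (\<Sum>j\<le>Suc l. faulhaber \<delta> l j * of_nat n ^ j)"
proof -
  let ?g = "\<lambda>n::nat. \<Sum>j\<le>Suc l. faulhaber 0 l j * of_nat n ^ j"
  have "?g n = ?g (Suc n) + npow (Suc n) (- of_nat l) * mz_tail \<delta> [] (Suc n)" for n
    using faulhaber_diff[of l "of_nat (Suc n)"]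
    by (simp add: npow_neg_of_nat right_diff_distrib sum_subtractf algebra_simps del: sum.atMost_Suc)
  moreover have "?g N - (\<Sum>t<Suc (Suc l). plain_coeff (- of_nat l) (mz_coeff \<delta> []) t * npow N (- of_nat l - 1 + of_nat t)) = 0"
    if N: "N \<ge> 1" for N
  proof -
    have "?g N = (\<Sum>t\<le>Suc l. em_gamma t (- of_nat l) * of_nat N ^ (Suc l - t))"
      by (rule sum.reindex_bij_witness[of _ "\<lambda>t. Suc l - t" "\<lambda>t. Suc l - t"]) (auto simp: faulhaber_def)
    also have "\<dots> = (\<Sum>t\<le>Suc l. plain_coeff (- of_nat l) (mz_coeff \<delta> []) t * npow N (- of_nat l - 1 + of_nat t))"
    proof (intro sum.cong refl)
      fix t assume "t \<in> {..Suc l}"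
      then have "- of_nat l - 1 + of_nat t = (- of_nat (Suc l - t) :: complex)" by (simp add: of_nat_diff)
      then show "em_gamma t (- of_nat l) * of_nat N ^ (Suc l - t) = plain_coeff (- of_nat l) (mz_coeff \<delta> []) t * npow N (- of_nat l - 1 + of_nat t)"
        using N by (simp only: npow_neg_of_nat mz_coeff.simps plain_coeff_delta)
    qed
    finally show ?thesis by (simp add: lessThan_Suc_atMost del: sum.atMost_Suc sum.lessThan_Suc)
  qed
  then have "(\<lambda>N. ?g N - (\<Sum>t<Suc (Suc l). plain_coeff (- of_nat l) (mz_coeff \<delta> []) t * npow N (- of_nat l - 1 + of_nat t))) \<longlonglongrightarrow> 0"
    by (intro tendsto_eventually eventually_sequentiallyI[of 1])
  moreover have "Re (- of_nat l - 1 :: complex) + real (Suc (Suc l)) > 0" by simp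
  ultimately have "is_tail (- of_nat l - 1) (plain_coeff (- of_nat l) (mz_coeff \<delta> [])) (\<lambda>m. npow m (- of_nat l) * mz_tail \<delta> [] m) ?g"
    unfolding is_tail_def by blast
  then have "mz_tail \<delta> [- of_nat l] n = ?g n + \<delta> * (npow n (- of_nat l) * mz_tail \<delta> [] n)"
    using assms by (intro mz_tail_Cons) simp_all
  also have "\<dots> = (\<Sum>j\<le>Suc l. faulhaber 0 l j * of_nat n ^ j) + (\<Sum>j\<le>Suc l. if j = l then \<delta> * of_nat n ^ j else 0)"
    using assms by (simp add: npow_neg_of_nat del: sum.atMost_Suc)
  also have "\<dots> = (\<Sum>j\<le>Suc l. faulhaber \<delta> l j * of_nat n ^ j)"
    unfolding sum.distrib[symmetric] by (intro sum.cong refl) (auto simp: faulhaber_delta[of _ l \<delta>] algebra_simps)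
  finally show ?thesis .
qed

lemma faulhaber_0: "faulhaber 0 l 0 = bern_coeff (Suc l) * pochhammer (- of_nat l) l"
  by (simp add: faulhaber_def em_gamma_def)

text \<open>The right side is \<open>zeta(-l) = (-1)^l B_(l+1) / (l+1)\<close>. It is free of
  \<delta>, as both versions are the same series in depth one.\<close>

lemma mz_val_neg: "mz_val \<delta> [- of_nat l] = faulhaber 0 l 0"
proof -
  have "(\<Sum>j\<le>Suc l. faulhaber \<delta> l j) = (\<Sum>j\<le>Suc l. faulhaber 0 l j) + (\<Sum>j\<le>Suc l. if j = l then \<delta> else 0)"
    unfolding sum.distrib[symmetric] by (intro sum.cong refl) (simp add: faulhaber_delta[of _ l \<delta>])
  moreover have "(1::complex) = faulhaber 0 l 0 - (\<Sum>j\<le>Suc l. faulhaber 0 l j)"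
    using sum_powers_faulhaber[of l 1] by (simp del: sum.atMost_Suc)
  ultimately show ?thesis
    unfolding mz_val_def by (simp add: mz_tail_neg algebra_simps del: sum.atMost_Suc)
qed

text \<open>Past index \<open>l + 1\<close> the factor \<open>pochhammer (- l) (t - 1)\<close> is 0,
  so the expansion is a finite sum of monomials. It is written as a combination of shifts of the
  expansion of the constant 1, as \<open>is_tail_lincomb\<close> requires.\<close>

lemma mz_coeff_neg:
  "mz_coeff \<delta> [- of_nat l] t = (\<Sum>j\<le>Suc l. faulhaber \<delta> l j * (if t < Suc l - j then 0 else mz_coeff \<delta> [] (t - (Suc l - j))))"
proof -
  have c: "mz_coeff \<delta> [- of_nat l] t = em_gamma t (- of_nat l) + (if t = 1 then \<delta> else 0)"
    unfolding mz_coeff.simps mz_exp.simps add_0_right plain_coeff_delta by simp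
  have "(\<Sum>j\<le>Suc l. faulhaber \<delta> l j * (if t < Suc l - j then 0 else mz_coeff \<delta> [] (t - (Suc l - j))))
     = (\<Sum>j\<le>Suc l. if j = Suc l - t \<and> t \<le> Suc l then faulhaber \<delta> l j else 0)"
  proof (intro sum.cong refl)
    fix j assume "j \<in> {..Suc l}"
    then have "j \<le> Suc l" by simp
    consider "t < Suc l - j" | "t = Suc l - j" | "t > Suc l - j" by linarith
    then show "faulhaber \<delta> l j * (if t < Suc l - j then 0 else mz_coeff \<delta> [] (t - (Suc l - j)))
        = (if j = Suc l - t \<and> t \<le> Suc l then faulhaber \<delta> l j else 0)"
    proof cases
      case 1
      with \<open>j \<le> Suc l\<close> have "\<not> (j = Suc l - t \<and> t \<le> Suc l)" by linarith
      with 1 show ?thesis by (simp only: if_True if_False mult_zero_right)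
    next
      case 2
      with \<open>j \<le> Suc l\<close> have "j = Suc l - t \<and> t \<le> Suc l" "t - (Suc l - j) = 0" "\<not> t < Suc l - j" by linarith+
      then show ?thesis by (simp only: if_True if_False mz_coeff.simps(1) mult_1_right simp_thms)
    next
      case 3
      with \<open>j \<le> Suc l\<close> have "\<not> (j = Suc l - t \<and> t \<le> Suc l)" "t - (Suc l - j) \<noteq> 0" "\<not> t < Suc l - j" by linarith+
      then show ?thesis by (simp only: if_True if_False mz_coeff.simps(1) mult_zero_right)
    qed
  qed
  also have "\<dots> = (if t \<le> Suc l then faulhaber \<delta> l (Suc l - t) else 0)"
    by (cases "t \<le> Suc l")
      (simp_all only: simp_thms if_True if_False sum.neutral_const sum.delta finite_atMost atMost_iff diff_le_self)
  also have "\<dots> = mz_coeff \<delta> [- of_nat l] t"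
  proof (cases "t \<le> Suc l")
    case True
    then have "Suc l - (Suc l - t) = t" "Suc l - t = l \<longleftrightarrow> t = 1" by auto
    with True show ?thesis unfolding c faulhaber_def by simp
  next
    case False
    then have "pochhammer (- of_nat l :: complex) (t - 1) = 0"
      by (intro pochhammer_of_nat_eq_0_lemma) simp
    then show ?thesis using False unfolding c by (simp add: em_gamma_def)
  qed
  finally show ?thesis ..
qed

text \<open>The exponents differ by the natural number \<open>Suc l - j\<close>, so each denominator
  of the shorter list already occurs for the longer one.\<close>

lemma regular_list_shift:
  assumes "regular_list (zs @ [s, - of_nat l])" "j \<le> Suc l"
  shows "regular_list (zs @ [s - of_nat j]) \<and>
    mz_exp (zs @ [s - of_nat j]) = mz_exp (zs @ [s, - of_nat l]) + of_nat (Suc l - j)"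
  using assms
proof (induction zs)
  case Nil
  have "\<forall>t::nat. s + mz_exp [- of_nat l] + of_nat t - 1 \<noteq> 0" using Nil(1) by simp
  then have "s + mz_exp [- of_nat l] + of_nat (Suc l - j) - 1 \<noteq> 0" by blast
  moreover have "s + mz_exp [- of_nat l] + of_nat (Suc l - j) - 1 = s - of_nat j - 1"
    using Nil(2) by (simp add: of_nat_diff)
  ultimately have "s - of_nat j \<noteq> 1" by auto
  then show ?case using Nil(2) by (simp add: of_nat_diff)
next
  case (Cons x zs)
  then have IH: "regular_list (zs @ [s - of_nat j])"
    "mz_exp (zs @ [s - of_nat j]) = mz_exp (zs @ [s, - of_nat l]) + of_nat (Suc l - j)" by auto
  have "x + mz_exp (zs @ [s - of_nat j]) + of_nat t - 1 \<noteq> 0" for t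
  proof -
    have "x + mz_exp (zs @ [s, - of_nat l]) + of_nat (t + (Suc l - j)) - 1 \<noteq> 0"
      using Cons.prems(1) by (simp del: of_nat_add)
    then show ?thesis unfolding IH(2) by (simp add: algebra_simps)
  qed
  then show ?case using IH by simp
qed

text \<open>Once the innermost tail is a polynomial, its monomial \<open>n ^ j\<close> is absorbed
  as \<open>s - j\<close> into the preceding power; linearity carries this outward.\<close>

lemma mz_tail_last_neg:
  assumes "regular_list (zs @ [s, - of_nat l])"
  shows "(\<forall>t. mz_coeff \<delta> (zs @ [s, - of_nat l]) t =
       (\<Sum>j\<le>Suc l. faulhaber \<delta> l j * (if t < Suc l - j then 0 else mz_coeff \<delta> (zs @ [s - of_nat j]) (t - (Suc l - j))))) \<and>
     (\<forall>n\<ge>1. mz_tail \<delta> (zs @ [s, - of_nat l]) n = (\<Sum>j\<le>Suc l. faulhaber \<delta> l j * mz_tail \<delta> (zs @ [s - of_nat j]) n))"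
proof -
  \<comment> \<open>One step outward. In the base case the head \<open>s - j\<close> varies with
    \<open>j\<close> and the rest is empty; later the head is fixed and the rest varies. Letting
    both depend on \<open>j\<close> covers the two cases.\<close>
  have step: "(\<forall>t. mz_coeff \<delta> (x # ys) t =
       (\<Sum>j\<le>Suc l. faulhaber \<delta> l j * (if t < Suc l - j then 0 else mz_coeff \<delta> (x' j # ys' j) (t - (Suc l - j))))) \<and>
     (\<forall>n\<ge>1. mz_tail \<delta> (x # ys) n = (\<Sum>j\<le>Suc l. faulhaber \<delta> l j * mz_tail \<delta> (x' j # ys' j) n))"
    if reg: "\<And>j. j \<le> Suc l \<Longrightarrow> regular_list (x' j # ys' j)"
      and ex: "\<And>j. j \<le> Suc l \<Longrightarrow> x' j + mz_exp (ys' j) = x + mz_exp ys + of_nat (Suc l - j)"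
      and co: "\<And>t. mz_coeff \<delta> ys t = (\<Sum>j\<le>Suc l. faulhaber \<delta> l j * (if t < Suc l - j then 0 else mz_coeff \<delta> (ys' j) (t - (Suc l - j))))"
      and fu: "\<And>n. n \<ge> 1 \<Longrightarrow> npow n x * mz_tail \<delta> ys n = (\<Sum>j\<le>Suc l. faulhaber \<delta> l j * (npow n (x' j) * mz_tail \<delta> (ys' j) n))"
    for x ys x' ys'
  proof -
    let ?a = "x + mz_exp ys"
    have co': "mz_coeff \<delta> ys = (\<lambda>t. \<Sum>j\<le>Suc l. faulhaber \<delta> l j * (if t < Suc l - j then 0 else mz_coeff \<delta> (ys' j) (t - (Suc l - j))))"
      using co by (simp add: fun_eq_iff)
    have pc: "plain_coeff ?a (mz_coeff \<delta> ys) t = (\<Sum>j\<le>Suc l. faulhaber \<delta> l j *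
        (if t < Suc l - j then 0 else plain_coeff (x' j + mz_exp (ys' j)) (mz_coeff \<delta> (ys' j)) (t - (Suc l - j))))" for t
      unfolding co' plain_coeff_sum plain_coeff_shift by (intro sum.cong refl) (simp only: ex atMost_iff)
    have "mz_coeff \<delta> (x # ys) t =
       (\<Sum>j\<le>Suc l. faulhaber \<delta> l j * (if t < Suc l - j then 0 else mz_coeff \<delta> (x' j # ys' j) (t - (Suc l - j))))" for t
    proof -
      have "(if t = 0 then 0 else \<delta> * mz_coeff \<delta> ys (t - 1)) = (\<Sum>j\<le>Suc l. faulhaber \<delta> l j *
          (if t < Suc l - j \<or> t - (Suc l - j) = 0 then 0 else \<delta> * mz_coeff \<delta> (ys' j) (t - (Suc l - j) - 1)))"
      proof (cases "t = 0")
        case False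
        have "\<delta> * mz_coeff \<delta> ys (t - 1) = (\<Sum>j\<le>Suc l. faulhaber \<delta> l j *
            (if t - 1 < Suc l - j then 0 else \<delta> * mz_coeff \<delta> (ys' j) (t - 1 - (Suc l - j))))"
          unfolding co sum_distrib_left by (intro sum.cong refl) auto
        also have "\<dots> = (\<Sum>j\<le>Suc l. faulhaber \<delta> l j *
          (if t < Suc l - j \<or> t - (Suc l - j) = 0 then 0 else \<delta> * mz_coeff \<delta> (ys' j) (t - (Suc l - j) - 1)))"
          using False by (intro sum.cong refl) (auto simp: diff_commute)
        finally show ?thesis using False by simp
      qed (auto intro!: sum.neutral)
      then show ?thesis
        unfolding mz_coeff.simps pc by (simp only: sum.distrib[symmetric]) (intro sum.cong refl, auto simp: distrib_left)
    qed
    moreover have "mz_tail \<delta> (x # ys) n = (\<Sum>j\<le>Suc l. faulhaber \<delta> l j * mz_tail \<delta> (x' j # ys' j) n)" if n: "n \<ge> 1" for n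
    proof -
      let ?g = "\<lambda>j n. mz_tail \<delta> (x' j # ys' j) n - \<delta> * (npow n (x' j) * mz_tail \<delta> (ys' j) n)"
      have "is_tail (?a - 1) (plain_coeff ?a (\<lambda>t. \<Sum>j\<le>Suc l. faulhaber \<delta> l j * (if t < Suc l - j then 0 else mz_coeff \<delta> (ys' j) (t - (Suc l - j)))))
         (\<lambda>n. \<Sum>j\<le>Suc l. faulhaber \<delta> l j * (npow n (x' j) * mz_tail \<delta> (ys' j) n)) (\<lambda>n. \<Sum>j\<le>Suc l. faulhaber \<delta> l j * ?g j n)"
      proof (rule is_tail_lincomb)
        fix j assume "j \<in> {..Suc l}"
        then have j: "j \<le> Suc l" by simp
        show "is_tail (?a + of_nat (Suc l - j) - 1) (plain_coeff (?a + of_nat (Suc l - j)) (mz_coeff \<delta> (ys' j)))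
           (\<lambda>n. npow n (x' j) * mz_tail \<delta> (ys' j) n) (?g j)"
          using mz_tail_is_tail[OF reg[OF j], of \<delta>] unfolding ex[OF j] .
      qed
      then have "is_tail (?a - 1) (plain_coeff ?a (mz_coeff \<delta> ys)) (\<lambda>m. npow m x * mz_tail \<delta> ys m) (\<lambda>n. \<Sum>j\<le>Suc l. faulhaber \<delta> l j * ?g j n)"
        unfolding co'[symmetric] by (rule is_tail_cong) (simp_all only: fu)
      from mz_tail_Cons[OF this n]
      have "mz_tail \<delta> (x # ys) n = (\<Sum>j\<le>Suc l. faulhaber \<delta> l j * ?g j n) + \<delta> * (\<Sum>j\<le>Suc l. faulhaber \<delta> l j * (npow n (x' j) * mz_tail \<delta> (ys' j) n))"
        by (simp only: fu[OF n])
      also have "\<dots> = (\<Sum>j\<le>Suc l. faulhaber \<delta> l j * mz_tail \<delta> (x' j # ys' j) n)"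
        unfolding sum_distrib_left sum.distrib[symmetric] by (intro sum.cong refl) (simp add: algebra_simps)
      finally show ?thesis .
    qed
    ultimately show ?thesis by blast
  qed
  show ?thesis using assms
  proof (induction zs)
    case Nil
    have "(\<forall>t. mz_coeff \<delta> (s # [- of_nat l]) t =
       (\<Sum>j\<le>Suc l. faulhaber \<delta> l j * (if t < Suc l - j then 0 else mz_coeff \<delta> ((s - of_nat j) # []) (t - (Suc l - j))))) \<and>
     (\<forall>n\<ge>1. mz_tail \<delta> (s # [- of_nat l]) n = (\<Sum>j\<le>Suc l. faulhaber \<delta> l j * mz_tail \<delta> ((s - of_nat j) # []) n))"
    proof (rule step)
      show "regular_list [s - of_nat j]" if "j \<le> Suc l" for j
        using regular_list_shift[OF Nil that] by simp
      show "s - of_nat j + mz_exp [] = s + mz_exp [- of_nat l] + of_nat (Suc l - j)" if "j \<le> Suc l" for j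
        using that by (simp add: of_nat_diff)
      show "mz_coeff \<delta> [- of_nat l] t = (\<Sum>j\<le>Suc l. faulhaber \<delta> l j * (if t < Suc l - j then 0 else mz_coeff \<delta> [] (t - (Suc l - j))))" for t
        by (rule mz_coeff_neg)
      fix n :: nat assume n: "n \<ge> 1"
      have "npow n (s - of_nat j) = npow n s * of_nat n ^ j" for j
        using n npow_add[of n s "- of_nat j"] by (simp add: npow_neg_of_nat)
      then show "npow n s * mz_tail \<delta> [- of_nat l] n = (\<Sum>j\<le>Suc l. faulhaber \<delta> l j * (npow n (s - of_nat j) * mz_tail \<delta> [] n))"
        unfolding mz_tail_neg[OF n] sum_distrib_left by (intro sum.cong refl) simp
    qed
    then show ?case unfolding append_Nil .
  next
    case (Cons x zs)
    then have IH: "\<And>t. mz_coeff \<delta> (zs @ [s, - of_nat l]) t =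
       (\<Sum>j\<le>Suc l. faulhaber \<delta> l j * (if t < Suc l - j then 0 else mz_coeff \<delta> (zs @ [s - of_nat j]) (t - (Suc l - j))))"
      "\<And>n. n \<ge> 1 \<Longrightarrow> mz_tail \<delta> (zs @ [s, - of_nat l]) n = (\<Sum>j\<le>Suc l. faulhaber \<delta> l j * mz_tail \<delta> (zs @ [s - of_nat j]) n)"
      by simp_all
    have "(\<forall>t. mz_coeff \<delta> (x # (zs @ [s, - of_nat l])) t =
       (\<Sum>j\<le>Suc l. faulhaber \<delta> l j * (if t < Suc l - j then 0 else mz_coeff \<delta> (x # (zs @ [s - of_nat j])) (t - (Suc l - j))))) \<and>
     (\<forall>n\<ge>1. mz_tail \<delta> (x # (zs @ [s, - of_nat l])) n = (\<Sum>j\<le>Suc l. faulhaber \<delta> l j * mz_tail \<delta> (x # (zs @ [s - of_nat j])) n))"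
    proof (rule step[where x' = "\<lambda>_. x" and ys' = "\<lambda>j. zs @ [s - of_nat j]"])
      show "regular_list (x # zs @ [s - of_nat j])" if "j \<le> Suc l" for j
        using regular_list_shift[OF Cons.prems that] unfolding append_Cons by blast
      show "x + mz_exp (zs @ [s - of_nat j]) = x + mz_exp (zs @ [s, - of_nat l]) + of_nat (Suc l - j)" if "j \<le> Suc l" for j
        using regular_list_shift[OF Cons.prems that] by simp
      show "npow n x * mz_tail \<delta> (zs @ [s, - of_nat l]) n = (\<Sum>j\<le>Suc l. faulhaber \<delta> l j * (npow n x * mz_tail \<delta> (zs @ [s - of_nat j]) n))"
        if "n \<ge> 1" for n
        unfolding IH(2)[OF that] sum_distrib_left by (intro sum.cong refl) simp
    qed (rule IH(1))
    then show ?case unfolding append_Cons .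
  qed
qed

lemma mz_val_last_neg:
  assumes "regular_list (zs @ [s, - of_nat l])"
  shows "mz_val \<delta> (zs @ [s, - of_nat l]) = (\<Sum>j\<le>Suc l. faulhaber \<delta> l j * mz_val \<delta> (zs @ [s - of_nat j]))"
proof -
  have 1: "mz_tail \<delta> (zs @ [s, - of_nat l]) 1 = (\<Sum>j\<le>Suc l. faulhaber \<delta> l j * mz_tail \<delta> (zs @ [s - of_nat j]) 1)"
    using mz_tail_last_neg[OF assms, of \<delta>] by blast
  have 2: "mz_tail \<delta> (tl (zs @ [s, - of_nat l])) 1 = (\<Sum>j\<le>Suc l. faulhaber \<delta> l j * mz_tail \<delta> (tl (zs @ [s - of_nat j])) 1)"
  proof (cases zs)
    case Nil
    then show ?thesis by (simp add: mz_tail_neg del: sum.atMost_Suc)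
  next
    case (Cons x zs')
    then have "regular_list (zs' @ [s, - of_nat l])" using assms by simp
    then show ?thesis using mz_tail_last_neg[of zs' s l \<delta>] Cons by simp
  qed
  show ?thesis
    unfolding mz_val_def 1 2 sum_distrib_left sum.distrib[symmetric]
    by (intro sum.cong refl) (simp add: algebra_simps)
qed

section \<open>Setting the first variable to a nonpositive integer\<close>

text \<open>Hadamard finite part: \<open>\<kappa>\<close> is the limit of \<open>y\<close> after removing powers \<open>N\<^bsup>-\<alpha>-t\<^esup>\<close>, hence unique
  if \<open>\<alpha>\<close> is not an integer.\<close>

definition has_finite_part :: "complex \<Rightarrow> (nat \<Rightarrow> complex) \<Rightarrow> complex \<Rightarrow> bool" where
  "has_finite_part \<alpha> y \<kappa> \<longleftrightarrow> (\<exists>K e. (\<lambda>N. y N + (\<Sum>t<K. e t * npow N (\<alpha> + of_nat t))) \<longlonglongrightarrow> \<kappa>)"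

lemma has_finite_part_shift:
  assumes "has_finite_part (\<alpha> + of_nat k) y \<kappa>" shows "has_finite_part \<alpha> y \<kappa>"
proof -
  obtain K e where "(\<lambda>N. y N + (\<Sum>t<K. e t * npow N (\<alpha> + of_nat k + of_nat t))) \<longlonglongrightarrow> \<kappa>"
    using assms by (auto simp: has_finite_part_def)
  moreover have "(\<Sum>t<K + k. (if t < k then 0 else e (t - k)) * npow N (\<alpha> + of_nat t))
      = (\<Sum>t<K. e t * npow N (\<alpha> + of_nat k + of_nat t))" for N
  proof -
    have "(\<Sum>t<K + k. (if t < k then 0 else e (t - k)) * npow N (\<alpha> + of_nat t))
       = (\<Sum>t\<in>{k..<K + k}. e (t - k) * npow N (\<alpha> + of_nat t))"
      by (rule sum.mono_neutral_cong_right) auto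
    also have "\<dots> = (\<Sum>t<K. e t * npow N (\<alpha> + of_nat k + of_nat t))"
      using sum.shift_bounds_nat_ivl[of "\<lambda>t. e (t - k) * npow N (\<alpha> + of_nat t)" 0 k K]
      by (simp add: atLeast0LessThan algebra_simps)
    finally show ?thesis .
  qed
  ultimately have "(\<lambda>N. y N + (\<Sum>t<K + k. (if t < k then 0 else e (t - k)) * npow N (\<alpha> + of_nat t))) \<longlonglongrightarrow> \<kappa>"
    by (simp only:)
  then show ?thesis unfolding has_finite_part_def
    by (intro exI[of _ "K + k"] exI[of _ "\<lambda>t. if t < k then 0 else e (t - k)"])
qed

lemma has_finite_part_lift: "has_finite_part \<alpha> y \<kappa> \<Longrightarrow> \<alpha> = \<beta> + of_nat k \<Longrightarrow> has_finite_part \<beta> y \<kappa>"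
  by (simp add: has_finite_part_shift)

lemma has_finite_part_add:
  assumes "has_finite_part \<alpha> y \<kappa>" "has_finite_part \<alpha> z \<nu>" shows "has_finite_part \<alpha> (\<lambda>N. y N + z N) (\<kappa> + \<nu>)"
proof -
  obtain K e where 1: "(\<lambda>N. y N + (\<Sum>t<K. e t * npow N (\<alpha> + of_nat t))) \<longlonglongrightarrow> \<kappa>"
    using assms(1) by (auto simp: has_finite_part_def)
  obtain L d where 2: "(\<lambda>N. z N + (\<Sum>t<L. d t * npow N (\<alpha> + of_nat t))) \<longlonglongrightarrow> \<nu>"
    using assms(2) by (auto simp: has_finite_part_def)
  define M where "M = max K L"
  have M: "K \<le> M" "L \<le> M" by (auto simp: M_def)
  have ext: "(\<Sum>t<M. (if t < k then f t else 0) * npow N (\<alpha> + of_nat t)) = (\<Sum>t<k. f t * npow N (\<alpha> + of_nat t))"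
    if "k \<le> M" for k f N
    by (rule sum.mono_neutral_cong_right) (use that in auto)
  have "(\<lambda>N. y N + z N + (\<Sum>t<M. ((if t < K then e t else 0) + (if t < L then d t else 0)) * npow N (\<alpha> + of_nat t))) \<longlonglongrightarrow> \<kappa> + \<nu>"
    using tendsto_add[OF 1 2] unfolding distrib_right sum.distrib by (simp add: ext M add_ac)
  then show ?thesis unfolding has_finite_part_def by (intro exI)
qed

lemma has_finite_part_cmult:
  assumes "has_finite_part \<alpha> y \<kappa>" shows "has_finite_part \<alpha> (\<lambda>N. c * y N) (c * \<kappa>)"
proof -
  obtain K e where 1: "(\<lambda>N. y N + (\<Sum>t<K. e t * npow N (\<alpha> + of_nat t))) \<longlonglongrightarrow> \<kappa>"
    using assms(1) by (auto simp: has_finite_part_def)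
  have "(\<lambda>N. c * y N + (\<Sum>t<K. c * e t * npow N (\<alpha> + of_nat t))) \<longlonglongrightarrow> c * \<kappa>"
    using tendsto_mult_left[OF 1, of c] by (simp add: distrib_left sum_distrib_left mult.assoc)
  then show ?thesis unfolding has_finite_part_def by (intro exI[of _ K] exI[of _ "\<lambda>t. c * e t"])
qed

lemma has_finite_part_sum:
  assumes "finite J" "\<And>j. j \<in> J \<Longrightarrow> has_finite_part \<alpha> (y j) (\<kappa> j)"
  shows "has_finite_part \<alpha> (\<lambda>N. \<Sum>j\<in>J. p j * y j N) (\<Sum>j\<in>J. p j * \<kappa> j)"
  using assms
proof (induction J rule: finite_induct)
  case empty
  have "(\<lambda>N. 0 + (\<Sum>t<0. (0::complex) * npow N (\<alpha> + of_nat t))) \<longlonglongrightarrow> 0" by simp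
  then show ?case unfolding has_finite_part_def sum.empty by (intro exI[of _ 0] exI[of _ "\<lambda>_. 0"])
next
  case (insert j J)
  have "has_finite_part \<alpha> (\<lambda>N. p j * y j N + (\<Sum>j\<in>J. p j * y j N)) (p j * \<kappa> j + (\<Sum>j\<in>J. p j * \<kappa> j))"
    using insert by (intro has_finite_part_add has_finite_part_cmult) auto
  then show ?case using insert by simp
qed

lemma has_finite_part_cong:
  assumes "has_finite_part \<alpha> y \<kappa>" "\<And>N. N \<ge> 1 \<Longrightarrow> y N = z N" shows "has_finite_part \<alpha> z \<kappa>"
proof -
  obtain K e where 1: "(\<lambda>N. y N + (\<Sum>t<K. e t * npow N (\<alpha> + of_nat t))) \<longlonglongrightarrow> \<kappa>"
    using assms(1) by (auto simp: has_finite_part_def)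
  have "\<forall>\<^sub>F N in sequentially. y N + (\<Sum>t<K. e t * npow N (\<alpha> + of_nat t)) = z N + (\<Sum>t<K. e t * npow N (\<alpha> + of_nat t))"
    using assms(2) by (intro eventually_sequentiallyI[of 1]) auto
  from Lim_transform_eventually[OF 1 this] show ?thesis unfolding has_finite_part_def by blast
qed

text \<open>Otherwise \<open>q^(-x) = 1\<close> for two consecutive integers, so
  \<open>exp (-x ln (1 + 1/q)) = 1\<close>. For \<open>q > norm x\<close> this exponent is too small
  to be a nonzero multiple of \<open>2 pi i\<close>, so it is 0 and \<open>x = 0\<close>.\<close>

lemma ex_npow_neq_1:
  assumes "x \<noteq> 0" obtains q where "q \<ge> 1" "npow q x \<noteq> 1"
proof (rule ccontr)
  assume "\<not> thesis"
  with that have all: "npow q x = 1" if "q \<ge> 1" for q using \<open>q \<ge> 1\<close> by blast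
  obtain q :: nat where q: "real q > norm x" using reals_Archimedean2 by blast
  then have q1: "q \<ge> 1" using norm_ge_zero[of x] by (cases q) auto
  define h where "h = ln (real (Suc q)) - ln (real q)"
  have h: "h > 0" "h \<le> 1 / real q"
  proof -
    show "h > 0" unfolding h_def using q1 by simp
    have "h = ln (1 + 1 / real q)"
    proof -
      have "1 + 1 / real q = real (Suc q) / real q" using q1 by (simp add: field_simps)
      then show ?thesis unfolding h_def using q1 by (simp add: ln_div)
    qed
    also have "\<dots> \<le> 1 / real q" by (rule ln_add_one_self_le_self) simp
    finally show "h \<le> 1 / real q" .
  qed
  have "npow (Suc q) x / npow q x = exp (- x * of_real h)"
    using q1 by (simp add: npow_eq_exp h_def exp_diff[symmetric] algebra_simps)
  then have "exp (- x * of_real h) = 1" using all[of q] all[of "Suc q"] q1 by simp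
  then obtain n :: int where re: "Re (- x * of_real h) = 0" and im: "Im (- x * of_real h) = of_int (2 * n) * pi"
    unfolding exp_eq_1 by blast
  have "\<bar>Im (- x * of_real h)\<bar> \<le> norm x * h"
    using abs_Im_le_cmod[of "- x * of_real h"] h by (simp add: norm_mult)
  also have "\<dots> \<le> norm x * (1 / real q)" using h by (intro mult_left_mono) auto
  also have "\<dots> < 1" using q q1 by (simp add: field_simps)
  finally have "\<bar>of_int (2 * n) * pi\<bar> < 1" unfolding im .
  moreover have "1 < \<bar>of_int (2 * n) * pi\<bar>" if "n \<noteq> 0"
  proof -
    have "1 \<le> \<bar>n\<bar>" using that by simp
    then have "1 \<le> (of_int \<bar>n\<bar> :: real)" by (simp only: of_int_1_le_iff)
    then have "1 \<le> \<bar>of_int n :: real\<bar>" by simp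
    then have "1 * 3 < 2 * \<bar>of_int n :: real\<bar> * pi" using pi_gt3 by (intro mult_less_le_imp_less mult_le_less_imp_less) auto
    then show ?thesis by (simp add: abs_mult)
  qed
  ultimately have "n = 0" by fastforce
  with re im have "- x * of_real h = 0" by (simp add: complex_eq_iff)
  then show False using assms h by simp
qed

text \<open>Passing from \<open>N\<close> to \<open>q N\<close> multiplies \<open>N\<^bsup>-\<alpha>-t\<^esup>\<close> by \<open>q\<^bsup>-\<alpha>-t\<^esup>\<close>, so a suitable combination of the two
  sequences eliminates one exponent without killing the limit.\<close>

lemma has_finite_part_zero:
  assumes "has_finite_part \<alpha> (\<lambda>N. 0) \<kappa>" "\<alpha> \<notin> \<int>" shows "\<kappa> = 0"
proof -
  have "\<kappa> = 0" if "(\<lambda>N. \<Sum>t<K. e t * npow N (\<alpha> + of_nat t)) \<longlonglongrightarrow> \<kappa>" for K e \<kappa>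
    using that
  proof (induction K arbitrary: e \<kappa>)
    case 0
    then show ?case by (simp add: LIMSEQ_const_iff)
  next
    case (Suc K)
    let ?x = "\<alpha> + of_nat K"
    \<comment> \<open>Here non-integrality enters: a power with exponent 0 is constant and could not
      be separated from the limit.\<close>
    have "?x \<noteq> 0"
    proof
      assume "?x = 0"
      then have "\<alpha> = - of_nat K" by (simp add: eq_neg_iff_add_eq_0)
      then show False using assms(2) by simp
    qed
    then obtain q where q: "q \<ge> 1" "npow q ?x \<noteq> 1" by (rule ex_npow_neq_1)
    let ?y = "\<lambda>N. \<Sum>t<Suc K. e t * npow N (\<alpha> + of_nat t)"
    have "filterlim (\<lambda>N. q * N) sequentially sequentially"
      using q(1) by (intro filterlim_subseq) (simp add: strict_mono_def)
    from filterlim_compose[OF Suc.prems this] have "(\<lambda>N. ?y (q * N)) \<longlonglongrightarrow> \<kappa>" .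
    from tendsto_diff[OF this tendsto_mult_left[OF Suc.prems, of "npow q ?x"]]
    have "(\<lambda>N. ?y (q * N) - npow q ?x * ?y N) \<longlonglongrightarrow> \<kappa> - npow q ?x * \<kappa>" .
    also have "(\<lambda>N. ?y (q * N) - npow q ?x * ?y N)
        = (\<lambda>N. \<Sum>t<K. (e t * (npow q (\<alpha> + of_nat t) - npow q ?x)) * npow N (\<alpha> + of_nat t))"
    proof
      fix N
      have "?y (q * N) - npow q ?x * ?y N
          = (\<Sum>t<Suc K. (e t * (npow q (\<alpha> + of_nat t) - npow q ?x)) * npow N (\<alpha> + of_nat t))"
        unfolding sum_distrib_left sum_subtractf[symmetric] npow_mult
        by (intro sum.cong refl) (simp add: algebra_simps)
      then show "?y (q * N) - npow q ?x * ?y N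
          = (\<Sum>t<K. (e t * (npow q (\<alpha> + of_nat t) - npow q ?x)) * npow N (\<alpha> + of_nat t))" by simp
    qed
    finally have "\<kappa> - npow q ?x * \<kappa> = 0" by (rule Suc.IH)
    then show ?case using q(2) by (simp add: algebra_simps)
  qed
  then show ?thesis using assms(1) by (auto simp: has_finite_part_def)
qed

lemma has_finite_part_mz_tail:
  assumes "regular_list ys"
  shows "has_finite_part (x + mz_exp ys) (\<lambda>N. npow N x * mz_tail \<delta> ys N) 0"
proof -
  obtain L :: nat where L: "real L > - Re (x + mz_exp ys)" using reals_Archimedean2 by blast
  obtain K C where K: "K \<ge> L" and C: "\<And>n. n \<ge> 1 \<Longrightarrow>
    norm (mz_tail \<delta> ys n - (\<Sum>t<K. mz_coeff \<delta> ys t * npow n (mz_exp ys + of_nat t))) \<le> C * real n powr (- Re (mz_exp ys) - real K)"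
    using mz_tail_expansion[OF assms] by blast
  have lim: "(\<lambda>n. C * real n powr - (Re (x + mz_exp ys) + real K)) \<longlonglongrightarrow> 0"
    using K L by (intro tendsto_mult_right_zero tendsto_neg_powr filterlim_real_sequentially) auto
  have bd: "norm (npow n x * mz_tail \<delta> ys n + (\<Sum>t<K. - mz_coeff \<delta> ys t * npow n (x + mz_exp ys + of_nat t)))
      \<le> C * real n powr - (Re (x + mz_exp ys) + real K)" if n: "n \<ge> 1" for n
  proof -
    have "npow n x * mz_tail \<delta> ys n + (\<Sum>t<K. - mz_coeff \<delta> ys t * npow n (x + mz_exp ys + of_nat t))
       = npow n x * (mz_tail \<delta> ys n - (\<Sum>t<K. mz_coeff \<delta> ys t * npow n (mz_exp ys + of_nat t)))"
      by (simp add: right_diff_distrib sum_distrib_left sum_negf npow_add mult_ac)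
    then have "norm (npow n x * mz_tail \<delta> ys n + (\<Sum>t<K. - mz_coeff \<delta> ys t * npow n (x + mz_exp ys + of_nat t)))
       = real n powr (- Re x) * norm (mz_tail \<delta> ys n - (\<Sum>t<K. mz_coeff \<delta> ys t * npow n (mz_exp ys + of_nat t)))"
      by (simp only: norm_mult norm_npow)
    also have "\<dots> \<le> real n powr (- Re x) * (C * real n powr (- Re (mz_exp ys) - real K))"
      using C[OF n] by (rule mult_left_mono) simp
    also have "\<dots> = C * real n powr (- Re x + (- Re (mz_exp ys) - real K))"
      by (simp only: powr_add mult.left_commute)
    also have "- Re x + (- Re (mz_exp ys) - real K) = - (Re (x + mz_exp ys) + real K)" by simp
    finally show ?thesis .
  qed
  have "(\<lambda>n. npow n x * mz_tail \<delta> ys n + (\<Sum>t<K. - mz_coeff \<delta> ys t * npow n (x + mz_exp ys + of_nat t))) \<longlonglongrightarrow> 0"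
    by (rule Lim_null_comparison[OF eventually_sequentiallyI[of 1] lim]) (rule bd)
  then show ?thesis unfolding has_finite_part_def by (intro exI[of _ K] exI[of _ "\<lambda>t. - mz_coeff \<delta> ys t"])
qed

lemma mz_tail_diff:
  assumes "regular_list (x # ys)" "n \<ge> 1"
  shows "mz_tail \<delta> (x # ys) n - \<delta> * (npow n x * mz_tail \<delta> ys n)
     = mz_tail \<delta> (x # ys) (Suc n) - \<delta> * (npow (Suc n) x * mz_tail \<delta> ys (Suc n)) + npow (Suc n) x * mz_tail \<delta> ys (Suc n)"
  using mz_tail_is_tail[OF assms(1), of \<delta>] assms(2) unfolding is_tail_def by blast

text \<open>The partial sums are the total value minus the tail, and the expansion of the tail
  consists of powers that a finite part discards.\<close>

lemma has_finite_part_mz_val: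
  assumes "regular_list (x # ys)"
  shows "has_finite_part (mz_exp (x # ys)) (\<lambda>N. \<Sum>m=1..N. npow m x * mz_tail \<delta> ys m) (mz_val \<delta> (x # ys))"
proof -
  let ?f = "\<lambda>m. npow m x * mz_tail \<delta> ys m"
  let ?g = "\<lambda>n. mz_tail \<delta> (x # ys) n - \<delta> * ?f n"
  note tail = mz_tail_is_tail[OF assms, of \<delta>]
  obtain K where K: "(\<lambda>N. ?g N - (\<Sum>t<K. plain_coeff (x + mz_exp ys) (mz_coeff \<delta> ys) t * npow N (x + mz_exp ys - 1 + of_nat t))) \<longlonglongrightarrow> 0"
    using tail unfolding is_tail_def by blast
  have sum: "(\<Sum>m=1..N. ?f m) = mz_val \<delta> (x # ys) - ?g N" if "N \<ge> 1" for N
    using that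
  proof (induction N rule: dec_induct)
    case base
    show ?case by (simp add: mz_val_def algebra_simps)
  next
    case (step N)
    have "?g N = ?g (Suc N) + ?f (Suc N)" by (rule mz_tail_diff[OF assms step(1)])
    with step show ?case by simp
  qed
  have "(\<lambda>N. mz_val \<delta> (x # ys) - (?g N - (\<Sum>t<K. plain_coeff (x + mz_exp ys) (mz_coeff \<delta> ys) t * npow N (x + mz_exp ys - 1 + of_nat t)))) \<longlonglongrightarrow> mz_val \<delta> (x # ys) - 0"
    by (intro tendsto_diff tendsto_const K)
  then have "has_finite_part (x + mz_exp ys - 1) (\<lambda>N. mz_val \<delta> (x # ys) - ?g N) (mz_val \<delta> (x # ys))"
    unfolding has_finite_part_def by (intro exI[of _ K] exI[of _ "plain_coeff (x + mz_exp ys) (mz_coeff \<delta> ys)"])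
      (simp add: algebra_simps)
  then show ?thesis unfolding mz_exp.simps by (rule has_finite_part_cong) (simp only: sum)
qed

text \<open>\<open>\<Sum>j. partial_faulhaber \<delta> l j * n ^ j\<close> is the sum of \<open>m\<^sup>l\<close> over \<open>0 < m < n\<close> (for \<open>\<delta> = 0\<close>) or over
  \<open>0 < m \<le> n\<close> (for \<open>\<delta> = 1\<close>).\<close>

definition partial_faulhaber :: "complex \<Rightarrow> nat \<Rightarrow> nat \<Rightarrow> complex" where
  "partial_faulhaber \<delta> l j = (if j = 0 then faulhaber 0 l 0 else 0) - faulhaber (1 - \<delta>) l j"

lemma partial_faulhaber_delta:
  "j \<le> Suc l \<Longrightarrow> partial_faulhaber \<delta> l j = partial_faulhaber 1 l j - (if j = l then 1 - \<delta> else 0)"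
  by (simp add: partial_faulhaber_def faulhaber_def)

text \<open>A finite power sum is \<open>zeta(-l)\<close> minus the complementary tail. The
  complement of \<open>m \<le> n\<close> is \<open>m > n\<close> and that of \<open>m < n\<close> is
  \<open>m \<ge> n\<close>, which explains \<open>1 - \<delta>\<close> in the definition.\<close>

lemma sum_partial_faulhaber: "(\<Sum>j\<le>Suc l. partial_faulhaber 1 l j * of_nat n ^ j) = (\<Sum>m=1..n. of_nat m ^ l)"
proof -
  have "(\<Sum>j\<le>Suc l. partial_faulhaber 1 l j * of_nat n ^ j)
      = (\<Sum>j\<le>Suc l. if j = 0 then faulhaber 0 l 0 else 0) - (\<Sum>j\<le>Suc l. faulhaber 0 l j * of_nat n ^ j)"
    unfolding sum_subtractf[symmetric] partial_faulhaber_def by (intro sum.cong refl) (auto simp: algebra_simps)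
  then show ?thesis unfolding sum_powers_faulhaber by (simp del: sum.atMost_Suc)
qed

lemma sum_partial_faulhaber_delta:
  "(\<Sum>j\<le>Suc l. partial_faulhaber \<delta> l j * of_nat n ^ j) = (\<Sum>m=1..n. of_nat m ^ l) - (1 - \<delta>) * of_nat n ^ l"
proof -
  have "(\<Sum>j\<le>Suc l. partial_faulhaber \<delta> l j * of_nat n ^ j)
      = (\<Sum>j\<le>Suc l. partial_faulhaber 1 l j * of_nat n ^ j) - (\<Sum>j\<le>Suc l. if j = l then (1 - \<delta>) * of_nat n ^ j else 0)"
    unfolding sum_subtractf[symmetric]
    by (intro sum.cong refl) (simp add: partial_faulhaber_delta[of _ l \<delta>] algebra_simps)
  then show ?thesis unfolding sum_partial_faulhaber by (simp del: sum.atMost_Suc)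
qed

lemma generic_shift:
  assumes "generic_list (x # ys)"
  shows "generic_list ((x - of_nat j) # ys)" "generic_list (- of_nat l # x # ys)"
proof -
  have 1: "x + sum_list ys \<notin> \<int>" using assms by simp
  have "x - of_nat j + sum_list ys \<notin> \<int>"
  proof
    assume "x - of_nat j + sum_list ys \<in> \<int>"
    from Ints_add[OF this Ints_of_nat[of j]] show False using 1 by (simp add: algebra_simps)
  qed
  then show "generic_list ((x - of_nat j) # ys)" using assms by simp
  have "- of_nat l + (x + sum_list ys) \<notin> \<int>"
  proof
    assume "- of_nat l + (x + sum_list ys) \<in> \<int>"
    from Ints_add[OF this Ints_of_nat[of l]] show False using 1 by (simp add: algebra_simps)
  qed
  then show "generic_list (- of_nat l # x # ys)" using assms by simp
qed

lemma npow_diff_of_nat: "n \<ge> 1 \<Longrightarrow> npow n (x - of_nat j) = of_nat n ^ j * npow n x"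
  using npow_add[of n x "- of_nat j"] by (simp add: npow_neg_of_nat mult.commute)

text \<open>Both sides are finite parts of sequences of partial sums, and by summation by parts the difference
  of these sequences has finite part zero.\<close>

lemma mz_val_first_neg:
  assumes "generic_list (s # ss)"
  shows "mz_val \<delta> (- of_nat l # s # ss) = (\<Sum>j\<le>Suc l. partial_faulhaber \<delta> l j * mz_val \<delta> ((s - of_nat j) # ss))"
    (is "?L = ?R")
proof -
  \<comment> \<open>The leading exponent on the left side. Every other exponent in the proof is
    \<open>\<alpha>\<close> plus a natural number, so all finite parts can be taken relative to
    it.\<close>
  define \<alpha> where "\<alpha> = s + mz_exp ss - of_nat (l + 2)"
  define h where "h m = npow m s * mz_tail \<delta> ss m" for m
  define T where "T m = mz_tail \<delta> (s # ss) m" for m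
  define t where "t m = T m - \<delta> * h m" for m
  define S where "S n = (\<Sum>m=1..n. of_nat m ^ l :: complex)" for n :: nat
  have reg1: "regular_list (s # ss)" by (rule generic_imp_regular[OF assms])
  have reg2: "regular_list ((s - of_nat j) # ss)" for j
    by (rule generic_imp_regular[OF generic_shift(1)[OF assms]])
  have reg3: "regular_list (- of_nat l # s # ss)" by (rule generic_imp_regular[OF generic_shift(2)[OF assms]])
  have reg_ss: "regular_list ss" using reg1 by simp
  have t: "t n = t (Suc n) + h (Suc n)" if "n \<ge> 1" for n
    using mz_tail_diff[OF reg1 that, of \<delta>] unfolding t_def T_def h_def .
  have \<alpha>: "\<alpha> \<notin> \<int>"
  proof
    assume "\<alpha> \<in> \<int>"
    from Ints_add[OF Ints_add[OF this Ints_of_nat[of "l + 2"]] Ints_of_nat[of "length ss"]] show False using assms by (simp add: \<alpha>_def mz_exp_sum_list)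
  qed
  have "has_finite_part \<alpha> (\<lambda>N. \<Sum>m=1..N. npow m (- of_nat l) * T m) ?L"
    using has_finite_part_mz_val[where \<delta> = \<delta>, OF reg3] unfolding T_def
    by (rule has_finite_part_lift[where k = 0]) (simp add: \<alpha>_def)
  moreover have "has_finite_part \<alpha> (\<lambda>N. \<Sum>j\<le>Suc l. - partial_faulhaber \<delta> l j * (\<Sum>m=1..N. npow m (s - of_nat j) * mz_tail \<delta> ss m))
      (\<Sum>j\<le>Suc l. - partial_faulhaber \<delta> l j * mz_val \<delta> ((s - of_nat j) # ss))"
  proof (rule has_finite_part_sum)
    fix j assume "j \<in> {..Suc l}"
    then have j: "j \<le> Suc l" by simp
    show "has_finite_part \<alpha> (\<lambda>N. \<Sum>m=1..N. npow m (s - of_nat j) * mz_tail \<delta> ss m) (mz_val \<delta> ((s - of_nat j) # ss))"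
      using has_finite_part_mz_val[OF reg2]
      by (rule has_finite_part_lift[where k = "Suc l - j"]) (use j in \<open>simp add: \<alpha>_def of_nat_diff\<close>)
  qed simp
  ultimately have "has_finite_part \<alpha> (\<lambda>N. (\<Sum>m=1..N. npow m (- of_nat l) * T m)
       + (\<Sum>j\<le>Suc l. - partial_faulhaber \<delta> l j * (\<Sum>m=1..N. npow m (s - of_nat j) * mz_tail \<delta> ss m)))
      (?L + (\<Sum>j\<le>Suc l. - partial_faulhaber \<delta> l j * mz_val \<delta> ((s - of_nat j) # ss)))" by (rule has_finite_part_add)
  then have "has_finite_part \<alpha> (\<lambda>N. S N * t N) (?L - ?R)"
  proof (rule has_finite_part_cong[THEN subst[of _ _ "has_finite_part \<alpha> (\<lambda>N. S N * t N)", rotated]])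
    show "?L + (\<Sum>j\<le>Suc l. - partial_faulhaber \<delta> l j * mz_val \<delta> ((s - of_nat j) # ss)) = ?L - ?R"
      unfolding mult_minus_left sum_negf by simp
    fix N :: nat assume "N \<ge> 1"
    have "(\<Sum>j\<le>Suc l. - partial_faulhaber \<delta> l j * (\<Sum>m=1..N. npow m (s - of_nat j) * mz_tail \<delta> ss m))
       = - (\<Sum>m=1..N. (\<Sum>j\<le>Suc l. partial_faulhaber \<delta> l j * of_nat m ^ j) * h m)"
      unfolding sum_distrib_left sum_distrib_right sum_negf[symmetric]
      by (subst sum.swap) (intro sum.cong refl, auto simp: npow_diff_of_nat h_def)
    also have "\<dots> = - (\<Sum>m=1..N. (S m - (1 - \<delta>) * of_nat m ^ l) * h m)"
      unfolding sum_partial_faulhaber_delta S_def ..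
    finally have "(\<Sum>m=1..N. npow m (- of_nat l) * T m)
       + (\<Sum>j\<le>Suc l. - partial_faulhaber \<delta> l j * (\<Sum>m=1..N. npow m (s - of_nat j) * mz_tail \<delta> ss m))
       = (\<Sum>m=1..N. of_nat m ^ l * T m - (S m - (1 - \<delta>) * of_nat m ^ l) * h m)"
      unfolding sum_subtractf by (simp add: npow_neg_of_nat)
    \<comment> \<open>Abel summation: \<open>S\<close> has the increments \<open>m ^ l\<close> and
      \<open>t\<close> drops by \<open>h\<close>. The recursion for \<open>t\<close> is available
      from 1 on only, so \<open>N = 0\<close> is separate; there \<open>S 0 = 0\<close> makes up for
      it.\<close>
    also have "\<dots> = S N * t N"
    proof (induction N)
      case (Suc N)
      have "S N * t N = S N * (t (Suc N) + h (Suc N))"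
        using t[of N] by (cases "N = 0") (auto simp: S_def)
      moreover have "S (Suc N) = S N + of_nat (Suc N) ^ l" by (simp add: S_def)
      moreover have "T (Suc N) = t (Suc N) + \<delta> * h (Suc N)" by (simp add: t_def)
      ultimately show ?case using Suc by (simp add: algebra_simps)
    qed (simp add: S_def)
    finally show "(\<Sum>m=1..N. npow m (- of_nat l) * T m)
       + (\<Sum>j\<le>Suc l. - partial_faulhaber \<delta> l j * (\<Sum>m=1..N. npow m (s - of_nat j) * mz_tail \<delta> ss m)) = S N * t N" .
  qed
  \<comment> \<open>\<open>S\<close> is a polynomial, so the product expands in powers with
    non-integral exponents only, without a constant term.\<close>
  moreover have "has_finite_part \<alpha> (\<lambda>N. S N * t N) 0"
  proof -
    have "has_finite_part \<alpha> (\<lambda>N. \<Sum>j\<le>Suc l. partial_faulhaber 1 l j * (npow N (- of_nat j) * T N + (- \<delta>) * (npow N (s - of_nat j) * mz_tail \<delta> ss N)))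
        (\<Sum>j\<le>Suc l. partial_faulhaber 1 l j * (0 + (- \<delta>) * 0))"
    proof (rule has_finite_part_sum)
      fix j assume "j \<in> {..Suc l}"
      then have j: "j \<le> Suc l" by simp
      have "has_finite_part \<alpha> (\<lambda>N. npow N (- of_nat j) * T N) 0"
        using has_finite_part_mz_tail[OF reg1] unfolding T_def
        by (rule has_finite_part_lift[where k = "Suc l - j"]) (use j in \<open>simp add: \<alpha>_def of_nat_diff\<close>)
      moreover have "has_finite_part \<alpha> (\<lambda>N. npow N (s - of_nat j) * mz_tail \<delta> ss N) 0"
        using has_finite_part_mz_tail[OF reg_ss]
        by (rule has_finite_part_lift[where k = "Suc (Suc l) - j"]) (use j in \<open>simp add: \<alpha>_def of_nat_diff\<close>)
      ultimately show "has_finite_part \<alpha> (\<lambda>N. npow N (- of_nat j) * T N + (- \<delta>) * (npow N (s - of_nat j) * mz_tail \<delta> ss N)) (0 + (- \<delta>) * 0)"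
        by (intro has_finite_part_add has_finite_part_cmult)
    qed simp
    then have "has_finite_part \<alpha> (\<lambda>N. S N * t N) (\<Sum>j\<le>Suc l. partial_faulhaber 1 l j * (0 + (- \<delta>) * 0))"
    proof (rule has_finite_part_cong)
      fix N :: nat assume N: "N \<ge> 1"
      have "(\<Sum>j\<le>Suc l. partial_faulhaber 1 l j * (npow N (- of_nat j) * T N + (- \<delta>) * (npow N (s - of_nat j) * mz_tail \<delta> ss N)))
        = (\<Sum>j\<le>Suc l. partial_faulhaber 1 l j * of_nat N ^ j) * t N"
        unfolding sum_distrib_right using N
        by (intro sum.cong refl) (simp add: npow_diff_of_nat npow_neg_of_nat t_def h_def algebra_simps)
      then show "(\<Sum>j\<le>Suc l. partial_faulhaber 1 l j * (npow N (- of_nat j) * T N + (- \<delta>) * (npow N (s - of_nat j) * mz_tail \<delta> ss N))) = S N * t N"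
        unfolding sum_partial_faulhaber S_def .
    qed
    then show ?thesis by simp
  qed
  ultimately have "has_finite_part \<alpha> (\<lambda>N. S N * t N + (- 1) * (S N * t N)) ((?L - ?R) + (- 1) * 0)"
    by (intro has_finite_part_add has_finite_part_cmult)
  then have "has_finite_part \<alpha> (\<lambda>N. 0) (?L - ?R)" by simp
  then show ?thesis using has_finite_part_zero[OF _ \<alpha>] by fastforce
qed

section \<open>The domain of absolute convergence\<close>

text \<open>Since \<open>mz_exp\<close> subtracts 1 per entry, the condition at the head says that
  the sum of the real parts exceeds the length of the list, as in
  \<open>convergence_domain\<close>.\<close>

primrec convergent_list :: "complex list \<Rightarrow> bool" where
  "convergent_list [] \<longleftrightarrow> True"
| "convergent_list (x # ys) \<longleftrightarrow> Re (x + mz_exp ys) > 1 \<and> convergent_list ys"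

lemma convergent_imp_regular: "convergent_list ss \<Longrightarrow> regular_list ss"
proof (induction ss)
  case (Cons x ys)
  have "x + mz_exp ys + of_nat t - 1 \<noteq> 0" for t
  proof
    assume "x + mz_exp ys + of_nat t - 1 = 0"
    then have "Re (x + mz_exp ys + of_nat t - 1) = 0" by simp
    then show False using Cons.prems by simp
  qed
  from this this[of 0] show ?case using Cons by auto
qed auto

lemma mz_tail_bound:
  assumes "regular_list ss"
  obtains C where "\<And>n. n \<ge> 1 \<Longrightarrow> norm (mz_tail \<delta> ss n) \<le> C * real n powr (- Re (mz_exp ss))"
proof -
  obtain K C where C: "\<And>n. n \<ge> 1 \<Longrightarrow>
    norm (mz_tail \<delta> ss n - (\<Sum>t<K. mz_coeff \<delta> ss t * npow n (mz_exp ss + of_nat t))) \<le> C * real n powr (- Re (mz_exp ss) - real K)"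
    using mz_tail_expansion[OF assms, of 0] by blast
  have "norm (mz_tail \<delta> ss n) \<le> (\<bar>C\<bar> + (\<Sum>t<K. norm (mz_coeff \<delta> ss t))) * real n powr (- Re (mz_exp ss))"
    if n: "n \<ge> 1" for n
  proof -
    let ?S = "\<Sum>t<K. mz_coeff \<delta> ss t * npow n (mz_exp ss + of_nat t)"
    have mono: "real n powr (- Re (mz_exp ss) - real t) \<le> real n powr (- Re (mz_exp ss))" for t :: nat
      using n by (intro powr_mono) auto
    have "norm ?S \<le> (\<Sum>t<K. norm (mz_coeff \<delta> ss t) * real n powr (- Re (mz_exp ss)))"
    proof (rule sum_norm_le)
      fix t
      show "norm (mz_coeff \<delta> ss t * npow n (mz_exp ss + of_nat t)) \<le> norm (mz_coeff \<delta> ss t) * real n powr (- Re (mz_exp ss))"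
        unfolding norm_mult norm_npow using mono[of t] by (intro mult_left_mono) auto
    qed
    moreover have "norm (mz_tail \<delta> ss n - ?S) \<le> \<bar>C\<bar> * real n powr (- Re (mz_exp ss))"
      using order_trans[OF C[OF n]] mono[of K] by (smt (verit) mult_mono powr_ge_zero abs_ge_self abs_ge_zero)
    ultimately show ?thesis
      using norm_triangle_sub[of "mz_tail \<delta> ss n" ?S] by (simp add: distrib_right sum_distrib_right)
  qed
  then show ?thesis by (rule that)
qed

text \<open>The genuine sum satisfies the recursion and tends to 0. The leading exponent has
  positive real part, so no term of the expansion has to be removed (\<open>K = 0\<close>), and
  uniqueness identifies the sum with the regularised tail.\<close>

lemma convergent_tail:
  fixes \<delta> :: complex
  assumes conv: "convergent_list (x # ys)"
  defines "f \<equiv> \<lambda>m. npow m x * mz_tail \<delta> ys m"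
  shows "n \<ge> 1 \<Longrightarrow> (f has_sum (mz_tail \<delta> (x # ys) n - \<delta> * f n)) {n<..}"
    and "(\<lambda>m. norm (f m)) summable_on {n<..}"
proof -
  let ?a = "x + mz_exp ys"
  have a: "Re ?a > 1" and ys: "convergent_list ys" using conv by auto
  obtain C where C: "\<And>n. n \<ge> 1 \<Longrightarrow> norm (mz_tail \<delta> ys n) \<le> C * real n powr (- Re (mz_exp ys))"
    using mz_tail_bound[OF convergent_imp_regular[OF ys]] by blast
  have bd: "norm (f m) \<le> C * real m powr (- Re ?a)" if "m \<ge> 1" for m
  proof -
    have "norm (f m) \<le> real m powr (- Re x) * (C * real m powr (- Re (mz_exp ys)))"
      unfolding f_def norm_mult norm_npow using C[OF that] by (rule mult_left_mono) simp
    also have "\<dots> = C * real m powr (- Re x + - Re (mz_exp ys))" by (simp only: powr_add mult.left_commute)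
    finally show ?thesis by simp
  qed
  have "summable (\<lambda>m. C * real m powr (- Re ?a))"
    using a by (intro summable_mult) (simp add: summable_real_powr_iff)
  then have sn: "summable (\<lambda>m. norm (f m))"
    by (rule summable_comparison_test'[where N = 1]) (use bd in auto)
  have sn': "summable (\<lambda>k. norm (f (k + Suc n)))" for n
    using sn by (subst summable_iff_shift[of "\<lambda>m. norm (f m)"])
  have bij: "bij_betw (\<lambda>k. k + Suc n) UNIV {n<..}" for n
    by (rule bij_betw_byWitness[where f' = "\<lambda>m. m - Suc n"]) auto
  define g where "g n = (\<Sum>k. f (k + Suc n))" for n
  have hs: "(f has_sum g n) {n<..}" for n
  proof -
    have "((\<lambda>k. f (k + Suc n)) has_sum g n) UNIV"
      using sn'[of n] unfolding g_def
      by (intro norm_summable_imp_has_sum summable_sums) (auto intro: summable_norm_cancel)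
    then show ?thesis using has_sum_reindex_bij_betw[where f = f and S = "g n", OF bij[of n]] by simp
  qed
  show "(\<lambda>m. norm (f m)) summable_on {n<..}"
  proof -
    have "(\<lambda>k. norm (f (k + Suc n))) summable_on UNIV"
      using sn'[of n] by (intro norm_summable_imp_summable_on) simp
    then show ?thesis using summable_on_reindex_bij_betw[where f = "\<lambda>m. norm (f m)", OF bij[of n]] by simp
  qed
  have g_step: "g n = g (Suc n) + f (Suc n)" for n
    unfolding g_def using suminf_split_head[OF summable_norm_cancel[OF sn'[of n]]] by simp
  have "g \<longlonglongrightarrow> 0"
  proof -
    have "g 0 - (\<Sum>k<n. f (k + Suc 0)) = g n" for n
      using suminf_minus_initial_segment[OF summable_norm_cancel[OF sn'[of 0]], of n]
      by (simp add: g_def)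
    then have eq: "(\<lambda>n. g 0 - (\<Sum>k<n. f (k + Suc 0))) = g" by (rule ext)
    have "(\<lambda>n. g 0 - (\<Sum>k<n. f (k + Suc 0))) \<longlonglongrightarrow> g 0 - g 0"
      unfolding g_def by (intro tendsto_diff tendsto_const summable_LIMSEQ summable_norm_cancel[OF sn'])
    then show ?thesis unfolding eq by simp
  qed
  then have "(\<lambda>N. g N - (\<Sum>t<0. plain_coeff ?a (mz_coeff \<delta> ys) t * npow N (?a - 1 + of_nat t))) \<longlonglongrightarrow> 0"
    by simp
  moreover have "Re (?a - 1) + real 0 > 0" using a by simp
  ultimately have "is_tail (?a - 1) (plain_coeff ?a (mz_coeff \<delta> ys)) f g"
    unfolding is_tail_def using g_step by blast
  from mz_tail_Cons[OF this[unfolded f_def]]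
  have "mz_tail \<delta> (x # ys) n = g n + \<delta> * f n" if "n \<ge> 1" using that by (simp only: f_def)
  then show "(f has_sum (mz_tail \<delta> (x # ys) n - \<delta> * f n)) {n<..}" if "n \<ge> 1"
    using hs[of n] that by simp
qed

section \<open>From iterated sums to sums over index tuples\<close>

definition chain_rel :: "bool \<Rightarrow> nat \<Rightarrow> nat \<Rightarrow> bool" where
  "chain_rel star m n \<longleftrightarrow> (if star then m \<le> n else m < n)"

text \<open>\<open>n\<close> bounds the indices from below, like the argument of
  \<open>mz_tail\<close>. All pairs are compared, not only neighbours, so that splitting off the
  first index leaves a set of the same form.\<close>

definition chains :: "bool \<Rightarrow> nat \<Rightarrow> nat \<Rightarrow> nat \<Rightarrow> (nat \<Rightarrow> nat) set" where
  "chains star r k n = {t \<in> {k..r} \<rightarrow>\<^sub>E {1..}.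
     (\<forall>i\<in>{k..r}. \<forall>j\<in>{k..r}. i < j \<longrightarrow> chain_rel star (t i) (t j)) \<and> (\<forall>i\<in>{k..r}. chain_rel star n (t i))}"

lemma chain_rel_trans: "chain_rel star a b \<Longrightarrow> chain_rel star b c \<Longrightarrow> chain_rel star a c"
  by (auto simp: chain_rel_def split: if_splits)

text \<open>The hypothesis on \<open>n\<close> keeps the split-off index positive: for
  \<open>n = 0\<close> the non-strict relation would admit the index 0.\<close>

lemma chains_bij:
  assumes k: "k \<le> r" and n: "\<And>m. chain_rel star n m \<Longrightarrow> m \<ge> 1"
  shows "bij_betw (\<lambda>(m, t). t(k := m)) (SIGMA m:{m. chain_rel star n m}. chains star r (Suc k) m) (chains star r k n)"
proof (rule bij_betw_byWitness[where f' = "\<lambda>t. (t k, t(k := undefined))"])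
  show "\<forall>a\<in>(SIGMA m:{m. chain_rel star n m}. chains star r (Suc k) m).
      (\<lambda>t. (t k, t(k := undefined))) ((\<lambda>(m, t). t(k := m)) a) = a"
  proof
    fix a assume a: "a \<in> (SIGMA m:{m. chain_rel star n m}. chains star r (Suc k) m)"
    obtain m t where mt: "a = (m, t)" by (cases a)
    have "t k = undefined" using a by (auto simp: mt chains_def PiE_iff extensional_def)
    then show "(\<lambda>t. (t k, t(k := undefined))) ((\<lambda>(m, t). t(k := m)) a) = a"
      by (auto simp: mt fun_eq_iff)
  qed
  show "\<forall>t\<in>chains star r k n. (\<lambda>(m, t). t(k := m)) (t k, t(k := undefined)) = t" by simp
  show "(\<lambda>(m, t). t(k := m)) ` (SIGMA m:{m. chain_rel star n m}. chains star r (Suc k) m) \<subseteq> chains star r k n"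
  proof safe
    fix m t assume m: "chain_rel star n m" and t: "t \<in> chains star r (Suc k) m"
    have "(t(k := m)) i \<ge> 1" if "i \<in> {k..r}" for i
      using t n[OF m] that by (cases "i = k") (auto simp: chains_def PiE_iff)
    moreover have "chain_rel star ((t(k := m)) i) ((t(k := m)) j)" if "i \<in> {k..r}" "j \<in> {k..r}" "i < j" for i j
      using t that by (cases "i = k") (auto simp: chains_def)
    moreover have "chain_rel star n ((t(k := m)) i)" if "i \<in> {k..r}" for i
    proof (cases "i = k")
      case False
      then have "chain_rel star m (t i)" using t that by (auto simp: chains_def)
      then show ?thesis using chain_rel_trans[OF m] False by simp
    qed (use m in simp)
    moreover have "t(k := m) \<in> extensional {k..r}"
      using t k by (auto simp: chains_def PiE_iff extensional_def)
    ultimately show "t(k := m) \<in> chains star r k n" unfolding chains_def PiE_iff by blast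
  qed
  show "(\<lambda>t. (t k, t(k := undefined))) ` chains star r k n \<subseteq> (SIGMA m:{m. chain_rel star n m}. chains star r (Suc k) m)"
    using k by (auto simp: chains_def PiE_iff extensional_def)
qed

lemma chains_has_sum:
  fixes h :: "(nat \<Rightarrow> nat) \<Rightarrow> 'a :: {topological_comm_monoid_add, t3_space}"
  assumes k: "k \<le> r" and n: "\<And>m. chain_rel star n m \<Longrightarrow> m \<ge> 1"
    and inner: "\<And>m. chain_rel star n m \<Longrightarrow> ((\<lambda>t. h (t(k := m))) has_sum g m) (chains star r (Suc k) m)"
    and outer: "(g has_sum S) {m. chain_rel star n m}"
    and summ: "(\<lambda>(m, t). h (t(k := m))) summable_on (SIGMA m:{m. chain_rel star n m}. chains star r (Suc k) m)"
  shows "(h has_sum S) (chains star r k n)"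
proof -
  have "((\<lambda>(m, t). h (t(k := m))) has_sum S) (SIGMA m:{m. chain_rel star n m}. chains star r (Suc k) m)"
    using inner outer summ by (intro has_sum_SigmaI[where g = g]) auto
  moreover have "(\<lambda>(m, t). h (t(k := m))) = (\<lambda>x. h ((\<lambda>(m, t). t(k := m)) x))" by (auto simp: fun_eq_iff)
  ultimately show ?thesis using has_sum_reindex_bij_betw[where f = h and S = S, OF chains_bij[OF k n]] by simp
qed

lemma chain_rel_set: "{m. chain_rel star n m} = (if star then insert n {n<..} else {n<..})"
  by (auto simp: chain_rel_def)

lemma convergent_rel_sum:
  fixes star
  defines "\<delta> \<equiv> (if star then 1 else 0 :: complex)"
  assumes conv: "convergent_list (x # ys)" and n: "n \<ge> 1"
  shows "((\<lambda>m. npow m x * mz_tail \<delta> ys m) has_sum mz_tail \<delta> (x # ys) n) {m. chain_rel star n m}"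
    and "(\<lambda>m. norm (npow m x * mz_tail \<delta> ys m)) summable_on {m. chain_rel star n m}"
proof -
  let ?f = "\<lambda>m. npow m x * mz_tail \<delta> ys m"
  note c = convergent_tail[where \<delta> = \<delta>, OF conv]
  show "(?f has_sum mz_tail \<delta> (x # ys) n) {m. chain_rel star n m}"
  proof (cases star)
    case True
    have "(?f has_sum (?f n + (mz_tail \<delta> (x # ys) n - \<delta> * ?f n))) (insert n {n<..})"
      by (intro has_sum_insert c(1)[OF n]) simp
    then show ?thesis using True by (simp add: chain_rel_set \<delta>_def)
  next
    case False
    then show ?thesis using c(1)[OF n] by (simp add: chain_rel_set \<delta>_def)
  qed
  show "(\<lambda>m. norm (?f m)) summable_on {m. chain_rel star n m}"
    using c(2)[where n = n] by (cases star) (simp_all add: chain_rel_set summable_on_insert_iff)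
qed

lemma prod_upd_first:
  fixes F :: "nat \<Rightarrow> nat \<Rightarrow> 'a::comm_monoid_mult"
  assumes "k \<le> r"
  shows "(\<Prod>i=k..r. F i ((t(k := m)) i)) = F k m * (\<Prod>i=Suc k..r. F i (t i))"
proof -
  have "(\<Prod>i=k..r. F i ((t(k := m)) i)) = F k ((t(k := m)) k) * (\<Prod>i=Suc k..r. F i ((t(k := m)) i))"
    using assms by (rule prod.atLeast_Suc_atMost)
  also have "(\<Prod>i=Suc k..r. F i ((t(k := m)) i)) = (\<Prod>i=Suc k..r. F i (t i))"
    by (intro prod.cong) auto
  finally show ?thesis by simp
qed

text \<open>The absolute value of \<open>n^(-s)\<close> is \<open>n^(-Re s)\<close>, so the sum of
  absolute values is the same sum at the real point \<open>s'\<close>. Treating \<open>s\<close> and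
  \<open>s'\<close> together gives the value and the absolute summability needed for Fubini;
  \<open>W\<close> and \<open>W'\<close> are the inner sums at the two points.\<close>

lemma chains_step:
  fixes s :: "nat \<Rightarrow> complex" and star r k n
  defines "s' \<equiv> \<lambda>i. complex_of_real (Re (s i))"
  assumes k: "k \<le> r" and ge1: "\<And>m. chain_rel star n m \<Longrightarrow> m \<ge> 1"
    and IH: "\<And>m. m \<ge> 1 \<Longrightarrow> \<exists>N. ((\<lambda>t. \<Prod>i=Suc k..r. norm (npow (t i) (s i))) has_sum N) (chains star r (Suc k) m) \<and> of_real N = W' m"
      "\<And>m. m \<ge> 1 \<Longrightarrow> ((\<lambda>t. \<Prod>i=Suc k..r. npow (t i) (s i)) has_sum W m) (chains star r (Suc k) m)"
    and V: "((\<lambda>m. npow m (s k) * W m) has_sum V) {m. chain_rel star n m}"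
    and V': "((\<lambda>m. npow m (s' k) * W' m) has_sum V') {m. chain_rel star n m}"
    and summ: "(\<lambda>m. norm (npow m (s' k) * W' m)) summable_on {m. chain_rel star n m}"
  shows "(\<exists>N. ((\<lambda>t. \<Prod>i=k..r. norm (npow (t i) (s i))) has_sum N) (chains star r k n) \<and> of_real N = V') \<and>
     ((\<lambda>t. \<Prod>i=k..r. npow (t i) (s i)) has_sum V) (chains star r k n)"
proof -
  define N where "N m = infsum (\<lambda>t. \<Prod>i=Suc k..r. norm (npow (t i) (s i))) (chains star r (Suc k) m)" for m
  have N: "((\<lambda>t. \<Prod>i=Suc k..r. norm (npow (t i) (s i))) has_sum N m) (chains star r (Suc k) m)"
    "of_real (N m) = W' m" if m: "m \<ge> 1" for m
  proof -
    obtain M where M: "((\<lambda>t. \<Prod>i=Suc k..r. norm (npow (t i) (s i))) has_sum M) (chains star r (Suc k) m)"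
      "of_real M = W' m" using IH(1)[OF m] by (elim exE conjE)
    have "N m = M" unfolding N_def by (rule infsumI[OF M(1)])
    with M show "((\<lambda>t. \<Prod>i=Suc k..r. norm (npow (t i) (s i))) has_sum N m) (chains star r (Suc k) m)"
      "of_real (N m) = W' m" by (simp_all only:)
  qed
  have N0: "N m \<ge> 0" if "m \<ge> 1" for m
    using N(1)[OF that] by (rule has_sum_nonneg) (auto intro: prod_nonneg)
  define \<phi> where "\<phi> m = norm (npow m (s k)) * N m" for m
  have f': "npow m (s' k) * W' m = of_real (\<phi> m)" if "m \<ge> 1" for m
  proof -
    have "npow m (s' k) = of_real (norm (npow m (s k)))"
      using that unfolding norm_npow by (simp add: s'_def npow_def powr_of_real[symmetric])
    then show ?thesis using N(2)[OF that] by (simp add: \<phi>_def)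
  qed
  have \<phi>0: "\<phi> m \<ge> 0" if "m \<ge> 1" for m using N0[OF that] by (simp add: \<phi>_def)
  have "(\<lambda>m. norm (npow m (s' k) * W' m)) summable_on {m. chain_rel star n m}"
    by (rule summ)
  then have \<phi>s: "\<phi> summable_on {m. chain_rel star n m}"
    by (rule summable_on_cong[THEN iffD1, rotated]) (use f' \<phi>0 ge1 in simp)
  then have \<phi>h: "(\<phi> has_sum infsum \<phi> {m. chain_rel star n m}) {m. chain_rel star n m}" by (rule has_sum_infsum)
  have val: "of_real (infsum \<phi> {m. chain_rel star n m}) = V'"
  proof -
    have "((\<lambda>m. complex_of_real (\<phi> m)) has_sum of_real (infsum \<phi> {m. chain_rel star n m})) {m. chain_rel star n m}"
      using \<phi>h by (rule has_sum_of_real)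
    then have "((\<lambda>m. npow m (s' k) * W' m) has_sum of_real (infsum \<phi> {m. chain_rel star n m})) {m. chain_rel star n m}"
      by (rule has_sum_cong[THEN iffD1, rotated]) (use f' ge1 in simp)
    then show ?thesis by (rule has_sum_unique) (rule V')
  qed
  have inner: "((\<lambda>t. \<Prod>i=k..r. norm (npow ((t(k := m)) i) (s i))) has_sum \<phi> m) (chains star r (Suc k) m)"
    if "chain_rel star n m" for m
    unfolding prod_upd_first[OF k, of "\<lambda>i x. norm (npow x (s i))"] \<phi>_def
    by (intro has_sum_cmult_right N(1) ge1 that)
  have sm: "(\<lambda>(m, t). \<Prod>i=k..r. norm (npow ((t(k := m)) i) (s i))) summable_on (SIGMA m:{m. chain_rel star n m}. chains star r (Suc k) m)"
    by (rule summable_on_SigmaI[where g = \<phi>]) (use inner \<phi>s in \<open>auto intro: prod_nonneg\<close>)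
  have 1: "((\<lambda>t. \<Prod>i=k..r. norm (npow (t i) (s i))) has_sum infsum \<phi> {m. chain_rel star n m}) (chains star r k n)"
    by (rule chains_has_sum[OF k ge1 inner \<phi>h sm])
  have 2: "((\<lambda>t. \<Prod>i=k..r. npow (t i) (s i)) has_sum V) (chains star r k n)"
  proof (rule chains_has_sum[OF k ge1])
    show "((\<lambda>t. \<Prod>i=k..r. npow ((t(k := m)) i) (s i)) has_sum npow m (s k) * W m) (chains star r (Suc k) m)"
      if "chain_rel star n m" for m
      unfolding prod_upd_first[OF k, of "\<lambda>i x. npow x (s i)"]
      by (intro has_sum_cmult_right IH(2) ge1 that)
    show "((\<lambda>m. npow m (s k) * W m) has_sum V) {m. chain_rel star n m}"
      by (rule V)
    have "(\<lambda>x. norm ((\<lambda>(m, t). \<Prod>i=k..r. npow ((t(k := m)) i) (s i)) x)) summable_on (SIGMA m:{m. chain_rel star n m}. chains star r (Suc k) m)"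
      using sm by (rule summable_on_cong[THEN iffD1, rotated]) (auto simp: prod_norm)
    then show "(\<lambda>(m, t). \<Prod>i=k..r. npow ((t(k := m)) i) (s i)) summable_on (SIGMA m:{m. chain_rel star n m}. chains star r (Suc k) m)"
      by (rule abs_summable_summable)
  qed
  from 1 2 val show ?thesis by blast
qed

lemma chains_abs:
  fixes star
  defines "\<delta> \<equiv> (if star then 1 else 0 :: complex)"
  assumes conv: "\<And>k. k \<ge> 1 \<Longrightarrow> convergent_list (map s [k..<Suc r])"
    and conv': "\<And>k. k \<ge> 1 \<Longrightarrow> convergent_list (map (\<lambda>i. of_real (Re (s i))) [k..<Suc r])"
    and k: "1 \<le> k" "k \<le> Suc r" and n: "n \<ge> 1"
  shows "(\<exists>N. ((\<lambda>t. \<Prod>i=k..r. norm (npow (t i) (s i))) has_sum N) (chains star r k n) \<and>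
            of_real N = mz_tail \<delta> (map (\<lambda>i. of_real (Re (s i))) [k..<Suc r]) n) \<and>
         ((\<lambda>t. \<Prod>i=k..r. npow (t i) (s i)) has_sum mz_tail \<delta> (map s [k..<Suc r]) n) (chains star r k n)"
  using k(2) n
proof (induction k arbitrary: n rule: inc_induct)
  case base
  \<comment> \<open>An empty index range leaves one function, with empty product 1, in accordance
    with \<open>mz_tail \<delta> [] = (\<lambda>n. 1)\<close>.\<close>
  have "chains star r (Suc r) n = {\<lambda>_. undefined}" by (auto simp: chains_def)
  then show ?case by (auto intro!: has_sum_finiteI exI[of _ 1])
next
  case (step k)
  have k: "k \<ge> 1" "k \<le> r" using step k(1) by auto
  let ?s' = "\<lambda>i. complex_of_real (Re (s i))"
  let ?W' = "mz_tail \<delta> (map ?s' [Suc k..<Suc r])" and ?W = "mz_tail \<delta> (map s [Suc k..<Suc r])"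
  have l: "map s [k..<Suc r] = s k # map s [Suc k..<Suc r]" "map ?s' [k..<Suc r] = ?s' k # map ?s' [Suc k..<Suc r]"
    by (rule map_upt_Cons[OF k(2)])+
  have c: "convergent_list (s k # map s [Suc k..<Suc r])" "convergent_list (?s' k # map ?s' [Suc k..<Suc r])"
    using conv[OF k(1)] conv'[OF k(1)] unfolding l by auto
  have ge1: "m \<ge> 1" if "chain_rel star n m" for m using that step.prems by (auto simp: chain_rel_def split: if_splits)
  have IH: "\<exists>N. ((\<lambda>t. \<Prod>i=Suc k..r. norm (npow (t i) (s i))) has_sum N) (chains star r (Suc k) m) \<and> of_real N = ?W' m"
    "((\<lambda>t. \<Prod>i=Suc k..r. npow (t i) (s i)) has_sum ?W m) (chains star r (Suc k) m)" if "m \<ge> 1" for m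
    using step.IH[OF that] by auto
  show ?case
  proof (rule chains_step[OF k(2) ge1 IH])
    show "((\<lambda>m. npow m (s k) * ?W m) has_sum mz_tail \<delta> (map s [k..<Suc r]) n) {m. chain_rel star n m}"
      unfolding l \<delta>_def by (rule convergent_rel_sum(1)[OF c(1) step.prems])
    show "((\<lambda>m. npow m (?s' k) * ?W' m) has_sum mz_tail \<delta> (map ?s' [k..<Suc r]) n) {m. chain_rel star n m}"
      unfolding l \<delta>_def by (rule convergent_rel_sum(1)[OF c(2) step.prems])
    show "(\<lambda>m. norm (npow m (?s' k) * ?W' m)) summable_on {m. chain_rel star n m}"
      unfolding \<delta>_def by (rule convergent_rel_sum(2)[OF c(2) step.prems])
  qed
qed

lemma sum_list_map_upt: "sum_list (map s [k..<Suc r]) = (\<Sum>i=k..r. s i)"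
proof -
  have "sum_list (map s [k..<Suc r]) = sum s (set [k..<Suc r])" by (rule interv_sum_list_conv_sum_set_nat)
  also have "set [k..<Suc r] = {k..r}" by auto
  finally show ?thesis .
qed

lemma convergent_map:
  assumes "\<And>k. 1 \<le> k \<Longrightarrow> k \<le> r \<Longrightarrow> Re (\<Sum>i=k..r. s i) > real (r - k) + 1" "1 \<le> k"
  shows "convergent_list (map s [k..<Suc r])"
proof (cases "k \<le> Suc r")
  case True
  then show ?thesis using assms(2)
  proof (induction k rule: inc_induct)
    case (step k)
    have k: "k \<le> r" "1 \<le> k" using step by auto
    have "(\<Sum>i=k..r. s i) = s k + (\<Sum>i=Suc k..r. s i)" using k(1) by (rule sum.atLeast_Suc_atMost)
    moreover have "s k + mz_exp (map s [Suc k..<Suc r]) = s k + (\<Sum>i=Suc k..r. s i) - of_nat (r - k)"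
      by (simp add: mz_exp_sum_list sum_list_map_upt del: upt_Suc)
    ultimately have "Re (s k + mz_exp (map s [Suc k..<Suc r])) > 1"
      using assms(1)[OF k(2,1)] by simp
    then show ?case using step k by (simp add: map_upt_Cons del: upt_Suc)
  qed simp
qed simp

lemma convergent_total:
  assumes "convergent_list (x # ys)"
  shows "((\<lambda>m. npow m x * mz_tail \<delta> ys m) has_sum mz_val \<delta> (x # ys)) {1..}"
    and "(\<lambda>m. norm (npow m x * mz_tail \<delta> ys m)) summable_on {1..}"
proof -
  let ?f = "\<lambda>m. npow m x * mz_tail \<delta> ys m"
  have set: "{1..} = insert (1::nat) {1<..}" by auto
  have "(?f has_sum (?f 1 + (mz_tail \<delta> (x # ys) 1 - \<delta> * ?f 1))) (insert 1 {1<..})"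
    by (intro has_sum_insert convergent_tail(1)[OF assms]) simp_all
  then show "(?f has_sum mz_val \<delta> (x # ys)) {1..}"
    unfolding set by (simp add: mz_val_def algebra_simps)
  show "(\<lambda>m. norm (?f m)) summable_on {1..}"
    unfolding set using convergent_tail(2)[OF assms, of \<delta> 1] by (simp add: summable_on_insert_iff)
qed

lemma zeta_term_npow: "zeta_term r s t = (\<Prod>i=1..r. npow (t i) (s i))"
  by (simp add: zeta_term_def npow_def powr_minus prod_inversef[symmetric] divide_inverse)

lemma series_eq_mz_val:
  assumes s: "s \<in> convergence_domain r" and r: "r \<ge> 1"
  shows "multi_zeta_series r s = mz_val 0 (map s [1..<Suc r])"
    and "multi_zeta_star_series r s = mz_val 1 (map s [1..<Suc r])"
proof -
  let ?s' = "\<lambda>i. complex_of_real (Re (s i))"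
  have Re: "Re (\<Sum>i=k..r. s i) > real (r - k) + 1" if "1 \<le> k" "k \<le> r" for k
  proof -
    have "r - k + 1 \<in> {1..r}" "r - (r - k + 1) + 1 = k" using that by auto
    then show ?thesis using s by (force simp: convergence_domain_def)
  qed
  have conv: "convergent_list (map s [k..<Suc r])" if "k \<ge> 1" for k
    using Re that by (rule convergent_map)
  have conv': "convergent_list (map ?s' [k..<Suc r])" if "k \<ge> 1" for k
    using _ that by (rule convergent_map) (use Re in simp)
  have sum: "((\<lambda>t. \<Prod>i=1..r. npow (t i) (s i)) has_sum mz_val \<delta> (map s [1..<Suc r])) (chains star r 1 n)"
    if d: "\<delta> = (if star then 1 else 0)" and n: "n = (if star then 1 else 0)" for \<delta> star n
  proof -
    have l: "map s [1..<Suc r] = s 1 # map s [Suc 1..<Suc r]" "map ?s' [1..<Suc r] = ?s' 1 # map ?s' [Suc 1..<Suc r]"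
      by (rule map_upt_Cons[OF r])+
    have c: "convergent_list (s 1 # map s [Suc 1..<Suc r])" "convergent_list (?s' 1 # map ?s' [Suc 1..<Suc r])"
      using conv[of 1] conv'[of 1] unfolding l by simp_all
    have chain_rel: "{m. chain_rel star n m} = {1..}" unfolding n by (auto simp: chain_rel_def)
    have ge1: "m \<ge> 1" if "chain_rel star n m" for m using that chain_rel by auto
    have "Suc 1 \<le> Suc r" using r by simp
    show ?thesis
    \<comment> \<open>\<open>chains_abs\<close> requires \<open>n \<ge> 1\<close>, whereas the
      strict sum starts from \<open>n = 0\<close>. The first index is therefore summed by hand, with
      total \<open>mz_val\<close>.\<close>
    proof (rule chains_step[OF r ge1, THEN conjunct2])
      show "\<exists>N. ((\<lambda>t. \<Prod>i=Suc 1..r. norm (npow (t i) (s i))) has_sum N) (chains star r (Suc 1) m) \<and>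
          of_real N = mz_tail \<delta> (map ?s' [Suc 1..<Suc r]) m" if "m \<ge> 1" for m
        using chains_abs[OF conv conv' _ \<open>Suc 1 \<le> Suc r\<close> that, of star] unfolding d by simp
      show "((\<lambda>t. \<Prod>i=Suc 1..r. npow (t i) (s i)) has_sum mz_tail \<delta> (map s [Suc 1..<Suc r]) m) (chains star r (Suc 1) m)"
        if "m \<ge> 1" for m
        using chains_abs[OF conv conv' _ \<open>Suc 1 \<le> Suc r\<close> that, of star] unfolding d by simp
      show "((\<lambda>m. npow m (s 1) * mz_tail \<delta> (map s [Suc 1..<Suc r]) m) has_sum mz_val \<delta> (map s [1..<Suc r])) {m. chain_rel star n m}"
        unfolding chain_rel l by (rule convergent_total(1)[OF c(1)])
      show "((\<lambda>m. npow m (?s' 1) * mz_tail \<delta> (map ?s' [Suc 1..<Suc r]) m) has_sum mz_val \<delta> (map ?s' [1..<Suc r])) {m. chain_rel star n m}"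
        unfolding chain_rel l by (rule convergent_total(1)[OF c(2)])
      show "(\<lambda>m. norm (npow m (?s' 1) * mz_tail \<delta> (map ?s' [Suc 1..<Suc r]) m)) summable_on {m. chain_rel star n m}"
        unfolding chain_rel by (rule convergent_total(2)[OF c(2)])
    qed
  qed
  have "{n \<in> {1..r} \<rightarrow>\<^sub>E {1..}. strict_mono_on {1..r} n} = chains False r 1 0"
    unfolding chains_def chain_rel_def by (auto simp: strict_mono_on_def PiE_iff Suc_le_eq)
  then show "multi_zeta_series r s = mz_val 0 (map s [1..<Suc r])"
    unfolding multi_zeta_series_def zeta_term_npow[abs_def] using sum[of 0 False 0] by (simp add: infsumI del: upt_Suc)
  have "mono_on {1..r} t \<longleftrightarrow> (\<forall>i\<in>{1..r}. \<forall>j\<in>{1..r}. i < j \<longrightarrow> t i \<le> t j)" for t :: "nat \<Rightarrow> nat"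
  proof
    show "mono_on {1..r} t \<Longrightarrow> \<forall>i\<in>{1..r}. \<forall>j\<in>{1..r}. i < j \<longrightarrow> t i \<le> t j"
      using less_imp_le by (blast dest: mono_onD)
    assume *: "\<forall>i\<in>{1..r}. \<forall>j\<in>{1..r}. i < j \<longrightarrow> t i \<le> t j"
    show "mono_on {1..r} t"
    proof (rule mono_onI)
      fix i j assume "i \<in> {1..r}" "j \<in> {1..r}" "i \<le> j"
      with * show "t i \<le> t j" by (cases "i = j") auto
    qed
  qed
  then have "{n \<in> {1..r} \<rightarrow>\<^sub>E {1..}. mono_on {1..r} n} = chains True r 1 1"
    unfolding chains_def chain_rel_def by (simp add: PiE_iff conj_comms)
  then show "multi_zeta_star_series r s = mz_val 1 (map s [1..<Suc r])"
    unfolding multi_zeta_star_series_def zeta_term_npow[abs_def] using sum[of 1 True 1] by (simp add: infsumI del: upt_Suc)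
qed

section \<open>Iterated limits\<close>

text \<open>An open set where a continuation is given by the series, from which the identity theorem
  can start: all real parts are at least 2 there, so a sum of \<open>k\<close> of them exceeds
  \<open>k\<close>.\<close>

lemma three_in_convergence_domain:
  assumes "z \<in> polydisc r (\<lambda>i\<in>{1..r}. 3) 1"
  shows "z \<in> convergence_domain r"
proof -
  have "real k < Re (\<Sum>i=r - k + 1..r. z i)" if k: "k \<in> {1..r}" for k
  proof -
    have "real k < (\<Sum>i=r - k + 1..r. 2)" using k by simp
    also have "\<dots> \<le> (\<Sum>i=r - k + 1..r. Re (z i))"
    proof (rule sum_mono)
      fix i assume "i \<in> {r - k + 1..r}"
      then have "norm (3 - z i) < 1" using assms by (auto simp: polydisc_iff dist_norm)
      then show "2 \<le> Re (z i)" using abs_Re_le_cmod[of "3 - z i"] by simp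
    qed
    finally show ?thesis by simp
  qed
  then show ?thesis using assms by (simp add: convergence_domain_def polydisc_iff)
qed

text \<open>\<open>mz_val\<close> is itself a continuation, so the \<open>SOME\<close> is inhabited;
  the chosen function agrees with it around \<open>(3, ..., 3)\<close> and hence generically near
  every point.\<close>

lemma continuation_generically_equal:
  assumes r: "r \<ge> 1" and series: "\<And>s. s \<in> convergence_domain r \<Longrightarrow> f s = mz_val \<delta> (map s [1..<Suc r])"
    and p: "p \<in> Cspace r"
  shows "generically_equal r (SOME F. meromorphic_continuation r f F) (\<lambda>s. mz_val \<delta> (map s [1..<Suc r])) p"
proof -
  let ?G = "\<lambda>s. mz_val \<delta> (map s [1..<Suc r])" and ?F = "SOME F. meromorphic_continuation r f F"
  have G: "meromorphic_several r ?G" by (rule meromorphic_mz_val[OF r])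
  have "meromorphic_continuation r f ?G" using G series by (simp add: meromorphic_continuation_def)
  then have F: "meromorphic_continuation r f ?F" by (rule someI[where P = "meromorphic_continuation r f"])
  let ?p = "\<lambda>i\<in>{1..r}. 3 :: complex"
  have eq: "generically_equal r ?F ?G ?p"
    unfolding generically_equal_def
  proof (intro exI[of _ 1] conjI exI[of _ "\<lambda>_. 1"] ballI impI)
    show "\<exists>z\<in>polydisc r ?p 1. (1::complex) \<noteq> 0" by (intro bexI[of _ ?p]) (auto simp: polydisc_iff)
    fix z assume "z \<in> polydisc r ?p 1"
    then have "z \<in> convergence_domain r" by (rule three_in_convergence_domain)
    then show "?F z = ?G z" using F series by (simp add: meromorphic_continuation_def)
  qed (simp_all add: holomorphic_several_const)
  have mero: "meromorphic_several r ?F" using F unfolding meromorphic_continuation_def by blast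
  have "?p \<in> Cspace r" by auto
  from meromorphic_several_unique[OF mero G this eq p] show ?thesis .
qed

lemma has_iterated_limit_continuation:
  assumes r: "r \<ge> 1" and series: "\<And>s. s \<in> convergence_domain r \<Longrightarrow> f s = mz_val \<delta> (map s [1..<Suc r])"
    and dist: "distinct is" "set is = {1..r}" and s: "s \<in> Cspace r"
    and lim: "has_iterated_limit is a (\<lambda>s. mz_val \<delta> (map s [1..<Suc r])) s v"
  shows "has_iterated_limit is a (SOME F. meromorphic_continuation r f F) s v"
  by (intro has_iterated_limit_cong[OF generically_equal_iter_eventually[OF _ dist s] lim]
        continuation_generically_equal[OF r series]) auto

text \<open>The innermost limit only has to be known for nested nearby outer variables. This removes
  one variable at a time from the inner end.\<close>

lemma has_iterated_limit_snoc:
  assumes "iter_eventually is a (\<lambda>s. ((\<lambda>z. F (s(k := z))) \<longlongrightarrow> G s) (at (a k))) s"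
    and "has_iterated_limit is a G s v"
  shows "has_iterated_limit (is @ [k]) a F s v"
  using assms
proof (induction "is" arbitrary: s v)
  case Nil
  then have "((\<lambda>z. F (s(k := z))) \<longlongrightarrow> v) (at (a k))"
    unfolding iter_eventually.simps has_iterated_limit.simps by blast
  then show ?case unfolding append_Nil has_iterated_limit.simps
    by (intro exI[of _ "\<lambda>z. F (s(k := z))"] conjI always_eventually allI refl)
next
  case (Cons i "is")
  from Cons.prems(2) obtain f where
    f: "\<forall>\<^sub>F z in at (a i). has_iterated_limit is a G (s(i := z)) (f z)" "(f \<longlongrightarrow> v) (at (a i))" by auto
  from Cons.prems(1) have "\<forall>\<^sub>F z in at (a i). iter_eventually is a
      (\<lambda>s. ((\<lambda>z. F (s(k := z))) \<longlongrightarrow> G s) (at (a k))) (s(i := z))"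
    unfolding iter_eventually.simps .
  with f(1) have "\<forall>\<^sub>F z in at (a i). has_iterated_limit (is @ [k]) a F (s(i := z)) (f z)"
    by eventually_elim (rule Cons.IH)
  with f(2) show ?case by auto
qed

lemma has_iterated_limit_sum:
  assumes "finite J" "\<And>j. j \<in> J \<Longrightarrow> has_iterated_limit is a (F j) s (v j)"
  shows "has_iterated_limit is a (\<lambda>s. \<Sum>j\<in>J. c j * F j s) s (\<Sum>j\<in>J. c j * v j)"
  using assms(2)
proof (induction "is" arbitrary: s v)
  case Nil
  then show ?case by auto
next
  case (Cons i "is")
  have "\<forall>j\<in>J. \<exists>f. (\<forall>\<^sub>F z in at (a i). has_iterated_limit is a (F j) (s(i := z)) (f z)) \<and> (f \<longlongrightarrow> v j) (at (a i))"
    using Cons.prems by auto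
  then obtain f where f: "\<And>j. j \<in> J \<Longrightarrow> \<forall>\<^sub>F z in at (a i). has_iterated_limit is a (F j) (s(i := z)) (f j z)"
    "\<And>j. j \<in> J \<Longrightarrow> (f j \<longlongrightarrow> v j) (at (a i))" by (auto dest!: bchoice)
  have "\<forall>\<^sub>F z in at (a i). \<forall>j\<in>J. has_iterated_limit is a (F j) (s(i := z)) (f j z)"
    using assms(1) f(1) by (simp add: eventually_ball_finite_distrib)
  then have "\<forall>\<^sub>F z in at (a i). has_iterated_limit is a (\<lambda>s. \<Sum>j\<in>J. c j * F j s) (s(i := z)) (\<Sum>j\<in>J. c j * f j z)"
    by eventually_elim (rule Cons.IH, blast)
  moreover have "((\<lambda>z. \<Sum>j\<in>J. c j * f j z) \<longlongrightarrow> (\<Sum>j\<in>J. c j * v j)) (at (a i))"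
    by (intro tendsto_sum tendsto_mult tendsto_const f(2))
  ultimately show ?case by auto
qed

text \<open>The arguments of \<open>reg_val\<close> are listed from the innermost limit variable to the outermost one.\<close>

function reg_val :: "complex \<Rightarrow> nat list \<Rightarrow> complex" where
  "reg_val \<delta> [] = 1"
| "reg_val \<delta> [l] = faulhaber 0 l 0"
| "reg_val \<delta> (l # m # ls) = (\<Sum>j\<le>Suc l. faulhaber \<delta> l j * reg_val \<delta> ((m + j) # ls))"
  by pat_completeness auto
termination by (relation "Wellfounded.measure (\<lambda>(\<delta>, ls). length ls)") auto

function rev_val :: "complex \<Rightarrow> nat list \<Rightarrow> complex" where
  "rev_val \<delta> [] = 1"
| "rev_val \<delta> [l] = faulhaber 0 l 0"
| "rev_val \<delta> (l # m # ls) = (\<Sum>j\<le>Suc l. partial_faulhaber \<delta> l j * rev_val \<delta> ((m + j) # ls))"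
  by pat_completeness auto
termination by (relation "Wellfounded.measure (\<lambda>(\<delta>, ls). length ls)") auto

lemma iter_eventually_True: "iter_eventually is a (\<lambda>s. True) s"
  by (induction "is" arbitrary: s) auto

text \<open>The shift \<open>j\<close> belongs to the statement because eliminating the last
  variable leaves the one before it shifted by each \<open>i \<le> Suc m\<close>, and the induction
  hypothesis must cover these.\<close>

lemma has_reg_limit:
  fixes l :: "nat \<Rightarrow> nat"
  defines "a \<equiv> \<lambda>i. - of_nat (l i)"
  shows "has_iterated_limit [1..<Suc (Suc k)] a (\<lambda>s. mz_val \<delta> (map s [1..<Suc k] @ [s (Suc k) - of_nat j])) s
     (reg_val \<delta> ((l (Suc k) + j) # rev (map l [1..<Suc k])))"
proof (induction k arbitrary: j)
  case 0
  have "((\<lambda>z. mz_val \<delta> ([] @ (z - of_nat j) # [])) \<longlongrightarrow> mz_val \<delta> ([] @ (a 1 - of_nat j) # [])) (at (a 1))"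
  proof (rule tendsto_compose_at[where f = "\<lambda>z. z - of_nat j" and g = "\<lambda>z. mz_val \<delta> ([] @ z # [])", unfolded o_def])
    show "((\<lambda>z. z - of_nat j) \<longlongrightarrow> a 1 - of_nat j) (at (a 1))" by (intro tendsto_intros)
    have "a 1 - of_nat j = - of_nat (l 1 + j)" by (simp add: a_def)
    then have "regular_list ([] @ (a 1 - of_nat j) # [])" using regular_single_neg[of "l 1 + j"] by simp
    then show "((\<lambda>z. mz_val \<delta> ([] @ z # [])) \<longlongrightarrow> mz_val \<delta> ([] @ (a 1 - of_nat j) # [])) (at (a 1 - of_nat j))"
      by (rule mz_val_tendsto)
  qed auto
  moreover have "a 1 - of_nat j = - of_nat (l 1 + j)" by (simp add: a_def)
  ultimately have "((\<lambda>z. mz_val \<delta> [z - of_nat j]) \<longlongrightarrow> faulhaber 0 (l 1 + j) 0) (at (a 1))"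
    using mz_val_neg[of \<delta> "l 1 + j"] by simp
  then show ?case by (auto intro!: exI[of _ "\<lambda>z. mz_val \<delta> [z - of_nat j]"])
next
  case (Suc k)
  let ?n = "Suc (Suc k)" and ?m = "l (Suc (Suc k)) + j"
  let ?F = "\<lambda>s. mz_val \<delta> (map s [1..<Suc (Suc k)] @ [s ?n - of_nat j])"
  let ?G = "\<lambda>s. \<Sum>i\<le>Suc ?m. faulhaber \<delta> ?m i * mz_val \<delta> (map s [1..<Suc k] @ [s (Suc k) - of_nat i])"
  have an: "a ?n - of_nat j = - of_nat ?m" by (simp add: a_def)
  have up: "[1..<Suc (Suc (Suc k))] = [1..<Suc (Suc k)] @ [?n]" "[1..<Suc (Suc k)] = [1..<Suc k] @ [Suc k]" by simp_all
  have "has_iterated_limit ([1..<Suc (Suc k)] @ [?n]) a ?F s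
     (\<Sum>i\<le>Suc ?m. faulhaber \<delta> ?m i * reg_val \<delta> ((l (Suc k) + i) # rev (map l [1..<Suc k])))"
  proof (rule has_iterated_limit_snoc)
    show "has_iterated_limit [1..<Suc (Suc k)] a ?G s
        (\<Sum>i\<le>Suc ?m. faulhaber \<delta> ?m i * reg_val \<delta> ((l (Suc k) + i) # rev (map l [1..<Suc k])))"
      by (rule has_iterated_limit_sum) (simp, rule Suc.IH)
    show "iter_eventually [1..<Suc (Suc k)] a (\<lambda>s. ((\<lambda>z. ?F (s(?n := z))) \<longlongrightarrow> ?G s) (at (a ?n))) s"
    proof (rule iter_eventually_mono)
      fix s :: "nat \<Rightarrow> complex"
      assume s: "regular_list (map s [1..<Suc (Suc k)] @ [- of_nat ?m])"
      have "((\<lambda>z. mz_val \<delta> (map s [1..<Suc (Suc k)] @ (z - of_nat j) # [])) \<longlongrightarrow>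
          mz_val \<delta> (map s [1..<Suc (Suc k)] @ (a ?n - of_nat j) # [])) (at (a ?n))"
      proof (rule tendsto_compose_at[where f = "\<lambda>z. z - of_nat j" and g = "\<lambda>z. mz_val \<delta> (map s [1..<Suc (Suc k)] @ z # [])", unfolded o_def])
        show "((\<lambda>z. z - of_nat j) \<longlongrightarrow> a ?n - of_nat j) (at (a ?n))" by (intro tendsto_intros)
        show "((\<lambda>z. mz_val \<delta> (map s [1..<Suc (Suc k)] @ z # [])) \<longlongrightarrow>
          mz_val \<delta> (map s [1..<Suc (Suc k)] @ (a ?n - of_nat j) # [])) (at (a ?n - of_nat j))"
          unfolding an by (rule mz_val_tendsto[OF s])
      qed auto
      moreover have "mz_val \<delta> (map s [1..<Suc (Suc k)] @ (a ?n - of_nat j) # []) = ?G s"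
        using mz_val_last_neg[of "map s [1..<Suc k]" "s (Suc k)" ?m \<delta>] s
        unfolding an up(2) map_append by (simp del: upt_Suc sum.atMost_Suc)
      ultimately show "((\<lambda>z. ?F (s(?n := z))) \<longlongrightarrow> ?G s) (at (a ?n))"
        by (simp del: upt_Suc sum.atMost_Suc)
    next
      have sum: "\<forall>\<^sub>F z in at (a (Suc k)). regular_list (map (s(Suc k := z)) [1..<Suc (Suc k)] @ [- of_nat ?m])" for s
      proof -
        \<comment> \<open>It is enough that \<open>z\<close>, the entry before the last, is generic:
          every denominator except that of the last entry involves \<open>z\<close>, and the last
          entry is a nonpositive integer. The outer variables may be arbitrary.\<close>
        have reg: "\<forall>\<^sub>F z in at b. regular_list (xs @ [z, - of_nat ?m])" for b and xs :: "complex list"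
        proof (induction xs)
          case Nil
          have "\<forall>\<^sub>F z in at b. z + - of_nat ?m \<notin> \<int>" by (rule eventually_add_notin_Ints)
          then show ?case
            by eventually_elim (use regular_single_neg[of ?m] generic_imp_regular_Cons[of _ "[- of_nat ?m]"] in simp)
        next
          case (Cons x xs)
          have "\<forall>\<^sub>F z in at b. z + (x + sum_list xs - of_nat ?m) \<notin> \<int>" by (rule eventually_add_notin_Ints)
          with Cons show ?case
          proof eventually_elim
            case (elim z)
            then have "x + sum_list (xs @ [z, - of_nat ?m]) \<notin> \<int>" by (simp add: algebra_simps)
            from generic_imp_regular_Cons[OF this] elim(1) show ?case by simp
          qed
        qed
        show ?thesis unfolding up(2) using reg[where b = "a (Suc k)" and xs = "map s [1..<Suc k]"] by (simp del: upt_Suc)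
      qed
      show "iter_eventually [1..<Suc (Suc k)] a (\<lambda>s. regular_list (map s [1..<Suc (Suc k)] @ [- of_nat ?m])) s"
        unfolding up(2) iter_eventually_append
        by (rule iter_eventually_mono[OF iter_eventually_True])
          (simp only: iter_eventually.simps, rule sum[unfolded up(2)])
    qed
  qed
  moreover have "reg_val \<delta> (?m # rev (map l [1..<Suc (Suc k)]))
      = (\<Sum>i\<le>Suc ?m. faulhaber \<delta> ?m i * reg_val \<delta> ((l (Suc k) + i) # rev (map l [1..<Suc k])))"
    unfolding up(2) map_append rev_append by (simp only: list.map rev.simps append.simps reg_val.simps)
  ultimately show ?case unfolding up(1) by (simp only:)
qed

text \<open>Here variables disappear from the front, and all remaining ones must be generic, since
  \<open>mz_val_first_neg\<close> extracts finite parts relative to a non-integral exponent.\<close>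

lemma has_rev_limit:
  fixes l :: "nat \<Rightarrow> nat"
  defines "a \<equiv> \<lambda>i. - of_nat (l i)"
  assumes "k \<le> r"
  shows "has_iterated_limit (rev [k..<Suc r]) a (\<lambda>s. mz_val \<delta> ((s k - of_nat j) # map s [Suc k..<Suc r])) s
     (rev_val \<delta> ((l k + j) # map l [Suc k..<Suc r]))"
  using assms(2)
proof (induction k arbitrary: j rule: inc_induct)
  case base
  have e: "a r - of_nat j = - of_nat (l r + j)" by (simp add: a_def)
  have "((\<lambda>z. mz_val \<delta> ([] @ (z - of_nat j) # [])) \<longlongrightarrow> mz_val \<delta> ([] @ (a r - of_nat j) # [])) (at (a r))"
  proof (rule tendsto_compose_at[where f = "\<lambda>z. z - of_nat j" and g = "\<lambda>z. mz_val \<delta> ([] @ z # [])", unfolded o_def])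
    show "((\<lambda>z. z - of_nat j) \<longlongrightarrow> a r - of_nat j) (at (a r))" by (intro tendsto_intros)
    show "((\<lambda>z. mz_val \<delta> ([] @ z # [])) \<longlongrightarrow> mz_val \<delta> ([] @ (a r - of_nat j) # [])) (at (a r - of_nat j))"
      by (rule mz_val_tendsto) (use regular_single_neg[of "l r + j"] in \<open>simp add: e\<close>)
  qed auto
  then have "((\<lambda>z. mz_val \<delta> [z - of_nat j]) \<longlongrightarrow> faulhaber 0 (l r + j) 0) (at (a r))"
    using mz_val_neg[of \<delta> "l r + j"] by (simp add: e)
  then show ?case by (auto intro!: exI[of _ "\<lambda>z. mz_val \<delta> [z - of_nat j]"])
next
  case (step k)
  let ?m = "l k + j" and ?ss = "\<lambda>s. map s [Suc (Suc k)..<Suc r]"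
  let ?F = "\<lambda>s. mz_val \<delta> ((s k - of_nat j) # map s [Suc k..<Suc r])"
  let ?G = "\<lambda>s. \<Sum>i\<le>Suc ?m. partial_faulhaber \<delta> ?m i * mz_val \<delta> ((s (Suc k) - of_nat i) # ?ss s)"
  have k: "Suc k \<le> r" using step by simp
  have ak: "a k - of_nat j = - of_nat ?m" by (simp add: a_def)
  have up: "rev [k..<Suc r] = rev [Suc k..<Suc r] @ [k]" using k by (simp add: upt_conv_Cons del: upt_Suc)
  have mp: "map s [Suc k..<Suc r] = s (Suc k) # map s [Suc (Suc k)..<Suc r]" for s :: "nat \<Rightarrow> 'b"
    using k by (simp add: upt_conv_Cons del: upt_Suc)
  have "has_iterated_limit (rev [Suc k..<Suc r] @ [k]) a ?F s
     (\<Sum>i\<le>Suc ?m. partial_faulhaber \<delta> ?m i * rev_val \<delta> ((l (Suc k) + i) # map l [Suc (Suc k)..<Suc r]))"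
  proof (rule has_iterated_limit_snoc)
    show "has_iterated_limit (rev [Suc k..<Suc r]) a ?G s
        (\<Sum>i\<le>Suc ?m. partial_faulhaber \<delta> ?m i * rev_val \<delta> ((l (Suc k) + i) # map l [Suc (Suc k)..<Suc r]))"
      by (rule has_iterated_limit_sum) (simp, rule step.IH)
    show "iter_eventually (rev [Suc k..<Suc r]) a (\<lambda>s. ((\<lambda>z. ?F (s(k := z))) \<longlongrightarrow> ?G s) (at (a k))) s"
    proof (rule iter_eventually_mono[OF iter_eventually_generic])
      fix s :: "nat \<Rightarrow> complex" assume gen: "generic_list (map s [Suc k..<Suc r])"
      have s: "regular_list ([] @ - of_nat ?m # map s [Suc k..<Suc r])"
        using generic_imp_regular[OF generic_shift(2)[OF gen[unfolded mp]]] unfolding mp append_Nil .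
      have "((\<lambda>z. mz_val \<delta> ([] @ (z - of_nat j) # map s [Suc k..<Suc r])) \<longlongrightarrow>
          mz_val \<delta> ([] @ (a k - of_nat j) # map s [Suc k..<Suc r])) (at (a k))"
      proof (rule tendsto_compose_at[where f = "\<lambda>z. z - of_nat j" and g = "\<lambda>z. mz_val \<delta> ([] @ z # map s [Suc k..<Suc r])", unfolded o_def])
        show "((\<lambda>z. z - of_nat j) \<longlongrightarrow> a k - of_nat j) (at (a k))" by (intro tendsto_intros)
        show "((\<lambda>z. mz_val \<delta> ([] @ z # map s [Suc k..<Suc r])) \<longlongrightarrow>
          mz_val \<delta> ([] @ (a k - of_nat j) # map s [Suc k..<Suc r])) (at (a k - of_nat j))"
          unfolding ak by (rule mz_val_tendsto[OF s])
      qed auto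
      moreover have "mz_val \<delta> ((a k - of_nat j) # map s [Suc k..<Suc r]) = ?G s"
        unfolding ak mp by (rule mz_val_first_neg[OF gen[unfolded mp]])
      ultimately show "((\<lambda>z. ?F (s(k := z))) \<longlongrightarrow> ?G s) (at (a k))"
        by (simp del: upt_Suc sum.atMost_Suc)
    qed (use k in simp)
  qed
  then show ?case unfolding up by (simp add: mp del: upt_Suc sum.atMost_Suc)
qed

text \<open>The coefficient contains the Bernoulli number of index \<open>Suc l - j\<close>. From
  index 2 on the odd ones vanish, and at index 1 the extra summand of the reflection is exactly the
  added \<delta>.\<close>

lemma faulhaber_reflect:
  assumes "j \<le> Suc l" shows "faulhaber 1 l j = (-1) ^ (Suc l - j) * faulhaber 0 l j"
proof -
  consider "j = Suc l" | "j = l" | "j < l" using assms by linarith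
  then show ?thesis
  proof cases
    case 2
    then show ?thesis using bern_coeff_reflect[of 1] by (simp add: faulhaber_def em_gamma_def)
  next
    case 3
    then have "(-1) ^ (Suc l - j) * bern_coeff (Suc l - j) = bern_coeff (Suc l - j)" using bern_coeff_reflect[of "Suc l - j"] by simp
    then show ?thesis using 3 by (simp add: faulhaber_def em_gamma_def mult.assoc[symmetric])
  qed (simp add: faulhaber_def em_gamma_def)
qed

lemma sign_shift:
  assumes "j \<le> Suc l"
  shows "(-1) ^ (length (l # m # ls) + sum_list (l # m # ls)) * (-1) ^ (Suc l - j)
    = ((-1) ^ (length ((m + j) # ls) + sum_list ((m + j) # ls)) :: complex)"
proof -
  have "even (length (l # m # ls) + sum_list (l # m # ls) + (Suc l - j)) \<longleftrightarrow>
      even (length ((m + j) # ls) + sum_list ((m + j) # ls))" using assms by auto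
  then show ?thesis unfolding power_add[symmetric] minus_one_power_iff[where n = "_ + (Suc l - j)"]
    minus_one_power_iff[where n = "length ((m + j) # ls) + _"] by (simp only:)
qed

text \<open>The trivial zeros of zeta. At \<open>l = 0\<close> the Bernoulli number is
  \<open>B_1\<close>, the one nonzero of odd index, which is why 0 is excluded.\<close>

lemma faulhaber_0_even: "even l \<Longrightarrow> l \<ge> 1 \<Longrightarrow> faulhaber 0 l 0 = 0"
  using bern_coeff_odd[of "Suc l"] by (simp add: faulhaber_0)

lemma faulhaber_0_sign: "l \<ge> 1 \<Longrightarrow> faulhaber 0 l 0 = (-1) ^ Suc l * faulhaber 0 l 0"
  using faulhaber_0_even[of l] by (cases "even l") auto

text \<open>\<open>l \<ge> 1\<close> matters at \<open>j = 0\<close> only, where the additional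
  constant \<open>zeta(-l)\<close> has to be compatible with the sign; for positive \<open>j\<close>
  this is the reflection of \<open>faulhaber\<close>.\<close>

lemma partial_faulhaber_reflect:
  assumes "j \<le> Suc l" "l \<ge> 1"
  shows "partial_faulhaber 1 l j = (-1) ^ (Suc l - j) * partial_faulhaber 0 l j"
proof (cases "j = 0")
  case True
  have "faulhaber 1 l 0 = faulhaber 0 l 0" using faulhaber_reflect[of 0 l] faulhaber_0_sign[OF assms(2)] by simp
  then show ?thesis using True by (simp add: partial_faulhaber_def)
next
  case False
  then show ?thesis using faulhaber_reflect[OF assms(1)] by (simp add: partial_faulhaber_def flip: power_add mult.assoc)
qed

lemma sign_combine:
  fixes x :: complex
  assumes "x' = t * y'" "p * e = t" "y = e * x"
  shows "x * x' = p * (y * y')"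
  using assms by (auto simp: mult_ac)

text \<open>The last entry belongs to the outermost variable. Elimination never decreases it, so the
  depth-one value reached at the end is \<open>zeta(-m)\<close> with
  \<open>m \<ge> 1\<close>.\<close>

lemma reg_val_sign:
  assumes "ls \<noteq> []" "last ls \<ge> 1"
  shows "reg_val 0 ls = (-1) ^ (length ls + sum_list ls) * reg_val 1 ls"
  using assms
proof (induction "0 :: complex" ls rule: reg_val.induct)
  case (2 l)
  then show ?case using faulhaber_0_sign[of l] by simp
next
  case (3 l m ls)
  have "reg_val 0 (l # m # ls) = (\<Sum>j\<le>Suc l. (-1) ^ (length (l # m # ls) + sum_list (l # m # ls)) * (faulhaber 1 l j * reg_val 1 ((m + j) # ls)))"
    unfolding reg_val.simps
  proof (intro sum.cong refl)
    fix j assume j: "j \<in> {..Suc l}"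
    have "reg_val 0 ((m + j) # ls) = (-1) ^ (length ((m + j) # ls) + sum_list ((m + j) # ls)) * reg_val 1 ((m + j) # ls)"
      by (rule 3) (use 3 j in \<open>auto split: if_splits\<close>)
    moreover have "(-1) ^ (length (l # m # ls) + sum_list (l # m # ls)) * (-1) ^ (Suc l - j)
        = ((-1) ^ (length ((m + j) # ls) + sum_list ((m + j) # ls)) :: complex)"
      using j by (intro sign_shift) simp
    ultimately show "faulhaber 0 l j * reg_val 0 ((m + j) # ls)
       = (-1) ^ (length (l # m # ls) + sum_list (l # m # ls)) * (faulhaber 1 l j * reg_val 1 ((m + j) # ls))"
      by (rule sign_combine) (use faulhaber_reflect[of j l] j in simp)
  qed
  then show ?case by (simp only: sum_distrib_left reg_val.simps)
qed simp

lemma rev_val_sign: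
  assumes "ls \<noteq> []" "hd ls \<ge> 1"
  shows "rev_val 0 ls = (-1) ^ (length ls + sum_list ls) * rev_val 1 ls"
  using assms
proof (induction "0 :: complex" ls rule: rev_val.induct)
  case (2 l)
  then show ?case using faulhaber_0_sign[of l] by simp
next
  case (3 l m ls)
  have l: "l \<ge> 1" using 3 by simp
  have "rev_val 0 (l # m # ls) = (\<Sum>j\<le>Suc l. (-1) ^ (length (l # m # ls) + sum_list (l # m # ls)) * (partial_faulhaber 1 l j * rev_val 1 ((m + j) # ls)))"
    unfolding rev_val.simps
  proof (intro sum.cong refl)
    fix j assume j: "j \<in> {..Suc l}"
    show "partial_faulhaber 0 l j * rev_val 0 ((m + j) # ls)
       = (-1) ^ (length (l # m # ls) + sum_list (l # m # ls)) * (partial_faulhaber 1 l j * rev_val 1 ((m + j) # ls))"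
    \<comment> \<open>For \<open>j = 0\<close> the new head \<open>m\<close> may be 0, out of reach
      of the induction hypothesis, but the coefficient vanishes. For \<open>j \<ge> 1\<close> the
      head \<open>m + j\<close> is positive again.\<close>
    proof (cases "j = 0")
      case True
      have "partial_faulhaber 0 l 0 = 0"
        using faulhaber_reflect[of 0 l] faulhaber_0_sign[OF l] by (simp add: partial_faulhaber_def)
      then show ?thesis using True partial_faulhaber_reflect[of 0 l] l by simp
    next
      case False
      have "rev_val 0 ((m + j) # ls) = (-1) ^ (length ((m + j) # ls) + sum_list ((m + j) # ls)) * rev_val 1 ((m + j) # ls)"
        by (rule 3) (use 3 j False in auto)
      moreover have "(-1) ^ (length (l # m # ls) + sum_list (l # m # ls)) * (-1) ^ (Suc l - j)
          = ((-1) ^ (length ((m + j) # ls) + sum_list ((m + j) # ls)) :: complex)"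
        using j by (intro sign_shift) simp
      ultimately show ?thesis by (rule sign_combine) (use partial_faulhaber_reflect[of j l] j l in simp)
    qed
  qed
  then show ?case by (simp only: sum_distrib_left rev_val.simps)
qed simp

lemma iter_value_unique: "has_reg_value r F l v \<Longrightarrow> reg_value r F l = v"
  "has_rev_value r F l v \<Longrightarrow> rev_value r F l = v"
  unfolding reg_value_def rev_value_def has_reg_value_def has_rev_value_def
  by (blast intro: has_iterated_limit_unique)+

lemma has_reg_value_continuation:
  assumes r: "r \<ge> 1" and series: "\<And>s. s \<in> convergence_domain r \<Longrightarrow> f s = mz_val \<delta> (map s [1..<Suc r])"
  shows "has_reg_value r (SOME F. meromorphic_continuation r f F) l (reg_val \<delta> (rev (map l [1..<Suc r])))"
proof -
  obtain k where k: "r = Suc k" using r by (cases r) auto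
  have "has_iterated_limit [1..<Suc r] (\<lambda>i. - of_nat (l i)) (\<lambda>s. mz_val \<delta> (map s [1..<Suc r])) (\<lambda>i\<in>{1..r}. 0)
     (reg_val \<delta> (rev (map l [1..<Suc r])))"
    using has_reg_limit[of k l \<delta> 0] unfolding k by simp
  then show ?thesis unfolding has_reg_value_def
    by (intro has_iterated_limit_continuation[OF r series]) auto
qed

lemma has_rev_value_continuation:
  assumes r: "r \<ge> 1" and series: "\<And>s. s \<in> convergence_domain r \<Longrightarrow> f s = mz_val \<delta> (map s [1..<Suc r])"
  shows "has_rev_value r (SOME F. meromorphic_continuation r f F) l (rev_val \<delta> (map l [1..<Suc r]))"
proof -
  have "has_iterated_limit (rev [1..<Suc r]) (\<lambda>i. - of_nat (l i)) (\<lambda>s. mz_val \<delta> (map s [1..<Suc r])) (\<lambda>i\<in>{1..r}. 0)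
     (rev_val \<delta> (map l [1..<Suc r]))"
    using has_rev_limit[of 1 r l \<delta> 0] r by (simp add: map_upt_Cons[OF r] upt_conv_Cons del: upt_Suc)
  then show ?thesis unfolding has_rev_value_def
    by (intro has_iterated_limit_continuation[OF r series]) auto
qed

theorem theorem3p10:
  fixes r :: nat and l :: "nat \<Rightarrow> nat"
  assumes "r \<ge> 1" and "l 1 \<ge> 1"
  shows "((\<exists>v. has_reg_value r (multi_zeta r) l v) \<and>
          (\<exists>v. has_reg_value r (multi_zeta_star r) l v) \<and>
          reg_value r (multi_zeta r) l
            = (-1) ^ (r + (\<Sum>i=1..r. l i)) * reg_value r (multi_zeta_star r) l) \<and>
         ((\<exists>v. has_rev_value r (multi_zeta r) l v) \<and>
          (\<exists>v. has_rev_value r (multi_zeta_star r) l v) \<and>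
          rev_value r (multi_zeta r) l
            = (-1) ^ (r + (\<Sum>i=1..r. l i)) * rev_value r (multi_zeta_star r) l)"
proof -
  let ?ls = "map l [1..<Suc r]"
  have ls: "?ls = l 1 # map l [Suc 1..<Suc r]" using assms(1) by (simp add: upt_conv_Cons del: upt_Suc)
  have sum: "length ?ls + sum_list ?ls = r + (\<Sum>i=1..r. l i)"
    by (simp add: interv_sum_list_conv_sum_set_nat atLeastLessThanSuc_atLeastAtMost del: upt_Suc)
  have reg: "has_reg_value r (multi_zeta r) l (reg_val 0 (rev ?ls))" "has_reg_value r (multi_zeta_star r) l (reg_val 1 (rev ?ls))"
    unfolding multi_zeta_def multi_zeta_star_def
    by (intro has_reg_value_continuation series_eq_mz_val assms(1); assumption)+
  have rev: "has_rev_value r (multi_zeta r) l (rev_val 0 ?ls)" "has_rev_value r (multi_zeta_star r) l (rev_val 1 ?ls)"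
    unfolding multi_zeta_def multi_zeta_star_def
    by (intro has_rev_value_continuation series_eq_mz_val assms(1); assumption)+
  \<comment> \<open>\<open>reg_val\<close> reads from the innermost variable outwards, so its list
    is reversed and its last entry is \<open>l 1\<close>.\<close>
  have "reg_val 0 (rev ?ls) = (-1) ^ (length (rev ?ls) + sum_list (rev ?ls)) * reg_val 1 (rev ?ls)"
    using assms(2) unfolding ls by (intro reg_val_sign) (simp_all del: upt_Suc)
  moreover have "rev_val 0 ?ls = (-1) ^ (length ?ls + sum_list ?ls) * rev_val 1 ?ls"
    using assms(2) unfolding ls by (intro rev_val_sign) (simp_all del: upt_Suc)
  ultimately show ?thesis
    using reg rev iter_value_unique(1)[OF reg(1)] iter_value_unique(1)[OF reg(2)]
      iter_value_unique(2)[OF rev(1)] iter_value_unique(2)[OF rev(2)]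
    by (simp only: length_rev sum_list_rev sum) blast
qed

end
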